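(* Let $f$ be a polynomial diffeomorphism of $\mathbb C^2$ of dynamical degree $d>1$. Let $f$ be quasi-expanding and quasi-contracting, and let the singular locus $\mathcal C$ be finite. Then for each tangency $r\in\mathcal T$ there are points $p,q\in\mathcal C$ such that $r\in W^s(p)\cap W^u(q)$.
   Context: $f:\mathbb C^2\to\mathbb C^2$ is a polynomial diffeomorphism of dynamical degree $d>1$ (up to polynomial conjugacy, a finite composition of generalized Hénon maps, of degree $d$). $K^\pm$ is the set of points with bounded forward/backward orbit, $J^\pm=\partial K^\pm$, $G^{\pm}(x)=\lim_{n\to\infty}d^{-n}\log^+\|f^{\pm n}(x)\|$. $J^*$ is the closure of the set of saddle (periodic) points. Fix a normalized invariant family $\psi_S=\{\psi_x:x\in S\}$ for $f$: $S\subset J^*$ is dense with $f(S)=S$, and each $\psi_x:\mathbb C\to\mathbb C^2$ is an injective holomorphic immersion such that (i) $x\in\psi_x(\mathbb C)\subset J^-$; (ii) $f(\psi_x(\mathbb C))=\psi_{fx}(\mathbb C)$, and the sets $\psi_{x_1}(\mathbb C),\psi_{x_2}(\mathbb C)$ are disjoint or equal; (iii) $\psi_x(0)=x$, $\max_{|\zeta|\le1}G^+(\psi_x(\zeta))=1$. (Example: $S$ the saddle points, $\psi_x$ normalized uniformizations of unstable manifolds.) $f$ is quasi-expanding if $\psi_S$ is a normal family; $f$ is quasi-contracting if $f^{-1}$ is quasi-expanding. For $x\in J^*$, $\Psi^u_x$ is the set of entire maps that are locally uniform limits of $\psi_{y_j}$, $S\ni y_j\to x$; when $f$ is quasi-expanding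 these are all non-constant. $\mathrm{Ord}(\psi)=\min\{n\ge1:\psi^{(n)}(0)\ne0\}$, $\tau^u(x)=\sup_{\psi\in\Psi^u_x}\mathrm{Ord}(\psi)$, and $E^u_x$ is the complex line spanned by $\psi^{(n)}(0)$, $n=\mathrm{Ord}(\psi)$, which does not depend on $\psi\in\Psi^u_x$. $\tau^s$ and $E^s_x$ are the corresponding objects for $f^{-1}$ (with $G^-$, $J^+$ replacing $G^+$, $J^-$). $\mathcal J_{1,1}=\{x\in J^*:\tau^s(x)=\tau^u(x)=1\}$; the singular locus is $\mathcal C=J^*-\mathcal J_{1,1}$; the set of tangencies is $\mathcal T=\{x\in J^*:E^s_x=E^u_x\}$. (When $\mathcal C$ is finite it consists of saddle points.) $W^s(p),W^u(p)$ are stable and unstable manifolds. *)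

theory Defs
  imports "HOL-Analysis.Analysis"
begin

section \<open>Polynomial diffeomorphisms of the complex plane squared\<close>

definition poly_map_le :: "nat \<Rightarrow> (complex^2 \<Rightarrow> complex^2) \<Rightarrow> bool" where
  "poly_map_le N f \<longleftrightarrow> (\<exists>c :: nat \<Rightarrow> nat \<Rightarrow> complex^2.
     \<forall>x. f x = (\<Sum>(i,j)\<in>{(i,j). i + j \<le> N}. (x$1 ^ i * x$2 ^ j) *s c i j))"

definition poly_map :: "(complex^2 \<Rightarrow> complex^2) \<Rightarrow> bool" where
  "poly_map f \<longleftrightarrow> (\<exists>N. poly_map_le N f)"

definition poly_map_degree :: "(complex^2 \<Rightarrow> complex^2) \<Rightarrow> nat" where
  "poly_map_degree f = (LEAST N. poly_map_le N f)"

definition poly_diffeo :: "(complex^2 \<Rightarrow> complex^2) \<Rightarrow> bool" where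
  "poly_diffeo f \<longleftrightarrow> bij f \<and> poly_map f \<and> poly_map (inv f)"

text \<open>The limit exists because the degree is submultiplicative under composition.  It is
  invariant under polynomial conjugacy, equals the algebraic degree for a composition of
  generalized Henon maps, and takes the same value on \<open>f\<close> and \<open>inv f\<close>.\<close>

definition dyn_degree :: "(complex^2 \<Rightarrow> complex^2) \<Rightarrow> real" where
  "dyn_degree f = lim (\<lambda>n. root n (real (poly_map_degree (f ^^ n))))"

section \<open>Invariant sets\<close>

text \<open>Objects with superscript plus are attached to \<open>f\<close>; their minus counterparts are obtained
  by applying the same definition to \<open>inv f\<close>.\<close>

definition K_plus :: "(complex^2 \<Rightarrow> complex^2) \<Rightarrow> (complex^2) set" where
  "K_plus f = {x. bounded (range (\<lambda>n. (f ^^ n) x))}"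

definition J_plus :: "(complex^2 \<Rightarrow> complex^2) \<Rightarrow> (complex^2) set" where
  "J_plus f = frontier (K_plus f)"

abbreviation J_minus :: "(complex^2 \<Rightarrow> complex^2) \<Rightarrow> (complex^2) set" where
  "J_minus f \<equiv> J_plus (inv f)"

definition log_plus :: "real \<Rightarrow> real" where
  "log_plus t = ln (max 1 t)"

definition G_plus :: "(complex^2 \<Rightarrow> complex^2) \<Rightarrow> complex^2 \<Rightarrow> real" where
  "G_plus f x = lim (\<lambda>n. log_plus (norm ((f ^^ n) x)) / dyn_degree f ^ n)"

definition saddle_points :: "(complex^2 \<Rightarrow> complex^2) \<Rightarrow> (complex^2) set" where
  "saddle_points f = {x. \<exists>n\<ge>1. (f ^^ n) x = x \<and>
     (\<exists>A \<alpha> \<beta> v w. ((f ^^ n) has_derivative A) (at x) \<and>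
        v \<noteq> 0 \<and> A v = \<alpha> *s v \<and> cmod \<alpha> < 1 \<and>
        w \<noteq> 0 \<and> A w = \<beta> *s w \<and> cmod \<beta> > 1)}"

definition J_star :: "(complex^2 \<Rightarrow> complex^2) \<Rightarrow> (complex^2) set" where
  "J_star f = closure (saddle_points f)"

text \<open>For a saddle point \<open>p\<close> this is the stable manifold; the unstable manifold of \<open>f\<close> is
  the stable manifold of \<open>inv f\<close>.\<close>

definition W_stable :: "(complex^2 \<Rightarrow> complex^2) \<Rightarrow> complex^2 \<Rightarrow> (complex^2) set" where
  "W_stable f p = {x. (\<lambda>n. dist ((f ^^ n) x) ((f ^^ n) p)) \<longlonglongrightarrow> 0}"

abbreviation W_unstable :: "(complex^2 \<Rightarrow> complex^2) \<Rightarrow> complex^2 \<Rightarrow> (complex^2) set" where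
  "W_unstable f \<equiv> W_stable (inv f)"

section \<open>Entire maps into the complex plane squared\<close>

definition entire_map :: "(complex \<Rightarrow> complex^2) \<Rightarrow> bool" where
  "entire_map g \<longleftrightarrow> (\<forall>i. (\<lambda>\<zeta>. g \<zeta> $ i) holomorphic_on UNIV)"

definition nth_deriv :: "nat \<Rightarrow> (complex \<Rightarrow> complex^2) \<Rightarrow> complex \<Rightarrow> complex^2" where
  "nth_deriv n g \<zeta> = (\<chi> i. (deriv ^^ n) (\<lambda>z. g z $ i) \<zeta>)"

definition inj_hol_immersion :: "(complex \<Rightarrow> complex^2) \<Rightarrow> bool" where
  "inj_hol_immersion g \<longleftrightarrow> entire_map g \<and> inj g \<and> (\<forall>\<zeta>. nth_deriv 1 g \<zeta> \<noteq> 0)"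

definition loc_unif_limit ::
    "(nat \<Rightarrow> complex \<Rightarrow> complex^2) \<Rightarrow> (complex \<Rightarrow> complex^2) \<Rightarrow> bool" where
  "loc_unif_limit h g \<longleftrightarrow> (\<forall>C. compact C \<longrightarrow> uniform_limit C h g sequentially)"

text \<open>Convergence to infinity is not admitted as a limit.  This is no restriction for the
  families below, whose members take values in the compact set \<open>J_star f\<close> at \<open>0\<close>.\<close>

definition normal_family :: "(complex \<Rightarrow> complex^2) set \<Rightarrow> bool" where
  "normal_family F \<longleftrightarrow> (\<forall>h. (\<forall>n. h n \<in> F) \<longrightarrow>
     (\<exists>r g. strict_mono (r :: nat \<Rightarrow> nat) \<and> loc_unif_limit (h \<circ> r) g))"

definition Ord :: "(complex \<Rightarrow> complex^2) \<Rightarrow> nat" where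
  "Ord g = (LEAST n. n \<ge> 1 \<and> nth_deriv n g 0 \<noteq> 0)"

section \<open>Normalized invariant families and quasi-expansion\<close>

definition normalized_invariant_family ::
    "(complex^2 \<Rightarrow> complex^2) \<Rightarrow> (complex^2) set \<Rightarrow> (complex^2 \<Rightarrow> complex \<Rightarrow> complex^2) \<Rightarrow> bool"
  where
  "normalized_invariant_family f S \<psi> \<longleftrightarrow>
     S \<subseteq> J_star f \<and> J_star f \<subseteq> closure S \<and> f ` S = S \<and>
     (\<forall>x\<in>S. inj_hol_immersion (\<psi> x)) \<and>
     (\<forall>x\<in>S. x \<in> range (\<psi> x) \<and> range (\<psi> x) \<subseteq> J_minus f) \<and>
     (\<forall>x\<in>S. f ` range (\<psi> x) = range (\<psi> (f x))) \<and>
     (\<forall>x1\<in>S. \<forall>x2\<in>S. range (\<psi> x1) \<inter> range (\<psi> x2) = {} \<or> range (\<psi> x1) = range (\<psi> x2)) \<and>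
     (\<forall>x\<in>S. \<psi> x 0 = x \<and>
        (\<exists>\<zeta>\<in>cball 0 1. G_plus f (\<psi> x \<zeta>) = 1) \<and> (\<forall>\<zeta>\<in>cball 0 1. G_plus f (\<psi> x \<zeta>) \<le> 1))"

text \<open>Quasi-expansion of \<open>f\<close>, tested on the fixed normalized invariant family.\<close>

definition quasi_expanding ::
    "(complex^2 \<Rightarrow> complex^2) \<Rightarrow> (complex^2) set \<Rightarrow> (complex^2 \<Rightarrow> complex \<Rightarrow> complex^2) \<Rightarrow> bool"
  where
  "quasi_expanding f S \<psi> \<longleftrightarrow> normalized_invariant_family f S \<psi> \<and> normal_family (\<psi> ` S)"

text \<open>Here the family is one for \<open>inv f\<close>.\<close>

abbreviation quasi_contracting ::
    "(complex^2 \<Rightarrow> complex^2) \<Rightarrow> (complex^2) set \<Rightarrow> (complex^2 \<Rightarrow> complex \<Rightarrow> complex^2) \<Rightarrow> bool"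
  where
  "quasi_contracting f \<equiv> quasi_expanding (inv f)"

definition limit_maps ::
    "(complex^2) set \<Rightarrow> (complex^2 \<Rightarrow> complex \<Rightarrow> complex^2) \<Rightarrow> complex^2
      \<Rightarrow> (complex \<Rightarrow> complex^2) set" where
  "limit_maps S \<psi> x = {g. entire_map g \<and>
     (\<exists>y. (\<forall>j. y j \<in> S) \<and> y \<longlonglongrightarrow> x \<and> loc_unif_limit (\<lambda>j. \<psi> (y j)) g)}"

definition tau ::
    "(complex^2) set \<Rightarrow> (complex^2 \<Rightarrow> complex \<Rightarrow> complex^2) \<Rightarrow> complex^2 \<Rightarrow> enat" where
  "tau S \<psi> x = (SUP g\<in>limit_maps S \<psi> x. enat (Ord g))"

text \<open>The definite description expresses that the line does not depend on the limit map.\<close>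

definition E_line ::
    "(complex^2) set \<Rightarrow> (complex^2 \<Rightarrow> complex \<Rightarrow> complex^2) \<Rightarrow> complex^2 \<Rightarrow> (complex^2) set" where
  "E_line S \<psi> x =
     (THE L. \<forall>g\<in>limit_maps S \<psi> x. L = vec.span {nth_deriv (Ord g) g 0})"

text \<open>In the next two definitions \<open>Su\<close>, \<open>\<psi>u\<close> is a family for \<open>f\<close>, giving the unstable objects,
  and \<open>Ss\<close>, \<open>\<psi>s\<close> is a family for \<open>inv f\<close>, giving the stable ones.\<close>

definition singular_locus ::
    "(complex^2 \<Rightarrow> complex^2)
      \<Rightarrow> (complex^2) set \<Rightarrow> (complex^2 \<Rightarrow> complex \<Rightarrow> complex^2)
      \<Rightarrow> (complex^2) set \<Rightarrow> (complex^2 \<Rightarrow> complex \<Rightarrow> complex^2) \<Rightarrow> (complex^2) set" where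
  "singular_locus f Su \<psi>u Ss \<psi>s =
     J_star f - {x \<in> J_star f. tau Ss \<psi>s x = 1 \<and> tau Su \<psi>u x = 1}"

definition tangencies ::
    "(complex^2 \<Rightarrow> complex^2)
      \<Rightarrow> (complex^2) set \<Rightarrow> (complex^2 \<Rightarrow> complex \<Rightarrow> complex^2)
      \<Rightarrow> (complex^2) set \<Rightarrow> (complex^2 \<Rightarrow> complex \<Rightarrow> complex^2) \<Rightarrow> (complex^2) set" where
  "tangencies f Su \<psi>u Ss \<psi>s = {x \<in> J_star f. E_line Ss \<psi>s x = E_line Su \<psi>u x}"

end

theory Submission
  imports Defs "HOL-Complex_Analysis.Conformal_Mappings" "HOL-Computational_Algebra.Fundamental_Theorem_Algebra"
begin

text \<open>
  Let \<open>r\<close> be a tangency. If \<open>r\<close> lies in the singular locus, then \<open>p = q = r\<close> will do. Otherwise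
  both orders are one at \<open>r\<close>, and the lines \<open>E\<close> are spanned by the derivatives at \<open>0\<close> of an
  unstable and a stable limit map (\<open>E_line_eq\<close>), so these derivatives are parallel. The
  diffeomorphism \<open>f ^^ n\<close> maps the leaf of \<open>x \<in> Su\<close> onto the leaf of its image, and in the
  normalized parametrizations it is multiplication by a number (\<open>ex_multiplier\<close>). This multiplier
  tends to infinity with \<open>n\<close>, uniformly in \<open>x\<close> (\<open>mult_unbounded\<close>): otherwise a limit of leaves
  would consist of points with bounded forward orbits, while the escape rate \<open>G_plus f\<close> attains
  the value one on every normalized unit disk. On the other hand the stable multipliers have
  modulus at least one, so that the derivative of \<open>f ^^ n\<close> does not expand the common direction at
  \<open>r\<close> beyond a fixed bound. Comparing the two, the derivatives at \<open>0\<close> of the unstable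
  parametrizations near \<open>(f ^^ n) r\<close> can be made arbitrarily small
  (\<open>small_derivative_near_orbit\<close>). Hence every limit point of the forward orbit of \<open>r\<close> has a limit
  map of order greater than one and belongs to the singular locus (\<open>limit_points_singular\<close>). So
  the limit set is finite, and the orbit of \<open>r\<close> is asymptotic to the orbit of one of its points
  (\<open>finite_limit_set_shadowing\<close>). This is \<open>p\<close>; the same argument for \<open>inv f\<close> gives \<open>q\<close>.

  Two analytic facts enter. First, injective holomorphic immersions of the plane with the same
  image differ by an affine change of parameter (\<open>reparametrization_affine\<close>). This gives the
  multipliers and, together with the persistence of transversal crossings, the independence of \<open>E\<close>
  of the limit map (\<open>limits_tangent\<close>). Second, the limit defining the escape rate exists, is
  multiplied by the dynamical degree under \<open>f\<close>, and tends to zero at points with bounded forward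
  orbit (\<open>green_function\<close>).

  The second fact, and with it that \<open>inv f\<close> has dynamical degree greater than one, rests on the
  algebra of plane polynomial automorphisms. Of the degrees of the two components of an
  automorphism the smaller divides the larger when it is positive (\<open>degree_divides\<close>), and then one
  leading form is proportional to a power of the other (\<open>top_power_relation\<close>). So shears reduce
  the degree (\<open>jung_decomposition\<close>), the leading form of an automorphism of degree at least two is
  a power of a linear form times a fixed vector (\<open>top_form_structure\<close>), and a conjugate of minimal
  degree is regular: the linear form does not vanish on the vector (\<open>regular_conjugate\<close>). For a
  regular map the degrees of the iterates are the powers of its degree, the escape rate is the
  limit of a decreasing sequence, and escaping orbits leave in the direction of the vector. The
  last property shows that passing back to \<open>f\<close> multiplies the escape rate by a constant
  (\<open>escape_rate_image\<close>).
\<close>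

section \<open>Polynomial functions and their leading forms\<close>

text \<open>Polynomial functions of degree at most \<open>N\<close>. The inductive form (constants, sums, products
  with a coordinate) makes degree bounds and leading forms provable by rule induction.\<close>

inductive poly_le :: "nat \<Rightarrow> (complex^2 \<Rightarrow> complex) \<Rightarrow> bool" where
  poly_le_const: "poly_le N (\<lambda>z. c)"
| poly_le_add: "poly_le N F \<Longrightarrow> poly_le N G \<Longrightarrow> poly_le N (\<lambda>z. F z + G z)"
| poly_le_coord: "poly_le N F \<Longrightarrow> poly_le (Suc N) (\<lambda>z. z $ i * F z)"

text \<open>Homogeneous polynomial functions of degree \<open>N\<close>; the zero function is one for every \<open>N\<close>.\<close>

inductive homog :: "nat \<Rightarrow> (complex^2 \<Rightarrow> complex) \<Rightarrow> bool" where
  homog_const: "homog 0 (\<lambda>z. c)"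
| homog_add: "homog N F \<Longrightarrow> homog N G \<Longrightarrow> homog N (\<lambda>z. F z + G z)"
| homog_coord: "homog N F \<Longrightarrow> homog (Suc N) (\<lambda>z. z $ i * F z)"

text \<open>Polynomial functions of degree less than \<open>N\<close>; for \<open>N = 0\<close> only the zero function.\<close>

definition lower :: "nat \<Rightarrow> (complex^2 \<Rightarrow> complex) \<Rightarrow> bool" where
  "lower N F \<longleftrightarrow> (if N = 0 then F = (\<lambda>z. 0) else poly_le (N - 1) F)"

text \<open>\<open>T\<close> is the homogeneous part of degree \<open>N\<close> of a polynomial function \<open>F\<close> of degree at
  most \<open>N\<close>. It vanishes if the degree is smaller.\<close>

definition has_top :: "nat \<Rightarrow> (complex^2 \<Rightarrow> complex) \<Rightarrow> (complex^2 \<Rightarrow> complex) \<Rightarrow> bool" where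
  "has_top N F T \<longleftrightarrow> homog N T \<and> lower N (\<lambda>z. F z - T z)"

lemma poly_le_mono: "poly_le N F \<Longrightarrow> N \<le> M \<Longrightarrow> poly_le M F"
proof (induction arbitrary: M rule: poly_le.induct)
  case (poly_le_coord N F i)
  then obtain M' where "M = Suc M'" "N \<le> M'" by (cases M) auto
  then show ?case using poly_le_coord poly_le.poly_le_coord by blast
qed (auto intro: poly_le.intros)

lemma poly_le_cmult: "poly_le N F \<Longrightarrow> poly_le N (\<lambda>z. a * F z)"
proof (induction rule: poly_le.induct)
  case (poly_le_coord N F i)
  have "(\<lambda>z. a * (z $ i * F z)) = (\<lambda>z. z $ i * (a * F z))" by (auto simp: algebra_simps)
  then show ?case using poly_le.poly_le_coord[OF poly_le_coord(2)] by simp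
next
  case (poly_le_add N F G)
  then show ?case using poly_le.poly_le_add by (simp add: distrib_left)
qed (auto intro: poly_le.intros)

lemma poly_le_diff: "poly_le N F \<Longrightarrow> poly_le N G \<Longrightarrow> poly_le N (\<lambda>z. F z - G z)"
  using poly_le_add[of N F "\<lambda>z. (-1) * G z"] poly_le_cmult[of N G "-1"] by simp

lemma poly_le_sum: "(\<And>x. x \<in> A \<Longrightarrow> poly_le N (F x)) \<Longrightarrow> poly_le N (\<lambda>z. \<Sum>x\<in>A. F x z)"
  by (induction A rule: infinite_finite_induct) (auto intro: poly_le.intros)

lemma poly_le_mult:
  assumes F: "poly_le N F" and G: "poly_le M G"
  shows "poly_le (N + M) (\<lambda>z. F z * G z)"
  using F
proof (induction rule: poly_le.induct)
  case (poly_le_const N c)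
  then show ?case using poly_le_mono[OF poly_le_cmult[OF G]] by simp
next
  case (poly_le_add N F1 F2)
  then show ?case using poly_le.poly_le_add by (simp add: distrib_right)
next
  case (poly_le_coord N F i)
  then show ?case using poly_le.poly_le_coord[of "N+M" "\<lambda>z. F z * G z" i] by (simp add: mult.assoc)
qed

lemma poly_le_var: "poly_le 1 (\<lambda>z. z $ i)"
  using poly_le_coord[OF poly_le_const[of 0 1], of i] by simp

lemma poly_le_power: "poly_le N F \<Longrightarrow> poly_le (k * N) (\<lambda>z. F z ^ k)"
proof (induction k)
  case 0 then show ?case by (simp add: poly_le_const)
next
  case (Suc k) then show ?case using poly_le_mult[of N F "k*N" "\<lambda>z. F z ^ k"] by simp
qed

lemma poly_le_compose:
  assumes "poly_le N F" and g: "\<And>i. poly_le M (\<lambda>z. g z $ i)"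
  shows "poly_le (N * M) (\<lambda>z. F (g z))"
  using assms(1)
proof (induction rule: poly_le.induct)
  case (poly_le_coord N F i)
  then show ?case using poly_le_mult[OF g poly_le_coord(2), of i] by simp
qed (auto intro: poly_le.intros)

lemma homog_zero: "homog N (\<lambda>z. 0)"
proof (induction N)
  case 0 show ?case by (rule homog_const)
next
  case (Suc N) then show ?case using homog_coord[of N "\<lambda>z. 0"] by simp
qed

lemma homog_imp_poly_le: "homog N T \<Longrightarrow> poly_le N T"
  by (induction rule: homog.induct) (auto intro: poly_le.intros)

lemma homog_cmult: "homog N F \<Longrightarrow> homog N (\<lambda>z. a * F z)"
proof (induction rule: homog.induct)
  case (homog_coord N F i)
  have "(\<lambda>z. a * (z $ i * F z)) = (\<lambda>z. z $ i * (a * F z))" by (auto simp: algebra_simps)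
  then show ?case using homog.homog_coord[OF homog_coord(2)] by simp
next
  case (homog_add N F G)
  then show ?case using homog.homog_add by (simp add: distrib_left)
qed (auto intro: homog.intros)

lemma homog_scale: "homog N T \<Longrightarrow> T (c *s z) = c ^ N * T z"
  by (induction rule: homog.induct) (auto simp: algebra_simps)

lemma lower_imp_poly_le: "lower N L \<Longrightarrow> poly_le N L"
  by (cases N) (auto simp: lower_def poly_le_const elim: poly_le_mono)

lemma lower_zero: "lower N (\<lambda>z. 0)"
  by (auto simp: lower_def intro: poly_le_const)

lemma lower_add: "lower N F \<Longrightarrow> lower N G \<Longrightarrow> lower N (\<lambda>z. F z + G z)"
  by (auto simp: lower_def intro: poly_le_add split: if_splits)

lemma lower_coord: "lower N F \<Longrightarrow> lower (Suc N) (\<lambda>z. z $ i * F z)"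
  by (cases N) (auto simp: lower_def intro: poly_le_const poly_le_coord)

lemma lower_Suc: "lower (Suc N) F \<longleftrightarrow> poly_le N F"
  by (simp add: lower_def)

lemma ex_top:
  assumes "poly_le N F"
  obtains T where "has_top N F T"
proof -
  have "\<exists>T. has_top N F T"
    using assms
  proof (induction rule: poly_le.induct)
    case (poly_le_const N c)
    show ?case
    proof (cases N)
      case 0
      then show ?thesis
        by (intro exI[of _ "\<lambda>z. c"]) (simp add: has_top_def homog_const lower_zero)
    next
      case (Suc n)
      then show ?thesis
        by (intro exI[of _ "\<lambda>z. 0"]) (simp add: has_top_def homog_zero lower_Suc poly_le.poly_le_const)
    qed
  next
    case (poly_le_add N F G)
    then obtain T U where T: "has_top N F T" and U: "has_top N G U" by auto
    have "(\<lambda>z. F z + G z - (T z + U z)) = (\<lambda>z. (F z - T z) + (G z - U z))" by auto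
    then have "has_top N (\<lambda>z. F z + G z) (\<lambda>z. T z + U z)"
      using T U lower_add[of N "\<lambda>z. F z - T z" "\<lambda>z. G z - U z"] homog_add[of N T U]
      unfolding has_top_def by simp
    then show ?case by blast
  next
    case (poly_le_coord N F i)
    then obtain T where T: "has_top N F T" by auto
    have "has_top (Suc N) (\<lambda>z. z $ i * F z) (\<lambda>z. z $ i * T z)"
      using T lower_coord[of N "\<lambda>z. F z - T z" i] homog_coord[of N T i]
      unfolding has_top_def by (simp add: right_diff_distrib)
    then show ?case by blast
  qed
  then show ?thesis using that by blast
qed

lemma has_top_imp_poly_le: "has_top N F T \<Longrightarrow> poly_le N F"
  using poly_le_add[OF homog_imp_poly_le lower_imp_poly_le, of N T "\<lambda>z. F z - T z"]
  by (simp add: has_top_def)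

lemma homog_has_top: "homog N T \<Longrightarrow> has_top N T T"
  by (simp add: has_top_def lower_zero)

lemma has_top_zero_imp: "has_top (Suc N) F (\<lambda>z. 0) \<Longrightarrow> poly_le N F"
  by (simp add: has_top_def lower_Suc)

lemma norm_smult: "norm (c *s z) = norm c * norm (z :: complex^2)"
  by (simp add: norm_vec_def L2_set_def norm_mult power_mult_distrib flip: sum_distrib_left)
    (simp add: real_sqrt_mult)

lemma poly_le_growth:
  assumes "poly_le N F"
  obtains C where "C > 0" "\<And>z. norm (F z) \<le> C * (1 + norm z) ^ N"
proof -
  have "\<exists>C>0. \<forall>z. norm (F z) \<le> C * (1 + norm z) ^ N"
    using assms
  proof (induction rule: poly_le.induct)
    case (poly_le_const N c)
    have "norm c \<le> (norm c + 1) * (1 + norm z) ^ N" for z :: "complex^2"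
      using one_le_power[of "1 + norm z" N]
      by (smt (verit) mult_le_cancel_left1 norm_ge_zero)
    then show ?case by (intro exI[of _ "norm c + 1"]) (auto simp: add_nonneg_pos)
  next
    case (poly_le_add N F G)
    then obtain C D where "C > 0" "D > 0"
      "\<And>z. norm (F z) \<le> C * (1 + norm z) ^ N" "\<And>z. norm (G z) \<le> D * (1 + norm z) ^ N" by auto
    then show ?case
      by (intro exI[of _ "C + D"]) (auto simp: distrib_right intro: norm_triangle_le add_mono)
  next
    case (poly_le_coord N F i)
    then obtain C where C: "C > 0" "\<And>z. norm (F z) \<le> C * (1 + norm z) ^ N" by auto
    have "norm (z $ i * F z) \<le> C * (1 + norm z) ^ Suc N" for z
    proof -
      have "norm (z $ i) \<le> 1 + norm z"
        by (meson Finite_Cartesian_Product.norm_nth_le add_increasing zero_le_one)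
      then have "norm (z $ i) * norm (F z) \<le> (1 + norm z) * (C * (1 + norm z) ^ N)"
        using C by (intro mult_mono) auto
      then show ?thesis by (simp add: norm_mult mult_ac)
    qed
    then show ?case using C by auto
  qed
  then show ?thesis using that by blast
qed

lemma poly_le_continuous: "poly_le N F \<Longrightarrow> continuous_on S F"
  by (induction rule: poly_le.induct) (auto intro!: continuous_intros)

lemma lower_scaled_tendsto_0:
  fixes s :: "'a \<Rightarrow> complex" and w :: "'a \<Rightarrow> complex^2"
  assumes L: "lower N L" and s: "filterlim s at_infinity Fl" and w: "(w \<longlongrightarrow> z) Fl"
  shows "((\<lambda>n. L (s n *s w n) / s n ^ N) \<longlongrightarrow> 0) Fl"
proof (cases N)
  case 0
  then show ?thesis using L by (simp add: lower_def)
next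
  case (Suc M)
  then obtain C where C: "C > 0" "\<And>z. norm (L z) \<le> C * (1 + norm z) ^ M"
    using L poly_le_growth by (metis lower_Suc)
  have inv0: "((\<lambda>n. inverse (norm (s n))) \<longlongrightarrow> 0) Fl"
    using tendsto_norm[OF filterlim_compose[OF tendsto_inverse_0 s]] by (simp add: norm_inverse)
  have "((\<lambda>n. C * (inverse (norm (s n)) + norm (w n)) ^ M * inverse (norm (s n))) \<longlongrightarrow>
          C * (0 + norm z) ^ M * 0) Fl"
    by (intro tendsto_intros inv0 w)
  then have lim: "((\<lambda>n. C * (inverse (norm (s n)) + norm (w n)) ^ M * inverse (norm (s n))) \<longlongrightarrow> 0) Fl"
    by simp
  have ev: "\<forall>\<^sub>F n in Fl. s n \<noteq> 0"
    using s eventually_not_equal_at_infinity[of 0] filterlim_iff by blast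
  show ?thesis
  proof (rule Lim_null_comparison[OF _ lim])
    show "\<forall>\<^sub>F n in Fl. norm (L (s n *s w n) / s n ^ N)
            \<le> C * (inverse (norm (s n)) + norm (w n)) ^ M * inverse (norm (s n))"
      using ev
    proof eventually_elim
      case (elim n)
      have ns: "norm (s n *s w n) = norm (s n) * norm (w n)"
        by (rule norm_smult)
      have "1 + norm (s n) * norm (w n) = norm (s n) * (inverse (norm (s n)) + norm (w n))"
        using elim by (simp add: field_simps)
      then have "norm (L (s n *s w n)) \<le> C * (norm (s n) ^ M * (inverse (norm (s n)) + norm (w n)) ^ M)"
        using C(2)[of "s n *s w n"] by (simp add: ns power_mult_distrib)
      then have "norm (L (s n *s w n)) / norm (s n) ^ N \<le>
          C * (norm (s n) ^ M * (inverse (norm (s n)) + norm (w n)) ^ M) / norm (s n) ^ N"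
        by (intro divide_right_mono) auto
      also have "\<dots> = C * (inverse (norm (s n)) + norm (w n)) ^ M * (norm (s n) ^ M / norm (s n) ^ N)"
        by simp
      also have "norm (s n) ^ M / norm (s n) ^ N = inverse (norm (s n))"
        using elim by (simp add: Suc field_simps)
      finally show ?case by (simp add: norm_divide norm_power)
    qed
  qed
qed

text \<open>Rescaling recovers the leading form, along any filter and with a converging direction.\<close>

lemma has_top_limit:
  fixes s :: "'a \<Rightarrow> complex" and w :: "'a \<Rightarrow> complex^2"
  assumes F: "has_top N F T" and s: "filterlim s at_infinity Fl" and w: "(w \<longlongrightarrow> z) Fl"
  shows "((\<lambda>n. F (s n *s w n) / s n ^ N) \<longlongrightarrow> T z) Fl"
proof -
  have hT: "homog N T" and hL: "lower N (\<lambda>z. F z - T z)" using F by (auto simp: has_top_def)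
  have "continuous_on UNIV T" using hT homog_imp_poly_le poly_le_continuous by blast
  then have "((\<lambda>n. T (w n)) \<longlongrightarrow> T z) Fl"
    using w by (metis continuous_on_eq_continuous_within UNIV_I isCont_tendsto_compose)
  then have "((\<lambda>n. T (w n) + (F (s n *s w n) - T (s n *s w n)) / s n ^ N) \<longlongrightarrow> T z + 0) Fl"
    using lower_scaled_tendsto_0[OF hL s w] by (intro tendsto_add) auto
  moreover have ev: "\<forall>\<^sub>F n in Fl. s n \<noteq> 0"
    using s eventually_not_equal_at_infinity[of 0] filterlim_iff by blast
  moreover have "\<forall>\<^sub>F n in Fl. T (w n) + (F (s n *s w n) - T (s n *s w n)) / s n ^ N = F (s n *s w n) / s n ^ N"
    using ev by eventually_elim (simp add: homog_scale[OF hT] field_simps)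
  ultimately show ?thesis
    using Lim_transform_eventually by fastforce
qed

lemma of_nat_at_infinity: "filterlim (\<lambda>n. of_nat n :: complex) at_infinity sequentially"
  by (rule tendsto_of_nat)

lemma has_top_ray:
  assumes "has_top N F T"
  shows "(\<lambda>n. F (of_nat n *s z) / of_nat n ^ N) \<longlonglongrightarrow> T z"
  using has_top_limit[OF assms of_nat_at_infinity tendsto_const] .

lemma has_top_unique: "has_top N F T \<Longrightarrow> has_top N F U \<Longrightarrow> T = U"
  using has_top_ray LIMSEQ_unique by blast

lemma homog_deriv:
  assumes "homog N T"
  obtains T1 T2 where "N > 0 \<Longrightarrow> homog (N - 1) T1" "N > 0 \<Longrightarrow> homog (N - 1) T2"
    "\<And>z. (T has_derivative (\<lambda>h. T1 z * h $ 1 + T2 z * h $ 2)) (at z)"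
    "\<And>z. z $ 1 * T1 z + z $ 2 * T2 z = of_nat N * T z"
proof -
  have "\<exists>T1 T2. (if N = 0 then T1 = (\<lambda>z. 0) \<and> T2 = (\<lambda>z. 0) else homog (N - 1) T1 \<and> homog (N - 1) T2) \<and>
    (\<forall>z. (T has_derivative (\<lambda>h. T1 z * h $ 1 + T2 z * h $ 2)) (at z)) \<and>
    (\<forall>z. z $ 1 * T1 z + z $ 2 * T2 z = of_nat N * T z)"
    using assms
  proof (induction rule: homog.induct)
    case (homog_const c)
    show ?case by (rule exI[of _ "\<lambda>z. 0"])+ auto
  next
    case (homog_add N F G)
    then obtain F1 F2 G1 G2 where
      F: "if N = 0 then F1 = (\<lambda>z. 0) \<and> F2 = (\<lambda>z. 0) else homog (N - 1) F1 \<and> homog (N - 1) F2"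
        "\<And>z. (F has_derivative (\<lambda>h. F1 z * h $ 1 + F2 z * h $ 2)) (at z)"
        "\<And>z. z $ 1 * F1 z + z $ 2 * F2 z = of_nat N * F z" and
      G: "if N = 0 then G1 = (\<lambda>z. 0) \<and> G2 = (\<lambda>z. 0) else homog (N - 1) G1 \<and> homog (N - 1) G2"
        "\<And>z. (G has_derivative (\<lambda>h. G1 z * h $ 1 + G2 z * h $ 2)) (at z)"
        "\<And>z. z $ 1 * G1 z + z $ 2 * G2 z = of_nat N * G z" by blast
    have "((\<lambda>z. F z + G z) has_derivative (\<lambda>h. (F1 z + G1 z) * h $ 1 + (F2 z + G2 z) * h $ 2)) (at z)" for z
      using has_derivative_add[OF F(2) G(2), of z] by (simp add: algebra_simps)
    moreover have "z $ 1 * (F1 z + G1 z) + z $ 2 * (F2 z + G2 z) = of_nat N * (F z + G z)" for z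
      using F(3)[of z] G(3)[of z] by (simp add: algebra_simps)
    ultimately show ?case using F(1) G(1) homog.homog_add
      by (intro exI[of _ "\<lambda>z. F1 z + G1 z"] exI[of _ "\<lambda>z. F2 z + G2 z"]) (auto split: if_splits)
  next
    case (homog_coord N F i)
    then obtain F1 F2 where
      F: "if N = 0 then F1 = (\<lambda>z. 0) \<and> F2 = (\<lambda>z. 0) else homog (N - 1) F1 \<and> homog (N - 1) F2"
        "\<And>z. (F has_derivative (\<lambda>h. F1 z * h $ 1 + F2 z * h $ 2)) (at z)"
        "\<And>z. z $ 1 * F1 z + z $ 2 * F2 z = of_nat N * F z" by blast
    have h: "homog N (\<lambda>z. z $ i * F1 z)" "homog N (\<lambda>z. z $ i * F2 z)"
      using F(1) homog_zero homog.homog_coord[of "N - 1" F1 i] homog.homog_coord[of "N - 1" F2 i]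
      by (auto split: if_splits)
    define G1 where "G1 = (\<lambda>z. (if i = 1 then 1 else 0) * F z + z $ i * F1 z)"
    define G2 where "G2 = (\<lambda>z. (if i = 1 then 0 else 1) * F z + z $ i * F2 z)"
    have "homog N G1" "homog N G2"
      unfolding G1_def G2_def by (intro homog.homog_add h homog_cmult homog_coord(1))+
    moreover have "((\<lambda>z. z $ i * F z) has_derivative (\<lambda>h. G1 z * h $ 1 + G2 z * h $ 2)) (at z)" for z
    proof -
      have "((\<lambda>z. z $ i * F z) has_derivative (\<lambda>h. z $ i * (F1 z * h $ 1 + F2 z * h $ 2) + h $ i * F z)) (at z)"
        by (intro has_derivative_mult F(2) bounded_linear_imp_has_derivative bounded_linear_vec_nth)
      also have "(\<lambda>h. z $ i * (F1 z * h $ 1 + F2 z * h $ 2) + h $ i * F z) = (\<lambda>h. G1 z * h $ 1 + G2 z * h $ 2)"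
        using exhaust_2[of i] by (auto simp: G1_def G2_def algebra_simps)
      finally show ?thesis .
    qed
    moreover have "z $ 1 * G1 z + z $ 2 * G2 z = of_nat (Suc N) * (z $ i * F z)" for z
    proof -
      have "z $ 1 * G1 z + z $ 2 * G2 z = z $ i * F z + z $ i * (z $ 1 * F1 z + z $ 2 * F2 z)"
        using exhaust_2[of i] by (auto simp: G1_def G2_def algebra_simps)
      then show ?thesis unfolding F(3) by (simp add: algebra_simps)
    qed
    ultimately show ?case by (intro exI[of _ G1] exI[of _ G2]) simp
  qed
  then obtain T1 T2 where
    "if N = 0 then T1 = (\<lambda>z. 0) \<and> T2 = (\<lambda>z. 0) else homog (N - 1) T1 \<and> homog (N - 1) T2"
    "\<And>z. (T has_derivative (\<lambda>h. T1 z * h $ 1 + T2 z * h $ 2)) (at z)"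
    "\<And>z. z $ 1 * T1 z + z $ 2 * T2 z = of_nat N * T z" by blast
  then show ?thesis by (intro that[of T1 T2]) (auto split: if_splits)
qed

lemma poly_le_deriv:
  assumes "poly_le N F"
  obtains F1 F2 where "lower N F1" "lower N F2"
    "\<And>z. (F has_derivative (\<lambda>h. F1 z * h $ 1 + F2 z * h $ 2)) (at z)"
proof -
  have "\<exists>F1 F2. lower N F1 \<and> lower N F2 \<and>
    (\<forall>z. (F has_derivative (\<lambda>h. F1 z * h $ 1 + F2 z * h $ 2)) (at z))"
    using assms
  proof (induction rule: poly_le.induct)
    case (poly_le_const N c)
    show ?case by (rule exI[of _ "\<lambda>z. 0"])+ (auto simp: lower_zero)
  next
    case (poly_le_add N F G)
    then obtain F1 F2 G1 G2 where
      F: "lower N F1" "lower N F2" "\<And>z. (F has_derivative (\<lambda>h. F1 z * h $ 1 + F2 z * h $ 2)) (at z)" and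
      G: "lower N G1" "lower N G2" "\<And>z. (G has_derivative (\<lambda>h. G1 z * h $ 1 + G2 z * h $ 2)) (at z)" by blast
    have "((\<lambda>z. F z + G z) has_derivative (\<lambda>h. (F1 z + G1 z) * h $ 1 + (F2 z + G2 z) * h $ 2)) (at z)" for z
      using has_derivative_add[OF F(3) G(3), of z] by (simp add: algebra_simps)
    then show ?case using lower_add[OF F(1) G(1)] lower_add[OF F(2) G(2)] by blast
  next
    case (poly_le_coord N F i)
    then obtain F1 F2 where
      F: "lower N F1" "lower N F2" "\<And>z. (F has_derivative (\<lambda>h. F1 z * h $ 1 + F2 z * h $ 2)) (at z)" by blast
    define G1 where "G1 = (\<lambda>z. (if i = 1 then 1 else 0) * F z + z $ i * F1 z)"
    define G2 where "G2 = (\<lambda>z. (if i = 1 then 0 else 1) * F z + z $ i * F2 z)"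
    have "lower (Suc N) G1" "lower (Suc N) G2"
      unfolding G1_def G2_def
      by (intro lower_add lower_coord F; simp only: lower_Suc; intro poly_le_cmult poly_le_coord(1))+
    moreover have "((\<lambda>z. z $ i * F z) has_derivative (\<lambda>h. G1 z * h $ 1 + G2 z * h $ 2)) (at z)" for z
    proof -
      have "((\<lambda>z. z $ i * F z) has_derivative (\<lambda>h. z $ i * (F1 z * h $ 1 + F2 z * h $ 2) + h $ i * F z)) (at z)"
        by (intro has_derivative_mult F(3) bounded_linear_imp_has_derivative bounded_linear_vec_nth)
      also have "(\<lambda>h. z $ i * (F1 z * h $ 1 + F2 z * h $ 2) + h $ i * F z) = (\<lambda>h. G1 z * h $ 1 + G2 z * h $ 2)"
        using exhaust_2[of i] by (auto simp: G1_def G2_def algebra_simps)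
      finally show ?thesis .
    qed
    ultimately show ?case by blast
  qed
  then show ?thesis using that by blast
qed

text \<open>The partial derivatives of the leading form are the leading forms of the partial
  derivatives, and Euler's relation holds.\<close>

lemma has_top_deriv:
  assumes "has_top N F T" "N > 0"
  obtains F1 F2 T1 T2 where "has_top (N - 1) F1 T1" "has_top (N - 1) F2 T2"
    "\<And>z. (F has_derivative (\<lambda>h. F1 z * h $ 1 + F2 z * h $ 2)) (at z)"
    "\<And>z. (T has_derivative (\<lambda>h. T1 z * h $ 1 + T2 z * h $ 2)) (at z)"
    "\<And>z. z $ 1 * T1 z + z $ 2 * T2 z = of_nat N * T z"
proof -
  have T: "homog N T" and L: "poly_le (N - 1) (\<lambda>z. F z - T z)"
    using assms by (auto simp: has_top_def lower_def)
  obtain T1 T2 where T12: "homog (N - 1) T1" "homog (N - 1) T2"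
    "\<And>z. (T has_derivative (\<lambda>h. T1 z * h $ 1 + T2 z * h $ 2)) (at z)"
    "\<And>z. z $ 1 * T1 z + z $ 2 * T2 z = of_nat N * T z"
    by (rule homog_deriv[OF T]) (rule that; use assms(2) in blast)
  obtain L1 L2 where L12: "lower (N - 1) L1" "lower (N - 1) L2"
    "\<And>z. ((\<lambda>z. F z - T z) has_derivative (\<lambda>h. L1 z * h $ 1 + L2 z * h $ 2)) (at z)"
    by (rule poly_le_deriv[OF L]) (rule that)
  have "(F has_derivative (\<lambda>h. (T1 z + L1 z) * h $ 1 + (T2 z + L2 z) * h $ 2)) (at z)" for z
    using has_derivative_add[OF T12(3) L12(3), of z] by (simp add: algebra_simps)
  moreover have "has_top (N - 1) (\<lambda>z. T1 z + L1 z) T1" "has_top (N - 1) (\<lambda>z. T2 z + L2 z) T2"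
    using T12 L12 by (auto simp: has_top_def)
  ultimately show ?thesis using that T12 by blast
qed

lemma homog_line:
  assumes "homog N T"
  obtains p where "degree p \<le> N" "coeff p N = T w" "\<And>t. T (z + t *s w) = poly p t"
proof -
  have "\<exists>p. degree p \<le> N \<and> coeff p N = T w \<and> (\<forall>t. T (z + t *s w) = poly p t)"
    using assms
  proof (induction rule: homog.induct)
    case (homog_const c)
    show ?case by (intro exI[of _ "[:c:]"]) auto
  next
    case (homog_add N F G)
    then obtain p q where "degree p \<le> N \<and> coeff p N = F w \<and> (\<forall>t. F (z + t *s w) = poly p t)"
      "degree q \<le> N \<and> coeff q N = G w \<and> (\<forall>t. G (z + t *s w) = poly q t)" by auto
    then show ?case by (intro exI[of _ "p + q"]) (auto simp: degree_add_le)
  next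
    case (homog_coord N F i)
    then obtain p where p: "degree p \<le> N" "coeff p N = F w" "\<And>t. F (z + t *s w) = poly p t" by auto
    have "degree ([:z $ i, w $ i:] * p) \<le> Suc N"
      using degree_mult_le[of "[:z $ i, w $ i:]" p] p(1) by (simp split: if_splits)
    moreover have "coeff ([:z $ i, w $ i:] * p) (Suc N) = w $ i * F w"
      using p by (simp add: coeff_eq_0)
    moreover have "\<forall>t. (z + t *s w) $ i * F (z + t *s w) = poly ([:z $ i, w $ i:] * p) t"
      using p(3) by (simp add: algebra_simps)
    ultimately show ?case by blast
  qed
  then show ?thesis using that by blast
qed

lemma poly_le_line:
  assumes "poly_le N F"
  obtains p where "degree p \<le> N" "\<And>t. F (z + t *s w) = poly p t"
proof -
  have "\<exists>p. degree p \<le> N \<and> (\<forall>t. F (z + t *s w) = poly p t)"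
    using assms
  proof (induction rule: poly_le.induct)
    case (poly_le_const N c)
    show ?case by (intro exI[of _ "[:c:]"]) auto
  next
    case (poly_le_add N F G)
    then obtain p q where "degree p \<le> N \<and> (\<forall>t. F (z + t *s w) = poly p t)"
      "degree q \<le> N \<and> (\<forall>t. G (z + t *s w) = poly q t)" by auto
    then show ?case by (intro exI[of _ "p + q"]) (auto simp: degree_add_le)
  next
    case (poly_le_coord N F i)
    then obtain p where p: "degree p \<le> N" "\<And>t. F (z + t *s w) = poly p t" by auto
    have "degree ([:z $ i, w $ i:] * p) \<le> Suc N"
      using degree_mult_le[of "[:z $ i, w $ i:]" p] p(1) by (simp split: if_splits)
    moreover have "\<forall>t. (z + t *s w) $ i * F (z + t *s w) = poly ([:z $ i, w $ i:] * p) t"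
      using p(2) by (simp add: algebra_simps)
    ultimately show ?case by blast
  qed
  then show ?thesis using that by blast
qed

lemma has_top_line:
  assumes "has_top N F T"
  obtains p where "degree p \<le> N" "coeff p N = T w" "\<And>t. F (z + t *s w) = poly p t"
proof -
  have T: "homog N T" and L: "lower N (\<lambda>z. F z - T z)" using assms by (auto simp: has_top_def)
  obtain p where p: "degree p \<le> N" "coeff p N = T w" "\<And>t. T (z + t *s w) = poly p t"
    by (rule homog_line[OF T, of w z]) (rule that)
  have "\<exists>q. degree q \<le> N \<and> coeff q N = 0 \<and> (\<forall>t. F (z + t *s w) - T (z + t *s w) = poly q t)"
  proof (cases N)
    case 0
    then have "F x - T x = 0" for x using L unfolding lower_def by meson
    then show ?thesis by (intro exI[of _ 0]) simp
  next
    case (Suc M)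
    then have "poly_le M (\<lambda>z. F z - T z)" using L by (simp add: lower_Suc)
    then obtain q where "degree q \<le> M" "\<And>t. F (z + t *s w) - T (z + t *s w) = poly q t"
      by (rule poly_le_line[of M _ z w]) (rule that)
    then show ?thesis using Suc by (intro exI[of _ q]) (auto simp: coeff_eq_0)
  qed
  then obtain q where q: "degree q \<le> N" "coeff q N = 0" "\<And>t. F (z + t *s w) - T (z + t *s w) = poly q t"
    by blast
  show ?thesis
    by (rule that[of "p + q"]) (use p q in \<open>auto simp: degree_add_le algebra_simps\<close>)
qed

text \<open>Degree bounds and leading forms of maps are taken componentwise. Thus \<open>T\<close> in
  \<open>map_top N f T\<close> may have one component zero, and both if the degree of \<open>f\<close> is below \<open>N\<close>.\<close>

definition map_le :: "nat \<Rightarrow> (complex^2 \<Rightarrow> complex^2) \<Rightarrow> bool" where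
  "map_le N f \<longleftrightarrow> (\<forall>i. poly_le N (\<lambda>z. f z $ i))"

definition map_top :: "nat \<Rightarrow> (complex^2 \<Rightarrow> complex^2) \<Rightarrow> (complex^2 \<Rightarrow> complex^2) \<Rightarrow> bool" where
  "map_top N f T \<longleftrightarrow> (\<forall>i. has_top N (\<lambda>z. f z $ i) (\<lambda>z. T z $ i))"

lemma poly_le_imp_coeffs:
  assumes "poly_le N F"
  shows "\<exists>c :: nat \<Rightarrow> nat \<Rightarrow> complex. (\<forall>i j. N < i + j \<longrightarrow> c i j = 0) \<and>
    (\<forall>z. \<forall>M\<ge>N. F z = (\<Sum>i\<le>M. \<Sum>j\<le>M. z $ 1 ^ i * z $ 2 ^ j * c i j))"
  using assms
proof (induction rule: poly_le.induct)
  case (poly_le_const N c)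
  have "(\<Sum>i\<le>M. \<Sum>j\<le>M. z $ 1 ^ i * z $ 2 ^ j * (if i = 0 \<and> j = 0 then c else 0)) = c" for M and z :: "complex^2"
  proof -
    have "(\<Sum>i\<le>M. \<Sum>j\<le>M. z $ 1 ^ i * z $ 2 ^ j * (if i = 0 \<and> j = 0 then c else 0)) =
      (\<Sum>i\<le>M. if i = 0 then c else 0)"
      by (intro sum.cong refl) (auto simp: if_distrib[of "\<lambda>u. _ * u"] cong: if_cong)
    then show ?thesis by simp
  qed
  then show ?case by (intro exI[of _ "\<lambda>i j. if i = 0 \<and> j = 0 then c else 0"]) auto
next
  case (poly_le_add N F G)
  then obtain c d where "\<forall>i j. N < i + j \<longrightarrow> c i j = 0"
    "\<forall>z. \<forall>M\<ge>N. F z = (\<Sum>i\<le>M. \<Sum>j\<le>M. z $ 1 ^ i * z $ 2 ^ j * c i j)"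
    "\<forall>i j. N < i + j \<longrightarrow> d i j = 0"
    "\<forall>z. \<forall>M\<ge>N. G z = (\<Sum>i\<le>M. \<Sum>j\<le>M. z $ 1 ^ i * z $ 2 ^ j * d i j)" by blast
  then show ?case
    by (intro exI[of _ "\<lambda>i j. c i j + d i j"]) (auto simp: distrib_left sum.distrib)
next
  case (poly_le_coord N F k)
  then obtain c where c: "\<And>i j. N < i + j \<Longrightarrow> c i j = 0"
    "\<And>z M. M \<ge> N \<Longrightarrow> F z = (\<Sum>i\<le>M. \<Sum>j\<le>M. z $ 1 ^ i * z $ 2 ^ j * c i j)" by blast
  consider "k = 1" | "k = 2" using exhaust_2 by blast
  then show ?case
  proof cases
    case 1
    define d where "d i j = (case i of 0 \<Rightarrow> 0 | Suc i' \<Rightarrow> c i' j)" for i j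
    have "z $ k * F z = (\<Sum>i\<le>M. \<Sum>j\<le>M. z $ 1 ^ i * z $ 2 ^ j * d i j)" if "M \<ge> Suc N" for z M
    proof -
      obtain M' where M': "M = Suc M'" "M' \<ge> N" using \<open>M \<ge> Suc N\<close> Suc_le_D Suc_le_mono by blast
      have "(\<Sum>i\<le>M. \<Sum>j\<le>M. z $ 1 ^ i * z $ 2 ^ j * d i j) =
        (\<Sum>i\<le>M'. \<Sum>j\<le>M. z $ 1 ^ Suc i * z $ 2 ^ j * c i j)"
        unfolding M'(1) by (subst sum.atMost_Suc_shift) (simp add: d_def)
      also have "\<dots> = z $ 1 * (\<Sum>i\<le>M'. \<Sum>j\<le>M'. z $ 1 ^ i * z $ 2 ^ j * c i j)"
        using c(1) M' by (simp add: sum_distrib_left mult_ac)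
      finally show ?thesis using c(2)[OF M'(2)] 1 by simp
    qed
    moreover have "\<forall>i j. Suc N < i + j \<longrightarrow> d i j = 0"
      using c(1) by (auto simp: d_def split: nat.split)
    ultimately show ?thesis by blast
  next
    case 2
    define d where "d i j = (case j of 0 \<Rightarrow> 0 | Suc j' \<Rightarrow> c i j')" for i j
    have "z $ k * F z = (\<Sum>i\<le>M. \<Sum>j\<le>M. z $ 1 ^ i * z $ 2 ^ j * d i j)" if "M \<ge> Suc N" for z M
    proof -
      obtain M' where M': "M = Suc M'" "M' \<ge> N" using \<open>M \<ge> Suc N\<close> Suc_le_D Suc_le_mono by blast
      have "(\<Sum>i\<le>M. \<Sum>j\<le>M. z $ 1 ^ i * z $ 2 ^ j * d i j) =
        (\<Sum>i\<le>M. \<Sum>j\<le>M'. z $ 1 ^ i * z $ 2 ^ Suc j * c i j)"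
        unfolding M'(1) by (subst sum.atMost_Suc_shift) (simp add: d_def)
      also have "\<dots> = z $ 2 * (\<Sum>i\<le>M'. \<Sum>j\<le>M'. z $ 1 ^ i * z $ 2 ^ j * c i j)"
        using c(1) M' by (simp add: sum_distrib_left mult_ac)
      finally show ?thesis using c(2)[OF M'(2)] 2 by simp
    qed
    moreover have "\<forall>i j. Suc N < i + j \<longrightarrow> d i j = 0"
      using c(1) by (auto simp: d_def split: nat.split)
    ultimately show ?thesis by blast
  qed
qed

lemma poly_map_le_iff: "poly_map_le N f \<longleftrightarrow> map_le N f"
proof
  assume "poly_map_le N f"
  then obtain c :: "nat \<Rightarrow> nat \<Rightarrow> complex^2"
    where c: "\<And>x. f x = (\<Sum>(i,j)\<in>{(i,j). i + j \<le> N}. (x$1 ^ i * x$2 ^ j) *s c i j)"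
    unfolding poly_map_le_def by blast
  have mono: "poly_le N (\<lambda>z. z$1 ^ i * z$2 ^ j * a)" if "i + j \<le> N" for i j and a :: complex
  proof -
    have "poly_le (i * 1 + j * 1) (\<lambda>z. z$1 ^ i * z$2 ^ j)"
      by (intro poly_le_mult poly_le_power poly_le_var)
    then show ?thesis using poly_le_cmult[of "i + j" _ a] that poly_le_mono
      by (fastforce simp: mult.commute)
  qed
  show "map_le N f"
    unfolding map_le_def
  proof
    fix k
    have "(\<lambda>z. f z $ k) = (\<lambda>z. \<Sum>p\<in>{(i,j). i + j \<le> N}. z$1 ^ fst p * z$2 ^ snd p * c (fst p) (snd p) $ k)"
      unfolding c by (auto simp: case_prod_unfold)
    moreover have "poly_le N (\<lambda>z. \<Sum>p\<in>{(i,j). i + j \<le> N}. z$1 ^ fst p * z$2 ^ snd p * c (fst p) (snd p) $ k)"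
      by (intro poly_le_sum mono) auto
    ultimately show "poly_le N (\<lambda>z. f z $ k)" by simp
  qed
next
  assume "map_le N f"
  then have "\<forall>k. \<exists>c :: nat \<Rightarrow> nat \<Rightarrow> complex. (\<forall>i j. N < i + j \<longrightarrow> c i j = 0) \<and>
    (\<forall>z. \<forall>M\<ge>N. f z $ k = (\<Sum>i\<le>M. \<Sum>j\<le>M. z $ 1 ^ i * z $ 2 ^ j * c i j))"
    unfolding map_le_def using poly_le_imp_coeffs by blast
  from choice[OF this] obtain c :: "2 \<Rightarrow> nat \<Rightarrow> nat \<Rightarrow> complex" where c: "\<And>k i j. N < i + j \<Longrightarrow> c k i j = 0"
    "\<And>k z. f z $ k = (\<Sum>i\<le>N. \<Sum>j\<le>N. z $ 1 ^ i * z $ 2 ^ j * c k i j)"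
    by blast
  have "f x = (\<Sum>(i,j)\<in>{(i,j). i + j \<le> N}. (x$1 ^ i * x$2 ^ j) *s (\<chi> k. c k i j))" for x
  proof (subst vec_eq_iff, intro allI)
    fix k
    have "f x $ k = (\<Sum>(i,j)\<in>{..N} \<times> {..N}. x $ 1 ^ i * x $ 2 ^ j * c k i j)"
      unfolding c(2) by (simp add: sum.cartesian_product)
    also have "\<dots> = (\<Sum>(i,j)\<in>{(i,j). i + j \<le> N}. x $ 1 ^ i * x $ 2 ^ j * c k i j)"
      by (rule sum.mono_neutral_right) (auto, meson c(1) not_le)
    also have "\<dots> = (\<Sum>(i,j)\<in>{(i,j). i + j \<le> N}. (x$1 ^ i * x$2 ^ j) *s (\<chi> k. c k i j)) $ k"
      by (simp add: case_prod_unfold)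
    finally show "f x $ k = (\<Sum>(i,j)\<in>{(i,j). i + j \<le> N}. (x$1 ^ i * x$2 ^ j) *s (\<chi> k. c k i j)) $ k" .
  qed
  then show "poly_map_le N f" unfolding poly_map_le_def by (intro exI[of _ "\<lambda>i j. \<chi> k. c k i j"]) blast
qed

lemma map_le_mono: "map_le N f \<Longrightarrow> N \<le> M \<Longrightarrow> map_le M f"
  by (auto simp: map_le_def intro: poly_le_mono)

lemma map_le_compose: "map_le N f \<Longrightarrow> map_le M g \<Longrightarrow> map_le (N * M) (f \<circ> g)"
  by (auto simp: map_le_def intro: poly_le_compose)

lemma map_top_imp_le: "map_top N f T \<Longrightarrow> map_le N f"
  by (auto simp: map_le_def map_top_def intro: has_top_imp_poly_le)

lemma ex_map_top:
  assumes "map_le N f"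
  obtains T where "map_top N f T"
proof -
  have "\<forall>i. \<exists>T. has_top N (\<lambda>z. f z $ i) T" using assms ex_top unfolding map_le_def by metis
  then obtain T where "\<forall>i. has_top N (\<lambda>z. f z $ i) (T i)" by metis
  then show ?thesis using that[of "\<lambda>z. \<chi> i. T i z"] by (simp add: map_top_def)
qed

lemma map_top_unique: "map_top N f T \<Longrightarrow> map_top N f U \<Longrightarrow> T = U"
  unfolding map_top_def by (auto simp: vec_eq_iff fun_eq_iff dest: has_top_unique) (metis has_top_unique)

lemma map_top_zero_imp: "map_top (Suc N) f (\<lambda>z. 0) \<Longrightarrow> map_le N f"
  by (simp add: map_top_def map_le_def has_top_zero_imp)

lemma map_le_imp_top_zero: "map_le N f \<Longrightarrow> N < M \<Longrightarrow> map_top M f (\<lambda>z. 0)"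
  by (auto simp: map_top_def map_le_def has_top_def homog_zero lower_def intro: poly_le_mono)

lemma map_top_limit:
  fixes s :: "'a \<Rightarrow> complex" and w :: "'a \<Rightarrow> complex^2"
  assumes f: "map_top N f T" and s: "filterlim s at_infinity Fl" and w: "(w \<longlongrightarrow> z) Fl"
  shows "((\<lambda>n. inverse (s n ^ N) *s f (s n *s w n)) \<longlongrightarrow> T z) Fl"
proof (rule vec_tendstoI)
  fix i
  have "((\<lambda>n. f (s n *s w n) $ i / s n ^ N) \<longlongrightarrow> T z $ i) Fl"
    using f by (intro has_top_limit[OF _ s w]) (simp add: map_top_def)
  then show "((\<lambda>n. (inverse (s n ^ N) *s f (s n *s w n)) $ i) \<longlongrightarrow> T z $ i) Fl"
    by (simp add: field_simps)
qed

lemma map_top_scale: "map_top N f T \<Longrightarrow> T (c *s z) = c ^ N *s T z"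
  unfolding map_top_def has_top_def vec_eq_iff
  using homog_scale[of N "\<lambda>z. T z $ i" c z for i] by simp

lemma map_le_continuous: "map_le N f \<Longrightarrow> continuous_on S f"
  using continuous_on_vec_lambda[of S "\<lambda>i z. f z $ i"] poly_le_continuous
  unfolding map_le_def vec_lambda_eta by blast

text \<open>The composition of the leading forms may vanish; then the composition has degree below
  \<open>N * M\<close>. For \<open>M = 0\<close> the statement fails, since \<open>f\<close> is then evaluated at a bounded argument.\<close>

lemma map_top_compose:
  assumes f: "map_top N f T" and g: "map_top M g U" and M: "M > 0"
  shows "map_top (N * M) (f \<circ> g) (T \<circ> U)"
proof -
  obtain V where V: "map_top (N * M) (f \<circ> g) V"
    using map_le_compose[OF map_top_imp_le[OF f] map_top_imp_le[OF g]] ex_map_top by blast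
  have "V z = T (U z)" for z
  proof -
    let ?s = "\<lambda>n. of_nat n :: complex"
    have s': "filterlim (\<lambda>n. ?s n ^ M) at_infinity sequentially"
      using Limits.filterlim_power_at_infinity[OF of_nat_at_infinity] M by simp
    have w: "(\<lambda>n. inverse (?s n ^ M) *s g (?s n *s z)) \<longlonglongrightarrow> U z"
      by (rule map_top_limit[OF g of_nat_at_infinity tendsto_const])
    have "(\<lambda>n. inverse ((?s n ^ M) ^ N) *s f ((?s n ^ M) *s (inverse (?s n ^ M) *s g (?s n *s z)))) \<longlonglongrightarrow> T (U z)"
      by (rule map_top_limit[OF f s' w])
    moreover have "\<forall>\<^sub>F n in sequentially. inverse ((?s n ^ M) ^ N) *s f ((?s n ^ M) *s (inverse (?s n ^ M) *s g (?s n *s z)))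
       = inverse (?s n ^ (N * M)) *s (f \<circ> g) (?s n *s z)"
      using eventually_gt_at_top[of 0]
      by eventually_elim (simp add: vector_smult_assoc mult.commute flip: power_mult)
    ultimately have "(\<lambda>n. inverse (?s n ^ (N * M)) *s (f \<circ> g) (?s n *s z)) \<longlonglongrightarrow> T (U z)"
      using Lim_transform_eventually by fastforce
    moreover have "(\<lambda>n. inverse (?s n ^ (N * M)) *s (f \<circ> g) (?s n *s z)) \<longlonglongrightarrow> V z"
      by (rule map_top_limit[OF V of_nat_at_infinity tendsto_const])
    ultimately show ?thesis using LIMSEQ_unique by blast
  qed
  then have "V = T \<circ> U" by auto
  then show ?thesis using V by simp
qed

lemma map_le_degree: "poly_map f \<Longrightarrow> map_le (poly_map_degree f) f"
  unfolding poly_map_def poly_map_degree_def by (metis LeastI poly_map_le_iff)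

lemma poly_map_degree_le: "map_le N f \<Longrightarrow> poly_map_degree f \<le> N"
  unfolding poly_map_degree_def by (simp add: Least_le poly_map_le_iff)

lemma map_le_imp_poly_map: "map_le N f \<Longrightarrow> poly_map f"
  unfolding poly_map_def poly_map_le_iff by blast

lemma poly_map_degree_eq:
  assumes T: "map_top N f T" and "T z \<noteq> 0"
  shows "poly_map_degree f = N"
proof -
  let ?M = "poly_map_degree f"
  have le: "?M \<le> N" using poly_map_degree_le map_top_imp_le T by blast
  have "map_le ?M f" using map_le_degree map_le_imp_poly_map map_top_imp_le T by blast
  then have "\<not> ?M < N" using map_le_imp_top_zero map_top_unique T assms(2) by metis
  then show ?thesis using le by simp
qed

lemma poly_map_degree_top:
  assumes "poly_map f" "poly_map_degree f > 0"
  obtains T z where "map_top (poly_map_degree f) f T" "T z \<noteq> 0"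
proof -
  obtain T where T: "map_top (poly_map_degree f) f T" using map_le_degree[OF assms(1)] ex_map_top by blast
  have "\<exists>z. T z \<noteq> 0"
  proof (rule ccontr)
    assume "\<not> ?thesis"
    then have "T = (\<lambda>z. 0)" by auto
    then have "map_le (poly_map_degree f - 1) f"
      using T map_top_zero_imp[of "poly_map_degree f - 1" f] assms(2) by simp
    then show False using poly_map_degree_le assms(2) by fastforce
  qed
  then show ?thesis using that T by blast
qed

lemma map_le_growth:
  assumes "map_le N f"
  obtains C where "C > 0" "\<And>z. norm (f z) \<le> C * (1 + norm z) ^ N"
proof -
  obtain C1 C2 where C: "C1 > 0" "\<And>z. norm (f z $ 1) \<le> C1 * (1 + norm z) ^ N"
    "C2 > 0" "\<And>z. norm (f z $ 2) \<le> C2 * (1 + norm z) ^ N"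
    using assms poly_le_growth unfolding map_le_def by metis
  have "norm (f z) \<le> (C1 + C2) * (1 + norm z) ^ N" for z
  proof -
    have "norm (f z) \<le> (\<Sum>i\<in>UNIV. norm (f z $ i))"
      unfolding norm_vec_def by (rule L2_set_le_sum) auto
    also have "\<dots> \<le> (C1 + C2) * (1 + norm z) ^ N"
      using C(2)[of z] C(4)[of z] by (simp add: UNIV_2 algebra_simps)
    finally show ?thesis .
  qed
  then show ?thesis using that[of "C1 + C2"] C by simp
qed

section \<open>The Jacobian determinant and the fibres of a component\<close>

text \<open>The point of the plane with the given coordinates.\<close>

abbreviation pair2 :: "complex \<Rightarrow> complex \<Rightarrow> complex^2" where
  "pair2 a b \<equiv> vector [a, b]"

lemma pair2_eta: "pair2 (z $ 1) (z $ 2) = z"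
  by (simp add: vec_eq_iff forall_2)

lemma pair2_eq_iff: "u = v \<longleftrightarrow> u $ 1 = v $ 1 \<and> u $ 2 = (v :: complex^2) $ 2"
  by (simp add: vec_eq_iff forall_2)

lemma bounded_linear_smult_left: "bounded_linear (\<lambda>t :: complex. t *s (w :: complex^2))"
  by (rule bounded_linear_intro[where K = "norm w"])
    (auto simp: vec_eq_iff norm_smult algebra_simps)

lemma has_derivative_pair2:
  assumes "(a has_derivative a') F" "(b has_derivative b') F"
  shows "((\<lambda>z. pair2 (a z) (b z)) has_derivative (\<lambda>h. pair2 (a' h) (b' h))) F"
proof -
  have eq: "pair2 x y = x *s pair2 1 0 + y *s pair2 0 1" for x y
    by (simp add: pair2_eq_iff)
  have "((\<lambda>z. a z *s pair2 1 0 + b z *s pair2 0 1) has_derivative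
      (\<lambda>h. a' h *s pair2 1 0 + b' h *s pair2 0 1)) F"
    by (intro has_derivative_add bounded_linear.has_derivative[OF bounded_linear_smult_left] assms)
  then show ?thesis by (subst (1 2) eq)
qed

lemma line_derivative:
  fixes F :: "complex^2 \<Rightarrow> complex"
  assumes "\<And>z. (F has_derivative (\<lambda>h. F1 z * h $ 1 + F2 z * h $ 2)) (at z)"
  shows "((\<lambda>t. F (z + t *s w)) has_field_derivative F1 (z + t *s w) * w $ 1 + F2 (z + t *s w) * w $ 2) (at t)"
proof -
  have "((\<lambda>t. z + t *s w) has_derivative (\<lambda>h. h *s w)) (at t)"
    using has_derivative_add[OF has_derivative_const[of z]
        bounded_linear_imp_has_derivative[OF bounded_linear_smult_left]] by simp
  from has_derivative_compose[OF this assms]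
  have "((\<lambda>t. F (z + t *s w)) has_derivative
      (\<lambda>h. F1 (z + t *s w) * (h * w $ 1) + F2 (z + t *s w) * (h * w $ 2))) (at t)" by simp
  moreover have "(\<lambda>h. F1 (z + t *s w) * (h * w $ 1) + F2 (z + t *s w) * (h * w $ 2)) =
     (*) (F1 (z + t *s w) * w $ 1 + F2 (z + t *s w) * w $ 2)" by (auto simp: algebra_simps)
  ultimately show ?thesis by (simp add: has_field_derivative_def)
qed

lemma poly_without_zeros_const:
  assumes "poly_le N F" "\<And>z. F z \<noteq> 0"
  shows "F z = F 0"
proof -
  obtain p where p: "\<And>t. F (0 + t *s z) = poly p t"
    by (rule poly_le_line[OF assms(1), of 0 z]) (rule that)
  have "\<forall>t. poly p t \<noteq> 0" using assms(2) p by metis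
  then have "constant (poly p)" using fundamental_theorem_of_algebra by blast
  then have "poly p 1 = poly p 0" unfolding constant_def by blast
  then show ?thesis using p[of 1] p[of 0] by (simp add: vec_eq_iff)
qed

text \<open>The Jacobian determinant is constant, and Cramer's rule for the inverse matrix.\<close>

lemma jacobian_constant:
  fixes f F :: "complex^2 \<Rightarrow> complex^2"
  assumes inv: "\<And>z. F (f z) = z"
    and P: "\<And>z. ((\<lambda>z. f z $ 1) has_derivative (\<lambda>h. P1 z * h $ 1 + P2 z * h $ 2)) (at z)"
    and Q: "\<And>z. ((\<lambda>z. f z $ 2) has_derivative (\<lambda>h. Q1 z * h $ 1 + Q2 z * h $ 2)) (at z)"
    and E: "\<And>z. ((\<lambda>z. F z $ 1) has_derivative (\<lambda>h. E1 z * h $ 1 + E2 z * h $ 2)) (at z)"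
    and G: "\<And>z. ((\<lambda>z. F z $ 2) has_derivative (\<lambda>h. G1 z * h $ 1 + G2 z * h $ 2)) (at z)"
    and poly: "poly_le N P1" "poly_le N P2" "poly_le M Q1" "poly_le M Q2"
  obtains \<delta> where "\<delta> \<noteq> 0" "\<And>z. P1 z * Q2 z - P2 z * Q1 z = \<delta>"
    "\<And>z. E1 (f z) * \<delta> = Q2 z" "\<And>z. G1 (f z) * \<delta> = - Q1 z"
proof -
  have df: "(f has_derivative (\<lambda>h. pair2 (P1 z * h $ 1 + P2 z * h $ 2) (Q1 z * h $ 1 + Q2 z * h $ 2))) (at z)" for z
    using has_derivative_pair2[OF P Q, of z] by (simp add: pair2_eta)
  have eq: "E1 (f z) * (P1 z * h $ 1 + P2 z * h $ 2) + E2 (f z) * (Q1 z * h $ 1 + Q2 z * h $ 2) = h $ 1"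
    "G1 (f z) * (P1 z * h $ 1 + P2 z * h $ 2) + G2 (f z) * (Q1 z * h $ 1 + Q2 z * h $ 2) = h $ 2" for z and h :: "complex^2"
  proof -
    have A1: "((\<lambda>z. z $ 1) has_derivative (\<lambda>h. E1 (f z) * (P1 z * h $ 1 + P2 z * h $ 2) + E2 (f z) * (Q1 z * h $ 1 + Q2 z * h $ 2))) (at z)"
      using has_derivative_compose[OF df E, of z] by (simp add: inv)
    have B1: "((\<lambda>z::complex^2. z $ 1) has_derivative (\<lambda>h. h $ 1)) (at z)"
      by (intro bounded_linear_imp_has_derivative bounded_linear_vec_nth)
    show "E1 (f z) * (P1 z * h $ 1 + P2 z * h $ 2) + E2 (f z) * (Q1 z * h $ 1 + Q2 z * h $ 2) = h $ 1"
      using fun_cong[OF has_derivative_unique[OF A1 B1], of h] .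
    have A2: "((\<lambda>z. z $ 2) has_derivative (\<lambda>h. G1 (f z) * (P1 z * h $ 1 + P2 z * h $ 2) + G2 (f z) * (Q1 z * h $ 1 + Q2 z * h $ 2))) (at z)"
      using has_derivative_compose[OF df G, of z] by (simp add: inv)
    have B2: "((\<lambda>z::complex^2. z $ 2) has_derivative (\<lambda>h. h $ 2)) (at z)"
      by (intro bounded_linear_imp_has_derivative bounded_linear_vec_nth)
    show "G1 (f z) * (P1 z * h $ 1 + P2 z * h $ 2) + G2 (f z) * (Q1 z * h $ 1 + Q2 z * h $ 2) = h $ 2"
      using fun_cong[OF has_derivative_unique[OF A2 B2], of h] .
  qed
  have e: "E1 (f z) * P1 z + E2 (f z) * Q1 z = 1" "E1 (f z) * P2 z + E2 (f z) * Q2 z = 0"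
    "G1 (f z) * P1 z + G2 (f z) * Q1 z = 0" "G1 (f z) * P2 z + G2 (f z) * Q2 z = 1" for z
    using eq[of z "pair2 1 0"] eq[of z "pair2 0 1"] by simp_all
  define J where "J = (\<lambda>z. P1 z * Q2 z - P2 z * Q1 z)"
  have EJ: "E1 (f z) * J z = Q2 z" for z
    using e(1,2)[of z] unfolding J_def by algebra
  have GJ: "G1 (f z) * J z = - Q1 z" for z
    using e(3,4)[of z] unfolding J_def by algebra
  have "(E1 (f z) * G2 (f z) - E2 (f z) * G1 (f z)) * J z = 1" for z
    using e[of z] unfolding J_def by algebra
  then have nz: "J z \<noteq> 0" for z by (metis mult_zero_right zero_neq_one)
  have "poly_le (N + M) J" unfolding J_def by (intro poly_le_diff poly_le_mult poly)
  then have "J z = J 0" for z using poly_without_zeros_const nz by blast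
  then show ?thesis using that[of "J 0"] nz EJ GJ unfolding J_def by metis
qed

text \<open>A polynomial function as a polynomial in the first coordinate whose coefficients are
  polynomials in the second.\<close>

lemma poly_le_bivariate:
  assumes "poly_le N F"
  obtains a :: "complex poly poly" where "\<And>z. F z = poly (poly a [:z $ 1:]) (z $ 2)"
proof -
  have "\<exists>a :: complex poly poly. \<forall>z. F z = poly (poly a [:z $ 1:]) (z $ 2)"
    using assms
  proof (induction rule: poly_le.induct)
    case (poly_le_const N c)
    show ?case by (intro exI[of _ "[:[:c:]:]"]) simp
  next
    case (poly_le_add N F G)
    then obtain a b where "\<forall>z. F z = poly (poly a [:z $ 1:]) (z $ 2)"
      "\<forall>z. G z = poly (poly b [:z $ 1:]) (z $ 2)" by blast
    then show ?case by (intro exI[of _ "a + b"]) simp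
  next
    case (poly_le_coord N F i)
    then obtain a where a: "\<forall>z. F z = poly (poly a [:z $ 1:]) (z $ 2)" by blast
    consider "i = 1" | "i = 2" using exhaust_2 by blast
    then show ?case
    proof cases
      case 1 then show ?thesis using a by (intro exI[of _ "pCons 0 a"]) simp
    next
      case 2 then show ?thesis using a by (intro exI[of _ "smult [:0, 1:] a"]) simp
    qed
  qed
  then show ?thesis using that by blast
qed

lemma poly_bounded_below:
  fixes l :: "complex poly"
  assumes "l \<noteq> 0"
  obtains c R where "c > 0" "\<And>y. R \<le> norm y \<Longrightarrow> c \<le> norm (poly l y)"
proof (cases l)
  case (pCons a p)
  show ?thesis
  proof (cases "p = 0")
    case True
    then show ?thesis using that[of "norm a" 0] pCons assms by auto
  next
    case False
    then obtain r where "\<forall>z. r \<le> norm z \<longrightarrow> 1 \<le> norm (poly (pCons a p) z)" using poly_infinity by blast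
    then show ?thesis using that[of 1 r] pCons by auto
  qed
qed

lemma rsquarefree_card_roots:
  fixes p :: "complex poly"
  assumes p: "rsquarefree p"
  shows "finite {x. poly p x = 0}" "card {x. poly p x = 0} = degree p"
    "poly p y = lead_coeff p * (\<Prod>x\<in>{x. poly p x = 0}. y - x)"
    "poly p x0 = 0 \<Longrightarrow> poly (pderiv p) x0 = lead_coeff p * (\<Prod>x\<in>{x. poly p x = 0} - {x0}. x0 - x)"
proof -
  let ?R = "{x. poly p x = 0}"
  have p0: "p \<noteq> 0" using p by (auto simp: rsquarefree_def)
  have fin: "finite ?R" using p0 by (rule poly_roots_finite)
  have dec: "p = smult (lead_coeff p) (\<Prod>x\<in>?R. [:-x, 1:])"
    using complex_poly_decompose_rsquarefree[OF p] by simp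
  show "finite ?R" by fact
  have "degree p = degree (\<Prod>x\<in>?R. [:-x, 1:])" using p0 by (subst dec) simp
  also have "\<dots> = (\<Sum>x\<in>?R. degree [:-x, 1:])" by (intro degree_prod_sum_eq) auto
  finally show "card ?R = degree p" by simp
  show "poly p y = lead_coeff p * (\<Prod>x\<in>?R. y - x)"
    by (subst (1) dec) (simp add: poly_prod)
  assume x0: "poly p x0 = 0"
  have "(\<Prod>x\<in>?R. [:-x, 1:]) = [:-x0, 1:] * (\<Prod>x\<in>?R - {x0}. [:-x, 1:])"
    using prod.remove[OF fin, of x0 "\<lambda>x. [:-x, 1:]"] x0 by blast
  then have "p = smult (lead_coeff p) ([:-x0, 1:] * (\<Prod>x\<in>?R - {x0}. [:-x, 1:]))" using dec by metis
  then have "pderiv p = pderiv (smult (lead_coeff p) ([:-x0, 1:] * (\<Prod>x\<in>?R - {x0}. [:-x, 1:])))" by (rule arg_cong)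
  then show "poly (pderiv p) x0 = lead_coeff p * (\<Prod>x\<in>?R - {x0}. x0 - x)"
    by (simp only: pderiv_smult pderiv_mult poly_smult poly_add poly_mult poly_prod)
      (simp add: pderiv_pCons)
qed

text \<open>All but boundedly many values \<open>y\<close> are regular for \<open>Q\<close>, as the critical values are finite in
  number.\<close>

lemma rsquarefree_shift:
  fixes Q :: "complex poly"
  assumes "degree Q > 0"
  obtains R where "\<And>y. R \<le> norm y \<Longrightarrow> rsquarefree (Q - [:y:])"
proof -
  have "pderiv Q \<noteq> 0" using assms pderiv_eq_0_iff[of Q] by auto
  then have "finite {t. poly (pderiv Q) t = 0}" by (rule poly_roots_finite)
  then have "bounded (poly Q ` {t. poly (pderiv Q) t = 0})" by (intro finite_imp_bounded finite_imageI)
  then obtain B where B: "\<And>t. poly (pderiv Q) t = 0 \<Longrightarrow> norm (poly Q t) \<le> B" unfolding bounded_iff by auto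
  have "rsquarefree (Q - [:y:])" if "B + 1 \<le> norm y" for y
    unfolding rsquarefree_roots using B that by (fastforce simp: pderiv_diff pderiv_pCons)
  then show ?thesis by (rule that)
qed

lemma poly_diffeo_inverse:
  assumes "poly_diffeo f"
  shows "inv f (f z) = z" "f (inv f z) = z"
  using assms by (auto simp: poly_diffeo_def bij_def surj_f_inv_f)

lemma poly_diffeo_inv: "poly_diffeo f \<Longrightarrow> poly_diffeo (inv f)"
  by (simp add: poly_diffeo_def bij_imp_bij_inv inv_inv_eq)

lemma poly_diffeo_map_le:
  assumes "poly_diffeo f"
  shows "map_le (poly_map_degree f) f" "map_le (poly_map_degree (inv f)) (inv f)"
  using assms map_le_degree by (auto simp: poly_diffeo_def)

text \<open>The image of the line through \<open>e\<close> is parametrized by \<open>Pp\<close> and \<open>Qp\<close>, and it is the zero set of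
  a polynomial \<open>A\<close> obtained from \<open>inv f\<close>. This polynomial, restricted to a horizontal line of large height \<open>y\<close>,
  has as its roots the values of \<open>Pp\<close> on the fibre of \<open>Qp\<close> over \<open>y\<close>, all of them simple. Its
  derivative at such a root is the leading coefficient times the product of the differences of
  the roots; by Cramer's rule it is also the derivative of \<open>Qp\<close>, up to a constant factor. The
  leading coefficient, a nonzero polynomial in \<open>y\<close>, is bounded away from zero.\<close>

lemma fibre_product_bound:
  fixes Pp Qp :: "complex poly"
  assumes f: "poly_diffeo f"
    and Pp: "\<And>t. f (t *s e) $ 1 = poly Pp t" and Qp: "\<And>t. f (t *s e) $ 2 = poly Qp t"
    and deg: "degree Qp > 0" and e: "e \<noteq> 0"
  obtains c R where "c > 0"
    "\<And>t0. R \<le> norm (poly Qp t0) \<Longrightarrow> finite {t. poly Qp t = poly Qp t0}"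
    "\<And>t0. R \<le> norm (poly Qp t0) \<Longrightarrow> card {t. poly Qp t = poly Qp t0} = degree Qp"
    "\<And>t0 u. R \<le> norm (poly Qp t0) \<Longrightarrow>
       poly Qp u - poly Qp t0 = lead_coeff Qp * (\<Prod>t\<in>{t. poly Qp t = poly Qp t0}. u - t)"
    "\<And>t0. R \<le> norm (poly Qp t0) \<Longrightarrow>
       c * (\<Prod>t\<in>{t. poly Qp t = poly Qp t0} - {t0}. norm (poly Pp t0 - poly Pp t)) \<le> norm (poly (pderiv Qp) t0)"
proof -
  let ?F = "inv f"
  note inv = poly_diffeo_inverse[OF f]
  have le: "poly_le (poly_map_degree f) (\<lambda>z. f z $ i)" "poly_le (poly_map_degree ?F) (\<lambda>z. ?F z $ i)" for i
    using poly_diffeo_map_le[OF f] by (auto simp: map_le_def)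
  obtain P1 P2 where P: "lower (poly_map_degree f) P1" "lower (poly_map_degree f) P2"
    "\<And>z. ((\<lambda>z. f z $ 1) has_derivative (\<lambda>h. P1 z * h $ 1 + P2 z * h $ 2)) (at z)"
    by (rule poly_le_deriv[OF le(1)[of 1]]) (rule that)
  obtain Q1 Q2 where Q: "lower (poly_map_degree f) Q1" "lower (poly_map_degree f) Q2"
    "\<And>z. ((\<lambda>z. f z $ 2) has_derivative (\<lambda>h. Q1 z * h $ 1 + Q2 z * h $ 2)) (at z)"
    by (rule poly_le_deriv[OF le(1)[of 2]]) (rule that)
  obtain E1 E2 where E: "\<And>z. ((\<lambda>z. ?F z $ 1) has_derivative (\<lambda>h. E1 z * h $ 1 + E2 z * h $ 2)) (at z)"
    by (rule poly_le_deriv[OF le(2)[of 1]]) (rule that)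
  obtain G1 G2 where G: "\<And>z. ((\<lambda>z. ?F z $ 2) has_derivative (\<lambda>h. G1 z * h $ 1 + G2 z * h $ 2)) (at z)"
    by (rule poly_le_deriv[OF le(2)[of 2]]) (rule that)
  obtain \<delta> where \<delta>: "\<delta> \<noteq> 0" "\<And>z. E1 (f z) * \<delta> = Q2 z" "\<And>z. G1 (f z) * \<delta> = - Q1 z"
    by (rule jacobian_constant[OF inv(1) P(3) Q(3) E G P(1,2)[THEN lower_imp_poly_le] Q(1,2)[THEN lower_imp_poly_le]])
      (rule that)
  \<comment> \<open>\<open>A\<close> vanishes exactly on the image of the line through \<open>e\<close>\<close>
  define A where "A = (\<lambda>z. e $ 1 * ?F z $ 2 - e $ 2 * ?F z $ 1)"
  have Ale: "poly_le (poly_map_degree ?F) A"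
    unfolding A_def by (intro poly_le_diff poly_le_cmult le)
  have A0: "A z = 0 \<longleftrightarrow> (\<exists>t. z = f (t *s e))" for z
  proof
    assume "A z = 0"
    then have eq: "e $ 1 * ?F z $ 2 = e $ 2 * ?F z $ 1" by (simp add: A_def)
    have "\<exists>t. ?F z = t *s e"
    proof (cases "e $ 1 = 0")
      case True
      then have "e $ 2 \<noteq> 0" using e by (auto simp: pair2_eq_iff)
      then show ?thesis using eq True
        by (intro exI[of _ "?F z $ 2 / e $ 2"]) (simp add: pair2_eq_iff)
    next
      case False
      then show ?thesis using eq
        by (intro exI[of _ "?F z $ 1 / e $ 1"]) (simp add: pair2_eq_iff field_simps)
    qed
    then show "\<exists>t. z = f (t *s e)" using inv(2) by metis
  next
    assume "\<exists>t. z = f (t *s e)"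
    then show "A z = 0" by (auto simp: A_def inv)
  qed
  obtain a :: "complex poly poly" where a: "\<And>z. A z = poly (poly a [:z $ 1:]) (z $ 2)"
    using poly_le_bivariate[OF Ale] by metis
  have a0: "a \<noteq> 0"
  proof
    assume "a = 0"
    then have "A z = 0" for z using a by simp
    then have "A (f (pair2 1 0)) = 0" "A (f (pair2 0 1)) = 0" by auto
    then show False using e by (auto simp: A_def inv pair2_eq_iff)
  qed
  \<comment> \<open>the restriction of \<open>A\<close> to the horizontal line of height \<open>y\<close>\<close>
  define al where "al = (\<lambda>y. map_poly (\<lambda>c. poly c y) a)"
  have "poly (map_poly (\<lambda>c. poly c y) b) x = poly (poly b [:x:]) y" for x y :: complex and b
    by (induction b) (simp_all add: map_poly_pCons)
  then have al: "poly (al y) x = A (pair2 x y)" for x y by (simp add: al_def a)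
  have dal: "poly (pderiv (al y)) x = e $ 1 * G1 (pair2 x y) - e $ 2 * E1 (pair2 x y)" for x y
  proof -
    have pt: "pair2 0 y + t *s pair2 1 0 = pair2 t y" for t by (simp add: pair2_eq_iff)
    have "((\<lambda>t. A (pair2 t y)) has_field_derivative e $ 1 * G1 (pair2 x y) - e $ 2 * E1 (pair2 x y)) (at x)"
      using line_derivative[OF G, of "pair2 0 y" "pair2 1 0" x] line_derivative[OF E, of "pair2 0 y" "pair2 1 0" x]
      unfolding A_def pt by (auto intro!: derivative_eq_intros)
    then have "(poly (al y) has_field_derivative e $ 1 * G1 (pair2 x y) - e $ 2 * E1 (pair2 x y)) (at x)"
      unfolding al[symmetric] .
    then show ?thesis using poly_DERIV DERIV_unique by blast
  qed
  have dQ: "poly (pderiv Qp) t = Q1 (t *s e) * e $ 1 + Q2 (t *s e) * e $ 2" for t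
  proof -
    have "((\<lambda>t. f (t *s e) $ 2) has_field_derivative Q1 (t *s e) * e $ 1 + Q2 (t *s e) * e $ 2) (at t)"
      using line_derivative[OF Q(3), of 0 e t] by simp
    then have "(poly Qp has_field_derivative Q1 (t *s e) * e $ 1 + Q2 (t *s e) * e $ 2) (at t)"
      unfolding Qp by simp
    then show ?thesis using poly_DERIV DERIV_unique by blast
  qed
  \<comment> \<open>Cramer's rule expresses the derivative of \<open>A\<close> by that of the second component\<close>
  have key: "poly (pderiv (al (poly Qp t))) (poly Pp t) * \<delta> = - poly (pderiv Qp) t" for t
  proof -
    have ft: "pair2 (poly Pp t) (poly Qp t) = f (t *s e)" by (simp add: pair2_eq_iff Pp Qp)
    have "poly (pderiv (al (poly Qp t))) (poly Pp t) * \<delta> =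
        e $ 1 * (G1 (f (t *s e)) * \<delta>) - e $ 2 * (E1 (f (t *s e)) * \<delta>)"
      unfolding dal ft by (simp add: algebra_simps)
    then show ?thesis by (simp add: \<delta> dQ)
  qed
  obtain R1 where R1: "\<And>y. R1 \<le> norm y \<Longrightarrow> rsquarefree (Qp - [:y:])" using rsquarefree_shift[OF deg] by metis
  obtain c R2 where c: "c > 0" "\<And>y. R2 \<le> norm y \<Longrightarrow> c \<le> norm (poly (lead_coeff a) y)"
    using poly_bounded_below[of "lead_coeff a"] a0 by (metis leading_coeff_0_iff)
  have root: "{t. poly (Qp - [:y:]) t = 0} = {t. poly Qp t = y}" for y by auto
  have degy: "degree (Qp - [:y:]) = degree Qp" for y
  proof -
    have eq: "Qp - [:y:] = Qp + [:-y:]" by simp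
    have "degree (Qp + [:-y:]) = degree Qp" by (rule degree_add_eq_left) (use deg in simp)
    then show ?thesis by (simp only: eq)
  qed
  have lcy: "lead_coeff (Qp - [:y:]) = lead_coeff Qp" for y
    unfolding degy using deg by (simp add: coeff_pCons split: nat.split)
  show ?thesis
  proof (rule that[of "c * norm \<delta>" "max R1 R2"])
    show "c * norm \<delta> > 0" using c \<delta> by simp
    fix t0 u
    assume t0: "max R1 R2 \<le> norm (poly Qp t0)"
    let ?y = "poly Qp t0"
    have sq: "rsquarefree (Qp - [:?y:])" using R1 t0 by simp
    show fin: "finite {t. poly Qp t = ?y}" using rsquarefree_card_roots(1)[OF sq] unfolding root .
    show "card {t. poly Qp t = ?y} = degree Qp" using rsquarefree_card_roots(2)[OF sq] unfolding root degy .
    show "poly Qp u - ?y = lead_coeff Qp * (\<Prod>t\<in>{t. poly Qp t = ?y}. u - t)"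
      using rsquarefree_card_roots(3)[OF sq, of u] unfolding root lcy by simp
    have roots: "poly (al ?y) x = 0 \<longleftrightarrow> (\<exists>t. poly Qp t = ?y \<and> x = poly Pp t)" for x
      unfolding al A0 by (auto simp: pair2_eq_iff Pp Qp)
    have dQ0: "poly (pderiv Qp) t \<noteq> 0" if "poly Qp t = ?y" for t
      using sq that unfolding rsquarefree_roots by (auto simp: pderiv_diff pderiv_pCons)
    have sqa: "rsquarefree (al ?y)"
      unfolding rsquarefree_roots
    proof (intro allI notI)
      fix x assume x: "poly (al ?y) x = 0 \<and> poly (pderiv (al ?y)) x = 0"
      then obtain t where "poly Qp t = ?y" "x = poly Pp t" using roots by blast
      then show False using x key[of t] dQ0 by auto
    qed
    have "coeff (al ?y) (degree a) = poly (lead_coeff a) ?y"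
      unfolding al_def by (simp add: coeff_map_poly)
    moreover have nz: "norm (poly (lead_coeff a) ?y) \<ge> c" using c t0 by simp
    ultimately have "coeff (al ?y) (degree a) \<noteq> 0" using c(1) by auto
    moreover have "degree (al ?y) \<le> degree a"
      by (rule degree_le) (simp add: al_def coeff_map_poly coeff_eq_0)
    ultimately have "degree (al ?y) = degree a" by (simp add: le_antisym le_degree)
    then have lc: "lead_coeff (al ?y) = poly (lead_coeff a) ?y"
      unfolding al_def by (simp add: coeff_map_poly)
    have inj: "inj_on (poly Pp) {t. poly Qp t = ?y}"
    proof
      fix s t assume "s \<in> {t. poly Qp t = ?y}" "t \<in> {t. poly Qp t = ?y}" "poly Pp s = poly Pp t"
      then have "f (s *s e) = f (t *s e)" by (simp add: pair2_eq_iff Pp Qp)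
      then have "s *s e = t *s e" by (metis inv(1))
      then show "s = t" using e by (simp add: vec_eq_iff) blast
    qed
    have "{x. poly (al ?y) x = 0} - {poly Pp t0} = poly Pp ` ({t. poly Qp t = ?y} - {t0})"
      using roots inj by (auto dest: inj_onD)
    moreover have "inj_on (poly Pp) ({t. poly Qp t = ?y} - {t0})" using inj by (rule inj_on_subset) auto
    ultimately have prod: "(\<Prod>x\<in>{x. poly (al ?y) x = 0} - {poly Pp t0}. poly Pp t0 - x) =
       (\<Prod>t\<in>{t. poly Qp t = ?y} - {t0}. poly Pp t0 - poly Pp t)"
      by (simp add: prod.reindex)
    have "poly (pderiv (al ?y)) (poly Pp t0) = lead_coeff (al ?y) * (\<Prod>t\<in>{t. poly Qp t = ?y} - {t0}. poly Pp t0 - poly Pp t)"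
      using rsquarefree_card_roots(4)[OF sqa, of "poly Pp t0"] roots unfolding prod by blast
    then have eq: "norm (poly (lead_coeff a) ?y) * (\<Prod>t\<in>{t. poly Qp t = ?y} - {t0}. norm (poly Pp t0 - poly Pp t)) * norm \<delta>
        = norm (poly (pderiv Qp) t0)"
      using arg_cong[OF key[of t0], of norm] unfolding lc by (simp add: norm_mult prod_norm)
    have "c * (\<Prod>t\<in>{t. poly Qp t = ?y} - {t0}. norm (poly Pp t0 - poly Pp t)) * norm \<delta> \<le>
       norm (poly (lead_coeff a) ?y) * (\<Prod>t\<in>{t. poly Qp t = ?y} - {t0}. norm (poly Pp t0 - poly Pp t)) * norm \<delta>"
      by (intro mult_right_mono nz prod_nonneg) auto
    then show "c * norm \<delta> * (\<Prod>t\<in>{t. poly Qp t = ?y} - {t0}. norm (poly Pp t0 - poly Pp t)) \<le> norm (poly (pderiv Qp) t0)"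
      unfolding eq by (simp add: mult_ac)
  qed
qed

lemma norm_pair2_le: "norm (pair2 a b) \<le> norm a + norm b"
proof -
  have "norm (pair2 a b) \<le> (\<Sum>i\<in>UNIV. norm (pair2 a b $ i))"
    unfolding norm_vec_def by (rule L2_set_le_sum) auto
  then show ?thesis by (simp add: UNIV_2)
qed

text \<open>Points at distance at least one on a level set of the second component have images that
  are not too close: \<open>inv f\<close> maps the horizontal segment between the images to a path that leaves
  the unit ball around \<open>b\<close>, and inside that ball its speed is bounded by the length of the segment
  times the size of the gradient of the second component, which has degree less than \<open>q\<close>.\<close>

lemma separation_on_fibre:
  assumes f: "poly_diffeo f" and q: "poly_le q (\<lambda>z. f z $ 2)" "q > 0"
  obtains c where "c > 0"
    "\<And>a b. f a $ 2 = f b $ 2 \<Longrightarrow> 1 \<le> norm (a - b) \<Longrightarrow> c \<le> norm (f a $ 1 - f b $ 1) * (2 + norm b) ^ (q - 1)"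
proof -
  let ?F = "inv f"
  note inv = poly_diffeo_inverse[OF f]
  have le: "poly_le (poly_map_degree f) (\<lambda>z. f z $ i)" "poly_le (poly_map_degree ?F) (\<lambda>z. ?F z $ i)" for i
    using poly_diffeo_map_le[OF f] by (auto simp: map_le_def)
  obtain P1 P2 where P: "lower (poly_map_degree f) P1" "lower (poly_map_degree f) P2"
    "\<And>z. ((\<lambda>z. f z $ 1) has_derivative (\<lambda>h. P1 z * h $ 1 + P2 z * h $ 2)) (at z)"
    by (rule poly_le_deriv[OF le(1)[of 1]]) (rule that)
  obtain Q1 Q2 where Q: "lower q Q1" "lower q Q2"
    "\<And>z. ((\<lambda>z. f z $ 2) has_derivative (\<lambda>h. Q1 z * h $ 1 + Q2 z * h $ 2)) (at z)"
    by (rule poly_le_deriv[OF q(1)]) (rule that)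
  obtain E1 E2 where E: "\<And>z. ((\<lambda>z. ?F z $ 1) has_derivative (\<lambda>h. E1 z * h $ 1 + E2 z * h $ 2)) (at z)"
    by (rule poly_le_deriv[OF le(2)[of 1]]) (rule that)
  obtain G1 G2 where G: "\<And>z. ((\<lambda>z. ?F z $ 2) has_derivative (\<lambda>h. G1 z * h $ 1 + G2 z * h $ 2)) (at z)"
    by (rule poly_le_deriv[OF le(2)[of 2]]) (rule that)
  obtain \<delta> where \<delta>: "\<delta> \<noteq> 0" "\<And>z. E1 (f z) * \<delta> = Q2 z" "\<And>z. G1 (f z) * \<delta> = - Q1 z"
    by (rule jacobian_constant[OF inv(1) P(3) Q(3) E G P(1,2)[THEN lower_imp_poly_le] Q(1,2)[THEN lower_imp_poly_le]])
      (rule that)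
  have "poly_le (q - 1) Q1" "poly_le (q - 1) Q2" using Q(1,2) q(2) by (auto simp: lower_def)
  then obtain C1 C2 where C: "C1 > 0" "C2 > 0"
    "\<And>z. norm (Q1 z) \<le> C1 * (1 + norm z) ^ (q - 1)" "\<And>z. norm (Q2 z) \<le> C2 * (1 + norm z) ^ (q - 1)"
    using poly_le_growth by metis
  define C where "C = (C1 + C2) / norm \<delta>"
  have Cpos: "C > 0" using C \<delta> by (simp add: C_def)
  have bound: "norm (pair2 (E1 w) (G1 w)) \<le> C * (1 + norm (?F w)) ^ (q - 1)" for w
  proof -
    have "norm (E1 w) * norm \<delta> = norm (Q2 (?F w))" "norm (G1 w) * norm \<delta> = norm (Q1 (?F w))"
      using \<delta>(2,3)[of "?F w"] inv by (metis norm_mult, metis norm_mult norm_minus_cancel)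
    then have "(norm (E1 w) + norm (G1 w)) * norm \<delta> \<le> (C1 + C2) * (1 + norm (?F w)) ^ (q - 1)"
      using C(3)[of "?F w"] C(4)[of "?F w"] by (simp add: algebra_simps)
    then have "norm (E1 w) + norm (G1 w) \<le> C * (1 + norm (?F w)) ^ (q - 1)"
      using \<delta>(1) by (simp add: C_def field_simps)
    then show ?thesis using norm_pair2_le[of "E1 w" "G1 w"] by linarith
  qed
  show ?thesis
  proof (rule that[of "1 / C"])
    show "1 / C > 0" using Cpos by simp
    fix a b assume fib: "f a $ 2 = f b $ 2" and dist: "1 \<le> norm (a - b)"
    define D where "D = f a $ 1 - f b $ 1"
    \<comment> \<open>the horizontal segment between the two images, and its preimage\<close>
    define L where "L = (\<lambda>x::real. f b + of_real x *s pair2 D 0)"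
    define \<gamma> where "\<gamma> = (\<lambda>x. ?F (L x))"
    have L01: "L 0 = f b" "L 1 = f a"
      using fib by (auto simp: L_def D_def pair2_eq_iff)
    have \<gamma>01: "\<gamma> 0 = b" "\<gamma> 1 = a" by (simp_all add: \<gamma>_def L01 inv)
    have d\<gamma>: "(\<gamma> has_derivative (\<lambda>h. h *\<^sub>R (D *s pair2 (E1 (L x)) (G1 (L x))))) (at x within S)" for x S
    proof -
      have bl: "bounded_linear (\<lambda>x::real. of_real x *s pair2 D 0 :: complex^2)"
        using bounded_linear_compose[OF bounded_linear_smult_left bounded_linear_of_real] .
      have dL: "(L has_derivative (\<lambda>h. of_real h *s pair2 D 0)) (at x within S)"
        unfolding L_def using has_derivative_add[OF has_derivative_const[of "f b"]
        bounded_linear_imp_has_derivative[OF bl]] by simp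
      have "((\<lambda>x. pair2 (?F (L x) $ 1) (?F (L x) $ 2)) has_derivative
         (\<lambda>h. pair2 (E1 (L x) * (of_real h * D)) (G1 (L x) * (of_real h * D)))) (at x within S)"
        using has_derivative_pair2[OF has_derivative_compose[OF dL E] has_derivative_compose[OF dL G]]
        by simp
      moreover have "(\<lambda>h. pair2 (E1 (L x) * (of_real h * D)) (G1 (L x) * (of_real h * D))) =
         (\<lambda>h. h *\<^sub>R (D *s pair2 (E1 (L x)) (G1 (L x))))"
        by (auto simp: pair2_eq_iff fun_eq_iff scaleR_conv_of_real[where 'a = complex])
      ultimately show ?thesis by (simp add: \<gamma>_def pair2_eta)
    qed
    have cont: "continuous_on {0..1} \<gamma>"
      by (rule has_derivative_continuous_on[OF d\<gamma>])
    \<comment> \<open>the infimum of \<open>K\<close> is the first time at which the path leaves the unit ball around \<open>b\<close>\<close>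
    define K where "K = {x \<in> {0..1}. 1 \<le> norm (\<gamma> x - b)}"
    have "closed K" unfolding K_def
      by (intro continuous_on_closed_Collect_le continuous_intros cont)
    moreover have "bounded K"
      by (rule bounded_subset[OF bounded_closed_interval[of 0 1]]) (auto simp: K_def)
    ultimately have "compact K" by (simp add: compact_eq_bounded_closed)
    moreover have "1 \<in> K" using dist \<gamma>01 by (simp add: K_def)
    ultimately obtain x where x: "x \<in> K" "\<And>y. y \<in> K \<Longrightarrow> x \<le> y"
      using compact_attains_inf[of K] by auto
    then have x01: "0 \<le> x" "x \<le> 1" by (auto simp: K_def)
    have near: "norm (\<gamma> y - b) \<le> 1" if "0 \<le> y" "y < x" for y
    proof (rule ccontr)
      assume "\<not> norm (\<gamma> y - b) \<le> 1"
      then have "y \<in> K" using that x01 by (simp add: K_def)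
      then show False using x(2) that by fastforce
    qed
    have near': "norm (\<gamma> y - b) \<le> 1" if y: "y \<in> {0..x}" for y
    proof (cases "y < x")
      case False
      then have yx: "y = x" using y by simp
      have "x \<noteq> 0" using x(1) \<gamma>01 by (auto simp: K_def)
      then have x0: "x > 0" using x01 by simp
      have "continuous_on {0..x} (\<lambda>y. norm (\<gamma> y - b))"
        using cont x01 by (intro continuous_intros continuous_on_subset[OF cont]) auto
      then have "((\<lambda>y. norm (\<gamma> y - b)) \<longlongrightarrow> norm (\<gamma> x - b)) (at_left x)"
        by (rule continuous_on_Icc_at_leftD[OF _ x0])
      moreover have "\<forall>\<^sub>F y in at_left x. norm (\<gamma> y - b) \<le> 1"
        using eventually_at_left_real[OF x0] by eventually_elim (auto intro: near)
      ultimately show ?thesis using tendsto_upperbound yx trivial_limit_at_left_real by metis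
    qed (use near y in auto)
    let ?B = "norm D * (C * (2 + norm b) ^ (q - 1))"
    have "norm (\<gamma> x - \<gamma> 0) \<le> ?B * norm (x - 0)"
    proof (rule differentiable_bound[of "{0..x}"])
      fix y assume y: "y \<in> {0..x}"
      show "(\<gamma> has_derivative (\<lambda>h. h *\<^sub>R (D *s pair2 (E1 (L y)) (G1 (L y))))) (at y within {0..x})" by (rule d\<gamma>)
      have "norm (\<gamma> y) \<le> 1 + norm b" using near'[OF y] norm_triangle_ineq2[of "\<gamma> y" b] by linarith
      then have "norm (pair2 (E1 (L y)) (G1 (L y))) \<le> C * (2 + norm b) ^ (q - 1)"
        using bound[of "L y"] Cpos unfolding \<gamma>_def
        by (smt (verit, best) mult_left_mono norm_ge_zero power_mono)
      then show "onorm (\<lambda>h. h *\<^sub>R (D *s pair2 (E1 (L y)) (G1 (L y)))) \<le> ?B"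
        using Cpos by (intro onorm_bound)
          (auto simp: norm_smult mult.commute[of "\<bar>_\<bar>"] intro!: mult_right_mono mult_left_mono)
    qed (use x01 in auto)
    moreover have "1 \<le> norm (\<gamma> x - \<gamma> 0)" using x(1) \<gamma>01 by (simp add: K_def)
    moreover have "?B * norm (x - 0) \<le> ?B * 1"
      using x01 Cpos by (intro mult_left_mono mult_nonneg_nonneg) auto
    ultimately have "1 \<le> ?B" by linarith
    then show "1 / C \<le> norm (f a $ 1 - f b $ 1) * (2 + norm b) ^ (q - 1)"
      using Cpos by (simp add: D_def field_simps)
  qed
qed

section \<open>The degrees of the components of an automorphism\<close>

lemma finite_family_subseq:
  fixes t :: "nat \<Rightarrow> nat \<Rightarrow> complex"
  assumes "\<And>i. i < q \<Longrightarrow> bounded (range (\<lambda>n. t n i))"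
  shows "\<exists>r \<tau>. strict_mono (r :: nat \<Rightarrow> nat) \<and> (\<forall>i<q. (\<lambda>n. t (r n) i) \<longlonglongrightarrow> \<tau> i)"
  using assms
proof (induction q)
  case 0
  show ?case by (intro exI[of _ id]) (auto simp: strict_mono_def)
next
  case (Suc q)
  then obtain r \<tau> where r: "strict_mono (r :: nat \<Rightarrow> nat)" "\<And>i. i < q \<Longrightarrow> (\<lambda>n. t (r n) i) \<longlonglongrightarrow> \<tau> i" by auto
  have "bounded (range (\<lambda>n. t (r n) q))"
    by (rule bounded_subset[OF Suc.prems[of q]]) auto
  then obtain l s where s: "strict_mono (s :: nat \<Rightarrow> nat)" "((\<lambda>n. t (r n) q) \<circ> s) \<longlonglongrightarrow> l"
    using bounded_imp_convergent_subsequence by blast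
  have "(\<lambda>n. t ((r \<circ> s) n) i) \<longlonglongrightarrow> (\<tau>(q := l)) i" if "i < Suc q" for i
  proof (cases "i = q")
    case True then show ?thesis using s(2) by (simp add: o_def)
  next
    case False
    then show ?thesis using LIMSEQ_subseq_LIMSEQ[OF r(2)[of i] s(1)] that by (simp add: o_def)
  qed
  then show ?case using strict_mono_o[OF r(1) s(1)] by blast
qed

text \<open>The common solutions of \<open>w ^ q = 1\<close> and \<open>w ^ p = 1\<close> form a subgroup of the \<open>q\<close>-th roots of
  unity. It is proper as \<open>q\<close> does not divide \<open>p\<close>, so it contains at most half of them.\<close>

lemma roots_of_unity_half:
  assumes "q > 0" "\<not> q dvd p"
  shows "q \<le> 2 * card {w :: complex. w ^ q = 1 \<and> w ^ p \<noteq> 1}"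
proof -
  let ?H = "{w :: complex. w ^ q = 1 \<and> w ^ p = 1}" and ?K = "{w :: complex. w ^ q = 1 \<and> w ^ p \<noteq> 1}"
  define u where "u = exp (2 * of_real pi * \<i> * of_nat 1 / of_nat q :: complex)"
  have upow: "u ^ k = exp (2 * of_real pi * \<i> * of_nat k / of_nat q)" for k
    unfolding u_def exp_of_nat_mult[symmetric] by (simp add: field_simps)
  have u: "u ^ q = 1" "u ^ p \<noteq> 1" "u \<noteq> 0"
    unfolding upow using complex_root_unity_eq_1[of q q] complex_root_unity_eq_1[of q p] assms
    by (auto simp: u_def)
  have fin: "finite {w :: complex. w ^ q = 1}" using finite_roots_unity[of q] assms by simp
  have c: "card {w :: complex. w ^ q = 1} = q" using card_roots_unity_eq assms by simp
  have un: "{w :: complex. w ^ q = 1} = ?H \<union> ?K" by auto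
  have "card (?H \<union> ?K) = card ?H + card ?K"
    by (rule card_Un_disjoint) (auto intro: finite_subset[OF _ fin])
  moreover have "card ?H \<le> card ?K"
  proof (rule card_inj_on_le[of "\<lambda>w. u * w"])
    show "inj_on (\<lambda>w. u * w) ?H" using u by (auto simp: inj_on_def)
    show "(\<lambda>w. u * w) ` ?H \<subseteq> ?K" using u by (auto simp: power_mult_distrib)
    show "finite ?K" by (rule finite_subset[OF _ fin]) auto
  qed
  ultimately show ?thesis using c unfolding un by linarith
qed

lemma has_top_ray_bounds:
  assumes "has_top q F T" "T e \<noteq> 0"
  obtains R where "R > 0"
    "\<And>t. R \<le> norm t \<Longrightarrow> norm (T e) / 2 * norm t ^ q \<le> norm (F (t *s e))"
    "\<And>t. R \<le> norm t \<Longrightarrow> norm (F (t *s e)) \<le> 2 * norm (T e) * norm t ^ q"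
proof -
  have "((\<lambda>t. F (t *s e) / t ^ q) \<longlongrightarrow> T e) at_infinity"
    by (rule has_top_limit[OF assms(1)]) (auto intro: filterlim_ident)
  then have lim: "((\<lambda>t. norm (F (t *s e) / t ^ q)) \<longlongrightarrow> norm (T e)) at_infinity" by (rule tendsto_norm)
  have "norm (T e) / 2 < norm (T e)" "norm (T e) < 2 * norm (T e)" using assms(2) by auto
  then have "\<forall>\<^sub>F t in at_infinity. norm (T e) / 2 < norm (F (t *s e) / t ^ q) \<and> norm (F (t *s e) / t ^ q) < 2 * norm (T e)"
    using order_tendstoD[OF lim] eventually_conj by blast
  then obtain b where b: "\<And>t. b \<le> norm t \<Longrightarrow> norm (T e) / 2 < norm (F (t *s e) / t ^ q) \<and> norm (F (t *s e) / t ^ q) < 2 * norm (T e)"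
    unfolding eventually_at_infinity by blast
  have *: "norm (T e) / 2 * norm t ^ q \<le> norm (F (t *s e)) \<and> norm (F (t *s e)) \<le> 2 * norm (T e) * norm t ^ q"
    if "max b 1 \<le> norm t" for t
  proof -
    have "norm t > 0" using that by auto
    then show ?thesis using b[of t] that by (auto simp: norm_divide norm_power field_simps)
  qed
  show ?thesis by (rule that[of "max b 1"]) (use * in auto)
qed

text \<open>If \<open>q\<close> does not divide \<open>p\<close>, the growth of the two sides of the estimate in
  \<open>fibre_product_bound\<close> along \<open>t0 = n \<rightarrow> \<infinity>\<close> is contradictory. The points of the fibre, divided by
  \<open>n\<close>, tend to the \<open>q\<close>-th roots of unity. Those with limit \<open>w\<close> such that \<open>w ^ p \<noteq> 1\<close>, at least half of
  them, contribute factors of order \<open>n ^ p\<close>; by \<open>separation_on_fibre\<close> each of the others, apart from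
  \<open>t0\<close>, contributes at least a factor of order \<open>n ^ - (q - 1)\<close>. As \<open>q \<le> p\<close>, the product exceeds the order
  \<open>n ^ (q - 1)\<close> of the derivative.\<close>

lemma degree_divides:
  assumes f: "poly_diffeo f"
    and P: "has_top p (\<lambda>z. f z $ 1) TP" and Q: "has_top q (\<lambda>z. f z $ 2) TQ"
    and TP: "TP e \<noteq> 0" and TQ: "TQ e \<noteq> 0" and q: "0 < q" "q \<le> p"
  shows "q dvd p"
proof (rule ccontr)
  assume ndvd: "\<not> q dvd p"
  have e: "e \<noteq> 0"
  proof
    assume "e = 0"
    then have "TQ e = TQ (0 *s e)" by (metis vector_smult_lzero)
    also have "\<dots> = 0" using homog_scale[of q TQ 0 e] Q q by (simp add: has_top_def)
    finally show False using TQ by simp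
  qed
  obtain Pp where Pp: "\<And>t. f (t *s e) $ 1 = poly Pp t"
    by (rule has_top_line[OF P, of e 0]) (rule that, simp)
  obtain Qp where Qp: "degree Qp \<le> q" "coeff Qp q = TQ e" "\<And>t. f (t *s e) $ 2 = poly Qp t"
    by (rule has_top_line[OF Q, of e 0]) (rule that, simp_all)
  have dQ: "degree Qp = q" using Qp(1,2) TQ by (simp add: le_degree order_antisym)
  obtain c R where c: "c > 0"
    and fin: "\<And>t0. R \<le> norm (poly Qp t0) \<Longrightarrow> finite {t. poly Qp t = poly Qp t0}"
    and card: "\<And>t0. R \<le> norm (poly Qp t0) \<Longrightarrow> card {t. poly Qp t = poly Qp t0} = degree Qp"
    and dec: "\<And>t0 u. R \<le> norm (poly Qp t0) \<Longrightarrow>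
       poly Qp u - poly Qp t0 = lead_coeff Qp * (\<Prod>t\<in>{t. poly Qp t = poly Qp t0}. u - t)"
    and key: "\<And>t0. R \<le> norm (poly Qp t0) \<Longrightarrow>
       c * (\<Prod>t\<in>{t. poly Qp t = poly Qp t0} - {t0}. norm (poly Pp t0 - poly Pp t)) \<le> norm (poly (pderiv Qp) t0)"
    by (rule fibre_product_bound[OF f Pp Qp(3) _ e]) (use dQ q in simp, rule that)
  obtain c2 where c2: "c2 > 0"
    "\<And>a b. f a $ 2 = f b $ 2 \<Longrightarrow> 1 \<le> norm (a - b) \<Longrightarrow> c2 \<le> norm (f a $ 1 - f b $ 1) * (2 + norm b) ^ (q - 1)"
    using separation_on_fibre[OF f has_top_imp_poly_le[OF Q] q(1)] by metis
  obtain R1 where R1: "R1 > 0"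
    "\<And>t. R1 \<le> norm t \<Longrightarrow> norm (TQ e) / 2 * norm t ^ q \<le> norm (poly Qp t)"
    "\<And>t. R1 \<le> norm t \<Longrightarrow> norm (poly Qp t) \<le> 2 * norm (TQ e) * norm t ^ q"
    by (rule has_top_ray_bounds[OF Q TQ]) (rule that, simp_all add: Qp)
  obtain C3 where C3: "C3 > 0" "\<And>t. norm (poly (pderiv Qp) t) \<le> C3 * (1 + norm t) ^ (q - 1)"
  proof -
    obtain Q1 Q2 where Q12: "lower q Q1" "lower q Q2"
      "\<And>z. ((\<lambda>z. f z $ 2) has_derivative (\<lambda>h. Q1 z * h $ 1 + Q2 z * h $ 2)) (at z)"
      by (rule poly_le_deriv[OF has_top_imp_poly_le[OF Q]]) (rule that)
    have D: "poly (pderiv Qp) t = e $ 1 * Q1 (t *s e) + e $ 2 * Q2 (t *s e)" for t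
    proof -
      have "((\<lambda>t. f (t *s e) $ 2) has_field_derivative Q1 (t *s e) * e $ 1 + Q2 (t *s e) * e $ 2) (at t)"
        using line_derivative[OF Q12(3), of 0 e t] by simp
      then have "(poly Qp has_field_derivative Q1 (t *s e) * e $ 1 + Q2 (t *s e) * e $ 2) (at t)"
        unfolding Qp by simp
      then show ?thesis using DERIV_unique[OF poly_DERIV[of Qp t]] by (simp add: mult.commute)
    qed
    have le: "poly_le (q - 1) (\<lambda>z. e $ 1 * Q1 z + e $ 2 * Q2 z)"
      using Q12(1,2) q by (intro poly_le_add poly_le_cmult) (auto simp: lower_def)
    obtain C where C: "C > 0" "\<And>z. norm (e $ 1 * Q1 z + e $ 2 * Q2 z) \<le> C * (1 + norm z) ^ (q - 1)"
      by (rule poly_le_growth[OF le]) (rule that)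
    have "norm (poly (pderiv Qp) t) \<le> C * (1 + norm e) ^ (q - 1) * (1 + norm t) ^ (q - 1)" for t
    proof -
      have "1 + norm (t *s e) \<le> (1 + norm e) * (1 + norm t)" by (simp add: norm_smult algebra_simps)
      then have "(1 + norm (t *s e)) ^ (q - 1) \<le> ((1 + norm e) * (1 + norm t)) ^ (q - 1)"
        by (intro power_mono) (auto simp: add_nonneg_nonneg)
      then show ?thesis using C(2)[of "t *s e"] C(1) unfolding D power_mult_distrib mult.assoc
        by (meson mult_left_mono order_trans less_imp_le)
    qed
    then show thesis using that[of "C * (1 + norm e) ^ (q - 1)"] C(1)
      by (simp add: add_pos_nonneg)
  qed
  \<comment> \<open>the indices at which all the estimates apply\<close>
  have large: "\<forall>\<^sub>F n in sequentially. R \<le> norm (poly Qp (of_nat n)) \<and> R1 \<le> real n \<and> 1 \<le> n"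
  proof -
    have "filterlim (\<lambda>n. norm (TQ e) / 2 * real n ^ q) at_top sequentially"
      using TQ q by (intro filterlim_tendsto_pos_mult_at_top[OF tendsto_const] filterlim_pow_at_top filterlim_real_sequentially) auto
    then have "\<forall>\<^sub>F n in sequentially. R \<le> norm (TQ e) / 2 * real n ^ q" by (simp add: filterlim_at_top)
    moreover have "\<forall>\<^sub>F n in sequentially. R1 \<le> real n" using filterlim_real_sequentially by (simp add: filterlim_at_top)
    ultimately show ?thesis using eventually_ge_at_top[of 1]
    proof eventually_elim
      case (elim n)
      then show ?case using R1(2)[of "of_nat n"] by auto
    qed
  qed
  then obtain n0 where n0: "\<And>n. n0 \<le> n \<Longrightarrow> R \<le> norm (poly Qp (of_nat n))" "\<And>n. n0 \<le> n \<Longrightarrow> R1 \<le> real n" "n0 \<ge> 1"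
    unfolding eventually_sequentially by (metis le_trans nat_le_linear)
  \<comment> \<open>\<open>y n\<close> enumerates the fibre through \<open>s n\<close>, starting with \<open>s n\<close> itself, and \<open>t n\<close> rescales it\<close>
  define s where "s = (\<lambda>n. of_nat (n + n0) :: complex)"
  let ?R = "\<lambda>n. {t. poly Qp t = poly Qp (s n)}"
  have s_ok: "R \<le> norm (poly Qp (s n))" "R1 \<le> norm (s n)" "norm (s n) \<ge> 1" "s n \<noteq> 0" for n
    using n0(1)[of "n + n0"] n0(2)[of "n + n0"] n0(3) norm_of_nat[of "n + n0", where 'a = complex]
    unfolding s_def by (simp_all del: norm_of_nat of_nat_add)
  have s_inf: "filterlim s at_infinity sequentially"
    unfolding s_def using filterlim_compose[OF of_nat_at_infinity filterlim_add_const_nat_at_top] .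
  have "\<exists>h. bij_betw h {1..<q} (?R n - {s n})" for n
  proof -
    have "card (?R n - {s n}) = card {1..<q}"
      using card[OF s_ok(1)] dQ by (simp add: card_Diff_singleton)
    then show ?thesis
      using finite_same_card_bij[of "{1..<q}" "?R n - {s n}"] fin[OF s_ok(1)] by auto
  qed
  then obtain h where h: "\<And>n. bij_betw (h n) {1..<q} (?R n - {s n})" by metis
  define y where "y n i = (if i = 0 then s n else h n i)" for n i
  define t where "t n i = y n i / s n" for n i
  have ybij: "bij_betw (y n) {..<q} (?R n)" for n
  proof -
    have "bij_betw (y n) {1..<q} (?R n - {s n})"
      using h[of n] by (rule bij_betw_cong[THEN iffD1, rotated]) (auto simp: y_def)
    then have "bij_betw (y n) ({0} \<union> {1..<q}) ({s n} \<union> (?R n - {s n}))"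
      by (intro bij_betw_combine) (auto simp: y_def)
    moreover have "{0} \<union> {1..<q} = {..<q}" using q by auto
    moreover have "{s n} \<union> (?R n - {s n}) = ?R n" by auto
    ultimately show ?thesis by simp
  qed
  have yQ: "poly Qp (y n i) = poly Qp (s n)" if "i < q" for n i
    using bij_betwE[OF ybij[of n]] that by auto
  have tb: "norm (t n i) \<le> 4" if "i < q" for n i
  proof (cases "R1 \<le> norm (y n i)")
    case True
    have "norm (TQ e) / 2 * norm (y n i) ^ q \<le> 2 * norm (TQ e) * norm (s n) ^ q"
      using R1(2)[OF True] R1(3)[OF s_ok(2)] yQ[OF that, of n] by (metis order_trans)
    then have "norm (y n i) ^ q \<le> 4 * norm (s n) ^ q" using TQ by (simp add: field_simps)
    also have "\<dots> \<le> 4 ^ q * norm (s n) ^ q"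
      using self_le_power[of "4::real" q] q by (intro mult_right_mono) auto
    finally have "norm (y n i) \<le> 4 * norm (s n)"
      using q by (metis power_mult_distrib power_mono_iff norm_ge_zero mult_nonneg_nonneg zero_le_numeral)
    then show ?thesis using s_ok(4)[of n] by (simp add: t_def norm_divide field_simps)
  next
    case False
    then have "norm (y n i) \<le> 4 * norm (s n)" using s_ok(2)[of n] norm_ge_zero[of "s n"] by linarith
    then show ?thesis using s_ok(4)[of n] by (simp add: t_def norm_divide field_simps)
  qed
  have "bounded (range (\<lambda>n. t n i))" if "i < q" for i
    unfolding bounded_iff using tb[OF that] by auto
  then obtain r \<tau> where r: "strict_mono (r :: nat \<Rightarrow> nat)" "\<And>i. i < q \<Longrightarrow> (\<lambda>n. t (r n) i) \<longlonglongrightarrow> \<tau> i"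
    using finite_family_subseq[of q t] by blast
  have sr_inf: "filterlim (\<lambda>n. s (r n)) at_infinity sequentially"
    using filterlim_compose[OF s_inf filterlim_subseq[OF r(1)]] .
  have scaledQ: "(\<lambda>n. poly Qp (s (r n) * w) / s (r n) ^ q) \<longlonglongrightarrow> TQ (w *s e)" for w
    using has_top_limit[OF Q sr_inf tendsto_const[of "w *s e"]] by (simp add: vector_smult_assoc Qp)
  have TQs: "TQ (w *s e) = w ^ q * TQ e" "TP (w *s e) = w ^ p * TP e" for w
    using homog_scale P Q by (auto simp: has_top_def)
  \<comment> \<open>the limits of the rescaled fibre are the \<open>q\<close>-th roots of unity\<close>
  have prod: "(\<Prod>i<q. u - \<tau> i) = u ^ q - 1" for u
  proof -
    have L1: "(\<lambda>n. \<Prod>i<q. u - t (r n) i) \<longlonglongrightarrow> (\<Prod>i<q. u - \<tau> i)"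
      by (intro tendsto_prod tendsto_intros r(2)) auto
    have E: "(\<Prod>i<q. u - t (r n) i) =
       (poly Qp (s (r n) * u) / s (r n) ^ q - poly Qp (s (r n) * 1) / s (r n) ^ q) / TQ e" for n
    proof -
      let ?x = "s (r n)"
      have "poly Qp (?x * u) - poly Qp ?x = TQ e * (\<Prod>t\<in>?R (r n). ?x * u - t)"
        using dec[OF s_ok(1)[of "r n"], of "?x * u"] Qp dQ by simp
      also have "(\<Prod>t\<in>?R (r n). ?x * u - t) = (\<Prod>i<q. ?x * u - y (r n) i)"
        by (rule prod.reindex_bij_betw[OF ybij, symmetric])
      also have "\<dots> = (\<Prod>i<q. ?x * (u - t (r n) i))"
        using s_ok(4)[of "r n"] by (intro prod.cong refl) (simp add: t_def field_simps)
      also have "\<dots> = ?x ^ q * (\<Prod>i<q. u - t (r n) i)" by (simp add: prod.distrib)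
      finally have "poly Qp (?x * u) - poly Qp ?x = TQ e * (?x ^ q * (\<Prod>i<q. u - t (r n) i))" .
      moreover have "(a * (b * c)) / b / a = c" if "a \<noteq> 0" "b \<noteq> 0" for a b c :: complex
        using that by simp
      ultimately show ?thesis using TQ s_ok(4)[of "r n"]
        by (simp only: diff_divide_distrib[symmetric] mult_1_right power_not_zero not_False_eq_True)
    qed
    have L2: "(\<lambda>n. (poly Qp (s (r n) * u) / s (r n) ^ q - poly Qp (s (r n) * 1) / s (r n) ^ q) / TQ e)
        \<longlonglongrightarrow> (TQ (u *s e) - TQ (1 *s e)) / TQ e"
      using TQ by (intro tendsto_intros scaledQ)
    have "(\<Prod>i<q. u - \<tau> i) = (TQ (u *s e) - TQ (1 *s e)) / TQ e"
      by (rule LIMSEQ_unique[OF L1[unfolded E] L2])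
    then show ?thesis using TQ unfolding TQs by (simp add: diff_divide_distrib)
  qed
  have im: "\<tau> ` {..<q} = {u. u ^ q = 1}"
  proof (intro set_eqI)
    fix u
    have "u ^ q = 1 \<longleftrightarrow> (\<Prod>i<q. u - \<tau> i) = 0" by (simp add: prod)
    then show "u \<in> \<tau> ` {..<q} \<longleftrightarrow> u \<in> {u. u ^ q = 1}" by (auto simp: prod_zero_iff)
  qed
  then have "card (\<tau> ` {..<q}) = card {..<q}" using card_roots_unity_eq[of q] q by simp
  then have inj: "inj_on \<tau> {..<q}" by (intro eq_card_imp_inj_on) auto
  have \<tau>0: "\<tau> 0 = 1"
  proof -
    have "(\<lambda>n. t (r n) 0) = (\<lambda>n. 1)" using s_ok(4) by (auto simp: t_def y_def)
    then show ?thesis using r(2)[of 0] q LIMSEQ_unique[OF tendsto_const[of 1]] by metis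
  qed
  define I where "I = {i \<in> {1..<q}. \<tau> i ^ p \<noteq> 1}"
  define I' where "I' = {1..<q} - I"
  have "\<tau> ` I = {w :: complex. w ^ q = 1 \<and> w ^ p \<noteq> 1}"
  proof (intro set_eqI iffI)
    fix w assume "w \<in> {w :: complex. w ^ q = 1 \<and> w ^ p \<noteq> 1}"
    then obtain i where i: "i < q" "w = \<tau> i" "w ^ p \<noteq> 1" using im by blast
    then have "i \<noteq> 0" using \<tau>0 by (metis power_one)
    then show "w \<in> \<tau> ` I" using i by (auto simp: I_def)
  qed (use im in \<open>auto simp: I_def\<close>)
  moreover have "inj_on \<tau> I" by (rule inj_on_subset[OF inj]) (auto simp: I_def)
  ultimately have cI: "q \<le> 2 * card I" using roots_of_unity_half[OF q(1) ndvd] by (metis card_image)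
  have finI: "finite I" "finite I'" by (auto simp: I_def I'_def)
  have cI': "card I' + 1 + card I = q"
  proof -
    have "card I' = card {1..<q} - card I" unfolding I'_def
      by (rule card_Diff_subset) (use finI in \<open>auto simp: I_def\<close>)
    moreover have "card I \<le> card {1..<q}" by (rule card_mono) (auto simp: I_def)
    ultimately show ?thesis using q by simp
  qed
  \<comment> \<open>lower bounds for the individual factors\<close>
  have low1: "\<exists>b>0. \<forall>\<^sub>F n in sequentially. b * norm (s (r n)) ^ p \<le> norm (poly Pp (s (r n)) - poly Pp (y (r n) i))"
    if "i \<in> I" for i
  proof -
    have iq: "i < q" "\<tau> i ^ p \<noteq> 1" using that by (auto simp: I_def)
    have "(\<lambda>n. t (r n) i *s e) \<longlonglongrightarrow> \<tau> i *s e"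
      by (rule bounded_linear.tendsto[OF bounded_linear_smult_left r(2)[OF iq(1)]])
    from has_top_limit[OF P sr_inf this]
    have "(\<lambda>n. poly Pp (y (r n) i) / s (r n) ^ p) \<longlonglongrightarrow> \<tau> i ^ p * TP e"
      using s_ok(4) by (simp add: vector_smult_assoc Pp TQs t_def)
    moreover have "(\<lambda>n. poly Pp (s (r n)) / s (r n) ^ p) \<longlonglongrightarrow> TP e"
      using has_top_limit[OF P sr_inf tendsto_const[of e]] by (simp add: Pp)
    ultimately have "(\<lambda>n. norm (poly Pp (s (r n)) / s (r n) ^ p - poly Pp (y (r n) i) / s (r n) ^ p))
       \<longlonglongrightarrow> norm (TP e - \<tau> i ^ p * TP e)"
      by (intro tendsto_intros)
    moreover define b where "b = norm (TP e - \<tau> i ^ p * TP e) / 2"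
    have "b > 0" "b < norm (TP e - \<tau> i ^ p * TP e)" using iq TP by (auto simp: b_def)
    ultimately have "\<forall>\<^sub>F n in sequentially. b < norm (poly Pp (s (r n)) / s (r n) ^ p - poly Pp (y (r n) i) / s (r n) ^ p)"
      using order_tendstoD(1) by blast
    then have "\<forall>\<^sub>F n in sequentially. b * norm (s (r n)) ^ p \<le> norm (poly Pp (s (r n)) - poly Pp (y (r n) i))"
    proof eventually_elim
      case (elim n)
      have "norm (s (r n)) ^ p > 0" using s_ok(4)[of "r n"] by (simp del: of_nat_add)
      then show ?case using elim
        by (simp add: diff_divide_distrib[symmetric] norm_divide norm_power field_simps del: of_nat_add norm_of_nat)
    qed
    then show ?thesis using \<open>b > 0\<close> by blast
  qed
  have low2: "\<exists>b>0. \<forall>\<^sub>F n in sequentially. b \<le> norm (poly Pp (s (r n)) - poly Pp (y (r n) i)) * norm (s (r n)) ^ (q - 1)"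
    if "i \<in> I'" for i
  proof -
    have iq: "i < q" "i \<noteq> 0" using that by (auto simp: I'_def)
    then have "\<tau> i \<noteq> 1" using inj \<tau>0 q by (metis inj_onD lessThan_iff)
    then have pos: "norm (\<tau> i - 1) > 0" by simp
    have "(\<lambda>n. norm (t (r n) i - 1)) \<longlonglongrightarrow> norm (\<tau> i - 1)"
      by (intro tendsto_intros r(2) iq)
    moreover have ninf: "filterlim (\<lambda>n. norm (s (r n))) at_top sequentially"
      by (rule filterlim_compose[OF filterlim_norm_at_top sr_inf])
    ultimately have "filterlim (\<lambda>n. norm (t (r n) i - 1) * norm (s (r n))) at_top sequentially"
      using pos filterlim_tendsto_pos_mult_at_top by blast
    then have "\<forall>\<^sub>F n in sequentially. 1 / norm e \<le> norm (t (r n) i - 1) * norm (s (r n))"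
      by (simp add: filterlim_at_top)
    then have "\<forall>\<^sub>F n in sequentially. c2 / (2 + norm e) ^ (q - 1) \<le> norm (poly Pp (s (r n)) - poly Pp (y (r n) i)) * norm (s (r n)) ^ (q - 1)"
    proof eventually_elim
      case (elim n)
      let ?x = "s (r n)"
      have "y (r n) i - ?x = (t (r n) i - 1) * ?x" using s_ok(4)[of "r n"] by (simp add: t_def field_simps)
      then have "1 / norm e \<le> norm (y (r n) i - ?x)" using elim by (simp add: norm_mult del: of_nat_add norm_of_nat)
      moreover have "norm (y (r n) i *s e - ?x *s e) = norm (y (r n) i - ?x) * norm e"
        unfolding norm_smult[symmetric] by (simp add: vec_eq_iff algebra_simps)
      ultimately have "1 \<le> norm (y (r n) i *s e - ?x *s e)" using e by (simp add: field_simps)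
      moreover have "f (y (r n) i *s e) $ 2 = f (?x *s e) $ 2" using yQ[OF iq(1), of "r n"] by (simp add: Qp)
      ultimately have "c2 \<le> norm (poly Pp (y (r n) i) - poly Pp ?x) * (2 + norm (?x *s e)) ^ (q - 1)"
        using c2(2) unfolding Pp[symmetric] by blast
      also have "\<dots> \<le> norm (poly Pp (y (r n) i) - poly Pp ?x) * ((2 + norm e) * norm ?x) ^ (q - 1)"
      proof (intro mult_left_mono power_mono)
        show "2 + norm (?x *s e) \<le> (2 + norm e) * norm ?x"
          unfolding norm_smult using s_ok(3)[of "r n"] by (simp only: distrib_right) (simp only: mult.commute; linarith)
      qed (auto simp: add_nonneg_nonneg)
      finally have "c2 \<le> norm (poly Pp ?x - poly Pp (y (r n) i)) * norm ?x ^ (q - 1) * (2 + norm e) ^ (q - 1)"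
        unfolding power_mult_distrib by (simp only: norm_minus_commute mult_ac)
      moreover have "(2 + norm e) ^ (q - 1) > 0" by (intro zero_less_power add_pos_nonneg) auto
      ultimately show ?case by (simp only: pos_divide_le_eq)
    qed
    moreover have "c2 / (2 + norm e) ^ (q - 1) > 0"
      using c2(1) by (intro divide_pos_pos zero_less_power add_pos_nonneg) auto
    ultimately show ?thesis by blast
  qed
  have "\<forall>i\<in>I. \<exists>b>0. \<forall>\<^sub>F n in sequentially. b * norm (s (r n)) ^ p \<le> norm (poly Pp (s (r n)) - poly Pp (y (r n) i))"
    using low1 by (intro ballI)
  from bchoice[OF this] obtain b where b: "\<And>i. i \<in> I \<Longrightarrow> b i > 0"
    "\<And>i. i \<in> I \<Longrightarrow> \<forall>\<^sub>F n in sequentially. b i * norm (s (r n)) ^ p \<le> norm (poly Pp (s (r n)) - poly Pp (y (r n) i))"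
    by blast
  have "\<forall>i\<in>I'. \<exists>b>0. \<forall>\<^sub>F n in sequentially. b \<le> norm (poly Pp (s (r n)) - poly Pp (y (r n) i)) * norm (s (r n)) ^ (q - 1)"
    using low2 by (intro ballI)
  from bchoice[OF this] obtain b' where b': "\<And>i. i \<in> I' \<Longrightarrow> b' i > 0"
    "\<And>i. i \<in> I' \<Longrightarrow> \<forall>\<^sub>F n in sequentially. b' i \<le> norm (poly Pp (s (r n)) - poly Pp (y (r n) i)) * norm (s (r n)) ^ (q - 1)"
    by blast
  define B where "B = c * ((\<Prod>i\<in>I. b i) * (\<Prod>i\<in>I'. b' i))"
  have Bpos: "B > 0" unfolding B_def using c b(1) b'(1) by (simp add: prod_pos)
  \<comment> \<open>the total order of the derivative and of the reciprocals of the factors indexed by \<open>I'\<close>\<close>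
  define m where "m = (q - 1) * (q - card I)"
  have "\<forall>\<^sub>F n in sequentially. \<forall>i\<in>I. b i * norm (s (r n)) ^ p \<le> norm (poly Pp (s (r n)) - poly Pp (y (r n) i))"
    using b(2) finI by (intro eventually_ball_finite) auto
  moreover have "\<forall>\<^sub>F n in sequentially. \<forall>i\<in>I'. b' i \<le> norm (poly Pp (s (r n)) - poly Pp (y (r n) i)) * norm (s (r n)) ^ (q - 1)"
    using b'(2) finI by (intro eventually_ball_finite) auto
  ultimately have upper: "\<forall>\<^sub>F n in sequentially. B * norm (s (r n)) ^ (p * card I) \<le> C3 * 2 ^ (q - 1) * norm (s (r n)) ^ m"
  proof eventually_elim
    case (elim n)
    let ?x = "s (r n)" and ?d = "\<lambda>i. norm (poly Pp (s (r n)) - poly Pp (y (r n) i))"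
    have "c * (\<Prod>t\<in>?R (r n) - {?x}. norm (poly Pp ?x - poly Pp t)) \<le> C3 * (1 + norm ?x) ^ (q - 1)"
      using key[OF s_ok(1)] C3(2) order_trans by blast
    also have "(\<Prod>t\<in>?R (r n) - {?x}. norm (poly Pp ?x - poly Pp t)) = (\<Prod>i\<in>{1..<q}. norm (poly Pp ?x - poly Pp (h (r n) i)))"
      by (rule prod.reindex_bij_betw[OF h, symmetric])
    also have "\<dots> = (\<Prod>i\<in>{1..<q}. ?d i)" by (intro prod.cong) (auto simp: y_def)
    also have "\<dots> = (\<Prod>i\<in>I. ?d i) * (\<Prod>i\<in>I'. ?d i)"
    proof -
      have "{1..<q} = I \<union> I'" "I \<inter> I' = {}" by (auto simp: I_def I'_def)
      then show ?thesis using finI by (simp add: prod.union_disjoint)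
    qed
    finally have A: "c * ((\<Prod>i\<in>I. ?d i) * (\<Prod>i\<in>I'. ?d i)) \<le> C3 * (1 + norm ?x) ^ (q - 1)" .
    have "(\<Prod>i\<in>I. b i) * norm ?x ^ (p * card I) = (\<Prod>i\<in>I. b i * norm ?x ^ p)"
      by (simp add: prod.distrib power_mult del: of_nat_add norm_of_nat)
    also have "\<dots> \<le> (\<Prod>i\<in>I. ?d i)"
      using elim(1) b(1) by (intro prod_mono) (auto intro!: mult_nonneg_nonneg simp: less_imp_le)
    finally have i1: "(\<Prod>i\<in>I. b i) * norm ?x ^ (p * card I) \<le> (\<Prod>i\<in>I. ?d i)" .
    have "(\<Prod>i\<in>I'. b' i) \<le> (\<Prod>i\<in>I'. ?d i * norm ?x ^ (q - 1))"
      using elim(2) b'(1) by (intro prod_mono) (auto simp: less_imp_le)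
    also have "\<dots> = (\<Prod>i\<in>I'. ?d i) * norm ?x ^ ((q - 1) * card I')"
      by (simp add: prod.distrib power_mult del: of_nat_add norm_of_nat)
    finally have i2: "(\<Prod>i\<in>I'. b' i) \<le> (\<Prod>i\<in>I'. ?d i) * norm ?x ^ ((q - 1) * card I')" .
    have "B * norm ?x ^ (p * card I) = c * (((\<Prod>i\<in>I. b i) * norm ?x ^ (p * card I)) * (\<Prod>i\<in>I'. b' i))"
      by (simp only: B_def mult_ac)
    also have "\<dots> \<le> c * ((\<Prod>i\<in>I. ?d i) * ((\<Prod>i\<in>I'. ?d i) * norm ?x ^ ((q - 1) * card I')))"
      using c b'(1) by (intro mult_left_mono mult_mono i1 i2 prod_nonneg) (auto simp: less_imp_le)
    also have "\<dots> = c * ((\<Prod>i\<in>I. ?d i) * (\<Prod>i\<in>I'. ?d i)) * norm ?x ^ ((q - 1) * card I')"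
      by (simp only: mult_ac)
    also have "\<dots> \<le> C3 * (1 + norm ?x) ^ (q - 1) * norm ?x ^ ((q - 1) * card I')"
      by (intro mult_right_mono A) auto
    also have "\<dots> \<le> C3 * (2 * norm ?x) ^ (q - 1) * norm ?x ^ ((q - 1) * card I')"
      using s_ok(3)[of "r n"] C3(1) by (intro mult_right_mono mult_left_mono power_mono) auto
    also have "\<dots> = C3 * 2 ^ (q - 1) * norm ?x ^ ((q - 1) + (q - 1) * card I')"
      by (simp only: power_mult_distrib power_add mult_ac)
    also have "(q - 1) + (q - 1) * card I' = m"
    proof -
      have "q - card I = card I' + 1" using cI' by simp
      then show ?thesis by (simp add: m_def)
    qed
    finally show ?case .
  qed
  have mlt: "m < p * card I"
  proof -
    have cpos: "card I > 0" using cI q by simp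
    have "m \<le> (q - 1) * card I" unfolding m_def using cI by (intro mult_left_mono) auto
    also have "\<dots> < p * card I" using cpos q by (intro mult_strict_right_mono) auto
    finally show ?thesis .
  qed
  have ninf: "filterlim (\<lambda>n. norm (s (r n))) at_top sequentially"
    by (rule filterlim_compose[OF filterlim_norm_at_top sr_inf])
  have "\<forall>\<^sub>F n in sequentially. C3 * 2 ^ (q - 1) / B < norm (s (r n))"
    using ninf by (simp only: filterlim_at_top_dense)
  then have "\<forall>\<^sub>F n in sequentially. False"
    using upper
  proof eventually_elim
    case (elim n)
    let ?x = "norm (s (r n))"
    have x1: "?x \<ge> 1" by (rule s_ok(3))
    have "?x ^ m * ?x \<le> ?x ^ (p * card I)"
      using power_increasing[of "Suc m" "p * card I" ?x] mlt x1 by (simp only: power_Suc mult.commute)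
    then have "B * (?x ^ m * ?x) \<le> C3 * 2 ^ (q - 1) * ?x ^ m"
      using elim(2) Bpos by (meson mult_left_mono order_trans less_imp_le)
    then have "?x ^ m * (B * ?x) \<le> ?x ^ m * (C3 * 2 ^ (q - 1))" by (simp only: mult_ac)
    moreover have "?x ^ m > 0" using x1 by (intro zero_less_power) linarith
    ultimately have "B * ?x \<le> C3 * 2 ^ (q - 1)" by (simp only: mult_le_cancel_left_pos)
    then show False using elim(1) Bpos by (simp only: pos_divide_less_eq) (simp only: mult.commute; linarith)
  qed
  then show False by simp
qed

lemma poly_wronskian_zero:
  fixes u w :: "complex poly"
  assumes W: "pderiv u * w = u * pderiv w" and w: "w \<noteq> 0"
  obtains c where "u = smult c w"
proof -
  let ?m = "degree w"
  define c where "c = coeff u ?m / lead_coeff w"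
  define D where "D = u - smult c w"
  have WD: "pderiv D * w = D * pderiv w"
    using W by (simp add: D_def pderiv_diff pderiv_smult algebra_simps)
  have cm: "coeff D ?m = 0" using w by (simp add: D_def c_def)
  have "D = 0"
  proof (rule ccontr)
    assume D: "D \<noteq> 0"
    let ?n = "degree D"
    have nm: "?n \<noteq> ?m" using cm D leading_coeff_0_iff by metis
    show False
    proof (cases "?n = 0 \<or> ?m = 0")
      case True
      then have "pderiv D = 0 \<or> pderiv w = 0" using pderiv_eq_0_iff[of D] pderiv_eq_0_iff[of w] by auto
      then have "pderiv D = 0" "pderiv w = 0" using WD w D by auto
      then show False using nm pderiv_eq_0_iff[of D] pderiv_eq_0_iff[of w] by auto
    next
      case False
      have "degree (pderiv D) + ?m = ?n + degree (pderiv w)" using False by (simp add: degree_pderiv)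
      then have "lead_coeff (pderiv D) * lead_coeff w = lead_coeff D * lead_coeff (pderiv w)"
        using coeff_mult_degree_sum[of "pderiv D" w] coeff_mult_degree_sum[of D "pderiv w"] WD by simp
      then have "of_nat ?n * (lead_coeff D * lead_coeff w) = of_nat ?m * (lead_coeff D * lead_coeff w)"
        using False by (simp add: degree_pderiv coeff_pderiv algebra_simps)
      then show False using nm D w by simp
    qed
  qed
  then show ?thesis using that[of c] by (simp add: D_def)
qed

lemma common_nonzero:
  assumes "homog p S" "homog q T" "S a \<noteq> 0" "T b \<noteq> 0"
  obtains e where "S e \<noteq> 0" "T e \<noteq> 0"
proof -
  obtain u where u: "\<And>t. S (a + t *s (b - a)) = poly u t"
    by (rule homog_line[OF assms(1), of "b - a" a]) (rule that)
  obtain v where v: "\<And>t. T (a + t *s (b - a)) = poly v t"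
    by (rule homog_line[OF assms(2), of "b - a" a]) (rule that)
  have "poly u 0 \<noteq> 0" using u[of 0] assms(3) by simp
  moreover have "poly v 1 \<noteq> 0" using v[of 1] assms(4) by simp
  ultimately have "u * v \<noteq> 0" by auto
  then have "finite {t. poly (u * v) t = 0}" by (rule poly_roots_finite)
  then obtain t where "poly (u * v) t \<noteq> 0"
    using infinite_UNIV_char_0[where 'a = complex] by (metis (mono_tags, lifting) UNIV_eq_I mem_Collect_eq)
  then show ?thesis using that[of "a + t *s (b - a)"] u v by auto
qed

text \<open>If \<open>p = k * q\<close>, the leading forms \<open>TP\<close> and \<open>TQ ^ k\<close> are proportional: the Jacobian
  determinant is constant, so that of \<open>TP\<close> and \<open>TQ\<close> vanishes when \<open>p + q > 2\<close>, and with Euler's relation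
  the logarithmic derivatives of \<open>TP\<close> and \<open>TQ ^ k\<close> agree.\<close>

lemma top_power_relation:
  assumes f: "poly_diffeo f"
    and P: "has_top p (\<lambda>z. f z $ 1) TP" and Q: "has_top q (\<lambda>z. f z $ 2) TQ"
    and pk: "p = k * q" and pq: "0 < p" "0 < q" "2 < p + q" and e: "TQ e \<noteq> 0"
  shows "TP z = TP e / TQ e ^ k * TQ z ^ k"
proof -
  note inv = poly_diffeo_inverse[OF f]
  have le: "poly_le (poly_map_degree (inv f)) (\<lambda>z. inv f z $ i)" for i
    using poly_diffeo_map_le[OF f] by (auto simp: map_le_def)
  obtain P1 P2 TP1 TP2 where P': "has_top (p - 1) P1 TP1" "has_top (p - 1) P2 TP2"
    "\<And>z. ((\<lambda>z. f z $ 1) has_derivative (\<lambda>h. P1 z * h $ 1 + P2 z * h $ 2)) (at z)"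
    "\<And>z. (TP has_derivative (\<lambda>h. TP1 z * h $ 1 + TP2 z * h $ 2)) (at z)"
    "\<And>z. z $ 1 * TP1 z + z $ 2 * TP2 z = of_nat p * TP z"
    by (rule has_top_deriv[OF P pq(1)]) (rule that)
  obtain Q1 Q2 TQ1 TQ2 where Q': "has_top (q - 1) Q1 TQ1" "has_top (q - 1) Q2 TQ2"
    "\<And>z. ((\<lambda>z. f z $ 2) has_derivative (\<lambda>h. Q1 z * h $ 1 + Q2 z * h $ 2)) (at z)"
    "\<And>z. (TQ has_derivative (\<lambda>h. TQ1 z * h $ 1 + TQ2 z * h $ 2)) (at z)"
    "\<And>z. z $ 1 * TQ1 z + z $ 2 * TQ2 z = of_nat q * TQ z"
    by (rule has_top_deriv[OF Q pq(2)]) (rule that)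
  obtain E1 E2 where E: "\<And>z. ((\<lambda>z. inv f z $ 1) has_derivative (\<lambda>h. E1 z * h $ 1 + E2 z * h $ 2)) (at z)"
    by (rule poly_le_deriv[OF le[of 1]]) (rule that)
  obtain G1 G2 where G: "\<And>z. ((\<lambda>z. inv f z $ 2) has_derivative (\<lambda>h. G1 z * h $ 1 + G2 z * h $ 2)) (at z)"
    by (rule poly_le_deriv[OF le[of 2]]) (rule that)
  obtain \<delta> where \<delta>: "\<And>z. P1 z * Q2 z - P2 z * Q1 z = \<delta>"
    by (rule jacobian_constant[OF inv(1) P'(3) Q'(3) E G P'(1,2)[THEN has_top_imp_poly_le] Q'(1,2)[THEN has_top_imp_poly_le]])
      (rule that)
  \<comment> \<open>the leading forms have vanishing Jacobian determinant\<close>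
  have J: "TP1 z * TQ2 z = TP2 z * TQ1 z" for z
  proof -
    let ?s = "\<lambda>n. of_nat n :: complex"
    have L1: "(\<lambda>n. P1 (?s n *s z) / ?s n ^ (p - 1) * (Q2 (?s n *s z) / ?s n ^ (q - 1)) -
       P2 (?s n *s z) / ?s n ^ (p - 1) * (Q1 (?s n *s z) / ?s n ^ (q - 1))) \<longlonglongrightarrow> TP1 z * TQ2 z - TP2 z * TQ1 z"
      by (intro tendsto_intros has_top_ray P' Q')
    have E: "P1 (?s n *s z) / ?s n ^ (p - 1) * (Q2 (?s n *s z) / ?s n ^ (q - 1)) -
       P2 (?s n *s z) / ?s n ^ (p - 1) * (Q1 (?s n *s z) / ?s n ^ (q - 1)) = \<delta> * (inverse (?s n)) ^ (p - 1 + (q - 1))" for n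
    proof -
      have "P1 (?s n *s z) / ?s n ^ (p - 1) * (Q2 (?s n *s z) / ?s n ^ (q - 1)) -
        P2 (?s n *s z) / ?s n ^ (p - 1) * (Q1 (?s n *s z) / ?s n ^ (q - 1)) =
        (P1 (?s n *s z) * Q2 (?s n *s z) - P2 (?s n *s z) * Q1 (?s n *s z)) / (?s n ^ (p - 1) * ?s n ^ (q - 1))"
        by (simp add: diff_divide_distrib)
      then show ?thesis by (simp add: \<delta> power_add power_inverse divide_inverse)
    qed
    have L2: "(\<lambda>n. \<delta> * (inverse (?s n)) ^ (p - 1 + (q - 1))) \<longlonglongrightarrow> \<delta> * 0 ^ (p - 1 + (q - 1))"
      by (intro tendsto_intros lim_inverse_n)
    have Z: "(0::complex) ^ (p - 1 + (q - 1)) = 0" using pq by simp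
    have "TP1 z * TQ2 z - TP2 z * TQ1 z = 0"
      by (rule LIMSEQ_unique[OF L1[unfolded E] L2[unfolded Z mult_zero_right]])
    then show ?thesis by simp
  qed
  have q0: "(of_nat q :: complex) \<noteq> 0" using pq by simp
  have grad: "TQ x * TP1 x = of_nat k * TP x * TQ1 x" "TQ x * TP2 x = of_nat k * TP x * TQ2 x" for x
  proof -
    have "of_nat q * (TQ x * TP1 x) = (x $ 1 * TQ1 x + x $ 2 * TQ2 x) * TP1 x" by (simp add: Q'(5))
    also have "\<dots> = (x $ 1 * TP1 x + x $ 2 * TP2 x) * TQ1 x" using J[of x] by algebra
    also have "\<dots> = of_nat q * (of_nat k * TP x * TQ1 x)" by (simp add: P'(5) pk)
    finally show "TQ x * TP1 x = of_nat k * TP x * TQ1 x" using q0 by simp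
    have "of_nat q * (TQ x * TP2 x) = (x $ 1 * TQ1 x + x $ 2 * TQ2 x) * TP2 x" by (simp add: Q'(5))
    also have "\<dots> = (x $ 1 * TP1 x + x $ 2 * TP2 x) * TQ2 x" using J[of x] by algebra
    also have "\<dots> = of_nat q * (of_nat k * TP x * TQ2 x)" by (simp add: P'(5) pk)
    finally show "TQ x * TP2 x = of_nat k * TP x * TQ2 x" using q0 by simp
  qed
  have hT: "homog p TP" "homog q TQ" using P Q by (auto simp: has_top_def)
  obtain u where u: "\<And>t. TP (e + t *s (z - e)) = poly u t"
    by (rule homog_line[OF hT(1), of "z - e" e]) (rule that)
  obtain v where v: "\<And>t. TQ (e + t *s (z - e)) = poly v t"
    by (rule homog_line[OF hT(2), of "z - e" e]) (rule that)
  have v0: "v \<noteq> 0" using v[of 0] e by auto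
  have du: "poly (pderiv u) t = TP1 (e + t *s (z - e)) * (z - e) $ 1 + TP2 (e + t *s (z - e)) * (z - e) $ 2" for t
    using line_derivative[OF P'(4), of e "z - e" t] unfolding u by (metis DERIV_unique poly_DERIV)
  have dv: "poly (pderiv v) t = TQ1 (e + t *s (z - e)) * (z - e) $ 1 + TQ2 (e + t *s (z - e)) * (z - e) $ 2" for t
    using line_derivative[OF Q'(4), of e "z - e" t] unfolding v by (metis DERIV_unique poly_DERIV)
  have "poly (pderiv u * v) t = poly (smult (of_nat k) (u * pderiv v)) t" for t
  proof -
    let ?x = "e + t *s (z - e)"
    have "poly (pderiv u * v) t = (TQ ?x * TP1 ?x) * (z - e) $ 1 + (TQ ?x * TP2 ?x) * (z - e) $ 2"
      unfolding poly_mult du v[symmetric] by (simp add: algebra_simps)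
    then show ?thesis unfolding grad poly_smult poly_mult dv u[symmetric] by (simp add: algebra_simps)
  qed
  then have uv: "pderiv u * v = smult (of_nat k) (u * pderiv v)" by (intro poly_ext)
  have "pderiv u * v ^ k = u * pderiv (v ^ k)"
  proof (cases k)
    case 0 then show ?thesis using pk pq by simp
  next
    case (Suc j)
    have "pderiv u * v ^ k = (pderiv u * v) * v ^ j" by (simp add: Suc mult_ac)
    also have "\<dots> = u * pderiv (v ^ k)" unfolding uv Suc pderiv_power_Suc by (simp add: mult_ac)
    finally show ?thesis .
  qed
  then obtain c where c: "u = smult c (v ^ k)" using poly_wronskian_zero v0 by (metis power_not_zero)
  have "TP e = c * TQ e ^ k" using u[of 0] v[of 0] c by simp
  moreover have "TP z = c * TQ z ^ k" using u[of 1] v[of 1] c by simp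
  ultimately show ?thesis using e by simp
qed

lemma top_divides:
  assumes f: "poly_diffeo f"
    and P: "has_top p (\<lambda>z. f z $ 1) TP" and Q: "has_top q (\<lambda>z. f z $ 2) TQ"
    and nz: "TP a \<noteq> 0" "TQ b \<noteq> 0" and pq: "0 < q" "q < p"
  obtains k c where "p = k * q" "\<And>z. TP z = c * TQ z ^ k"
proof -
  have hT: "homog p TP" "homog q TQ" using P Q by (auto simp: has_top_def)
  obtain e where e: "TP e \<noteq> 0" "TQ e \<noteq> 0" using common_nonzero[OF hT nz] by metis
  then have "q dvd p" using degree_divides[OF f P Q] pq by simp
  then obtain k where k: "p = k * q" by (metis dvd_def mult.commute)
  show ?thesis by (rule that[OF k top_power_relation[OF f P Q k _ _ _ e(2)]]) (use pq in auto)
qed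

section \<open>Shears and the reduction of degrees\<close>

text \<open>The elementary automorphism that adds a polynomial in the second coordinate to the first
  coordinate.\<close>

definition shear :: "complex poly \<Rightarrow> complex^2 \<Rightarrow> complex^2" where
  "shear s z = pair2 (z $ 1 + poly s (z $ 2)) (z $ 2)"

lemma shear_inverse: "shear s (shear (-s) z) = z" "shear (-s) (shear s z) = z"
  by (simp_all add: shear_def pair2_eq_iff)

lemma poly_le_poly: "poly_le q F \<Longrightarrow> poly_le (degree s * q) (\<lambda>z. poly s (F z))"
proof -
  assume F: "poly_le q F"
  have "poly_le (degree s * q) (\<lambda>z. \<Sum>i\<le>degree s. coeff s i * F z ^ i)"
    by (intro poly_le_sum poly_le_cmult poly_le_mono[OF poly_le_power[OF F]]) auto
  then show ?thesis by (simp add: poly_altdef)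
qed

lemma map_le_pair2: "poly_le N F \<Longrightarrow> poly_le N G \<Longrightarrow> map_le N (\<lambda>z. pair2 (F z) (G z))"
  by (simp add: map_le_def forall_2)

lemma map_top_pair2: "has_top N F S \<Longrightarrow> has_top N G T \<Longrightarrow> map_top N (\<lambda>z. pair2 (F z) (G z)) (\<lambda>z. pair2 (S z) (T z))"
  by (simp add: map_top_def forall_2)

lemma poly_diffeoI:
  assumes "map_le N f" "map_le M g" "\<And>z. f (g z) = z" "\<And>z. g (f z) = z"
  shows "poly_diffeo f" "inv f = g"
proof -
  show i: "inv f = g" using assms(3,4) by (intro inv_equality)
  have "bij f" using assms(3,4) by (intro bijI') metis+
  then show "poly_diffeo f" using assms(1,2) unfolding poly_diffeo_def i
    by (simp add: map_le_imp_poly_map)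
qed

lemma poly_diffeo_compose:
  assumes "poly_diffeo f" "poly_diffeo g"
  shows "poly_diffeo (f \<circ> g)" "inv (f \<circ> g) = inv g \<circ> inv f"
  by (rule poly_diffeoI[OF map_le_compose[OF poly_diffeo_map_le(1)[OF assms(1)] poly_diffeo_map_le(1)[OF assms(2)]]
        map_le_compose[OF poly_diffeo_map_le(2)[OF assms(2)] poly_diffeo_map_le(2)[OF assms(1)]]];
      simp add: poly_diffeo_inverse assms)+

lemma shear_map_le: "map_le (max 1 (degree s)) (shear s)"
proof -
  have "poly_le (max 1 (degree s)) (\<lambda>z. poly s (z $ 2))"
    using poly_le_poly[OF poly_le_var, of s 2] by (rule poly_le_mono) simp
  moreover have v: "poly_le (max 1 (degree s)) (\<lambda>z. z $ i)" for i
    by (rule poly_le_mono[OF poly_le_var]) simp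
  ultimately show ?thesis unfolding shear_def[abs_def] by (intro map_le_pair2 poly_le_add)
qed

lemma shear_diffeo: "poly_diffeo (shear s)" "inv (shear s) = shear (-s)"
  by (rule poly_diffeoI[OF shear_map_le shear_map_le[of "-s"] shear_inverse])+

lemma has_top_add_lower: "has_top N F T \<Longrightarrow> lower N G \<Longrightarrow> has_top N (\<lambda>z. F z + G z) T"
  using lower_add[of N "\<lambda>z. F z - T z" G] by (simp add: has_top_def algebra_simps)

lemma poly_le_imp_lower: "poly_le M G \<Longrightarrow> M < N \<Longrightarrow> lower N G"
  by (auto simp: lower_def intro: poly_le_mono)

lemma homog_power: "homog N T \<Longrightarrow> homog (k * N) (\<lambda>z. T z ^ k)"
proof (induction k)
  case 0 then show ?case using homog_const by simp
next
  case (Suc k)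
  have mult: "homog (N + M) (\<lambda>z. F z * G z)" if "homog N F" "homog M G" for N M F G
    using that(1)
  proof (induction rule: homog.induct)
    case (homog_const c) then show ?case using homog_cmult[OF that(2)] by simp
  next
    case (homog_add N F1 F2) then show ?case using homog.homog_add by (simp add: distrib_right)
  next
    case (homog_coord N F i)
    then show ?case using homog.homog_coord[of "N+M" "\<lambda>z. F z * G z" i] by (simp add: mult.assoc)
  qed
  show ?case using mult[OF Suc.prems Suc.IH[OF Suc.prems]] by simp
qed

lemma homog_var: "homog 1 (\<lambda>z. z $ i)"
  using homog_coord[OF homog_const[of 1], of i] by simp

lemma shear_top:
  assumes "degree s \<ge> 2"
  shows "map_top (degree s) (shear s) (\<lambda>z. pair2 (lead_coeff s * z $ 2 ^ degree s) 0)"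
proof -
  let ?k = "degree s"
  have "homog ?k (\<lambda>z. lead_coeff s * z $ 2 ^ ?k)"
    using homog_cmult[OF homog_power[OF homog_var, of ?k 2]] by simp
  then have t: "has_top ?k (\<lambda>z. lead_coeff s * z $ 2 ^ ?k) (\<lambda>z. lead_coeff s * z $ 2 ^ ?k)"
    by (rule homog_has_top)
  have "lower ?k (\<lambda>z. \<Sum>i<?k. coeff s i * z $ 2 ^ i)"
  proof (rule poly_le_imp_lower)
    show "poly_le (?k - 1) (\<lambda>z. \<Sum>i<?k. coeff s i * z $ 2 ^ i)"
      by (intro poly_le_sum poly_le_cmult poly_le_mono[OF poly_le_power[OF poly_le_var]]) auto
  qed (use assms in simp)
  then have l: "lower ?k (\<lambda>z. (\<Sum>i<?k. coeff s i * z $ 2 ^ i) + z $ 1)"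
    using assms by (intro lower_add poly_le_imp_lower[OF poly_le_var]) auto
  have "(\<lambda>z. z $ 1 + poly s (z $ 2)) = (\<lambda>z::complex^2. lead_coeff s * z $ 2 ^ ?k + ((\<Sum>i<?k. coeff s i * z $ 2 ^ i) + z $ 1))"
    by (auto simp: poly_altdef lessThan_Suc_atMost[symmetric] fun_eq_iff)
  then have "has_top ?k (\<lambda>z. z $ 1 + poly s (z $ 2)) (\<lambda>z. lead_coeff s * z $ 2 ^ ?k)"
    using has_top_add_lower[OF t l] by simp
  moreover have "has_top ?k (\<lambda>z. z $ 2) (\<lambda>z. 0)"
    using assms by (auto simp: has_top_def homog_zero intro: poly_le_imp_lower[OF poly_le_var])
  ultimately show ?thesis unfolding shear_def[abs_def] by (rule map_top_pair2)
qed

text \<open>The leading form of a nonconstant polynomial function at its exact degree.\<close>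

lemma poly_le_nonconst_top:
  assumes "poly_le N F" "F x \<noteq> F y"
  obtains q T b where "0 < q" "q \<le> N" "has_top q F T" "T b \<noteq> 0"
proof -
  have "\<exists>q T b. 0 < q \<and> q \<le> N \<and> has_top q F T \<and> T b \<noteq> 0"
    using assms(1)
  proof (induction N)
    case 0
    then have "F z = F 0" for z
    proof -
      obtain p where "degree p \<le> 0" "\<And>t. F (0 + t *s z) = poly p t"
        by (rule poly_le_line[OF 0, of 0 z]) (rule that)
      then show ?thesis by (metis add.left_neutral le_zero_eq degree_eq_zeroE poly_const_conv vector_smult_lid vector_smult_lzero)
    qed
    then show ?case using assms(2) by metis
  next
    case (Suc N)
    obtain T where T: "has_top (Suc N) F T" using ex_top[OF Suc.prems] by metis
    show ?case
    proof (cases "\<exists>b. T b \<noteq> 0")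
      case True then show ?thesis using T by (metis le_refl zero_less_Suc)
    next
      case False
      then have "T = (\<lambda>z. 0)" by auto
      then show ?thesis using T has_top_zero_imp Suc.IH by (meson le_SucI)
    qed
  qed
  then show ?thesis using that by blast
qed

text \<open>Subtracting polynomials in the second component lowers the degree of the first
  component to that of the second.\<close>

lemma jung_reduction:
  assumes "poly_diffeo f" "poly_le p (\<lambda>z. f z $ 1)" "has_top q (\<lambda>z. f z $ 2) TQ" "TQ b \<noteq> 0" "0 < q"
  shows "\<exists>s. poly_le q (\<lambda>z. f z $ 1 - poly s (f z $ 2)) \<and> (s = 0 \<or> degree s * q \<le> p)"
  using assms
proof (induction p arbitrary: f rule: less_induct)
  case (less p)
  show ?case
  proof (cases "p \<le> q")
    case True
    then show ?thesis using poly_le_mono[OF less.prems(2)] by (intro exI[of _ 0]) simp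
  next
    case False
    then have p1: "p > q" "p - 1 < p" by auto
    obtain TP where TP: "has_top p (\<lambda>z. f z $ 1) TP" using ex_top[OF less.prems(2)] by metis
    show ?thesis
    proof (cases "\<exists>a. TP a \<noteq> 0")
      case False
      then have "TP = (\<lambda>z. 0)" by auto
      then have "poly_le (p - 1) (\<lambda>z. f z $ 1)" using TP p1 has_top_zero_imp[of "p - 1"] by simp
      from less.IH[OF p1(2) less.prems(1) this less.prems(3,4,5)] show ?thesis by force
    next
      case True
      then obtain a where a: "TP a \<noteq> 0" by blast
      obtain k c where k: "p = k * q" "\<And>z. TP z = c * TQ z ^ k"
        using top_divides[OF less.prems(1) TP less.prems(3) a less.prems(4,5) p1(1)] by metis
      define m where "m = monom c k"
      define g where "g = shear (-m) \<circ> f"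
      have g: "poly_diffeo g" unfolding g_def by (intro poly_diffeo_compose shear_diffeo less.prems)
      have g12: "g z $ 1 = f z $ 1 - c * (f z $ 2) ^ k" "g z $ 2 = f z $ 2" for z
        by (simp_all add: g_def shear_def m_def poly_monom)
      have "has_top q (\<lambda>z. g z $ 2) TQ" using less.prems(3) by (simp add: g12)
      moreover have "poly_le (p - 1) (\<lambda>z. g z $ 1)"
      proof -
        have le: "poly_le p (\<lambda>z. g z $ 1)"
          unfolding g12 using less.prems(2) poly_le_power[OF has_top_imp_poly_le[OF less.prems(3)], of k] k(1)
          by (intro poly_le_diff poly_le_cmult) auto
        obtain U where U: "has_top p (\<lambda>z. g z $ 1) U" using ex_top[OF le] by metis
        have "U z = 0" for z
        proof -
          let ?s = "\<lambda>n. of_nat n :: complex"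
          have "(\<lambda>n. f (?s n *s z) $ 1 / ?s n ^ p - c * (f (?s n *s z) $ 2 / ?s n ^ q) ^ k) \<longlonglongrightarrow> TP z - c * TQ z ^ k"
            by (intro tendsto_intros has_top_ray[OF TP] has_top_ray[OF less.prems(3)])
          moreover have "f (?s n *s z) $ 1 / ?s n ^ p - c * (f (?s n *s z) $ 2 / ?s n ^ q) ^ k = g (?s n *s z) $ 1 / ?s n ^ p" for n
            by (simp add: g12 k(1) power_divide diff_divide_distrib mult.commute flip: power_mult)
          ultimately have "(\<lambda>n. g (?s n *s z) $ 1 / ?s n ^ p) \<longlonglongrightarrow> 0" using k(2) by simp
          then show ?thesis using has_top_ray[OF U] LIMSEQ_unique by blast
        qed
        then have "U = (\<lambda>z. 0)" by auto
        then show ?thesis using U p1 has_top_zero_imp[of "p - 1"] by simp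
      qed
      ultimately obtain s where s: "poly_le q (\<lambda>z. g z $ 1 - poly s (g z $ 2))" "s = 0 \<or> degree s * q \<le> p - 1"
        using less.IH[OF p1(2) g _ _ less.prems(4,5)] by blast
      have "poly_le q (\<lambda>z. f z $ 1 - poly (s + m) (f z $ 2))"
        using s(1) by (simp add: g12 m_def poly_monom algebra_simps)
      moreover have "degree (s + m) * q \<le> p"
      proof -
        have "degree s * q \<le> k * q" using s(2) k(1) by (elim disjE) (simp, linarith)
        then have "degree s \<le> k" using less.prems(5) by simp
        moreover have "degree m \<le> k" by (simp add: m_def degree_monom_le)
        ultimately show ?thesis unfolding k(1) by (intro mult_right_mono degree_add_le) auto
      qed
      ultimately show ?thesis by blast
    qed
  qed
qed

text \<open>The determinant of two vectors. It vanishes iff they are parallel, and every linear form on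
  the plane is \<open>om u\<close> for some \<open>u\<close>, with kernel spanned by \<open>u\<close> if \<open>u \<noteq> 0\<close>.\<close>

definition om :: "complex^2 \<Rightarrow> complex^2 \<Rightarrow> complex" where
  "om u z = u $ 1 * z $ 2 - u $ 2 * z $ 1"

text \<open>The linear map with columns \<open>v\<close> and \<open>w\<close>.\<close>

definition lin :: "complex^2 \<Rightarrow> complex^2 \<Rightarrow> complex^2 \<Rightarrow> complex^2" where
  "lin v w u = u $ 1 *s v + u $ 2 *s w"

lemma om_simps: "om (a *s u) z = a * om u z" "om u (a *s z) = a * om u z"
  "om (x + y) z = om x z + om y z" "om u (x + y) = om u x + om u y" "om u u = 0" "om u 0 = 0" "om 0 u = 0"
  by (auto simp: om_def algebra_simps)

lemma om_zero_parallel: "om u z = 0 \<Longrightarrow> u \<noteq> 0 \<Longrightarrow> \<exists>a. z = a *s u"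
proof -
  assume om: "om u z = 0" and u: "u \<noteq> 0"
  show ?thesis
  proof (cases "u $ 1 = 0")
    case True
    then have "u $ 2 \<noteq> 0" using u by (auto simp: pair2_eq_iff)
    then show ?thesis using om True
      by (intro exI[of _ "z $ 2 / u $ 2"]) (auto simp: pair2_eq_iff om_def)
  next
    case False
    then show ?thesis using om
      by (intro exI[of _ "z $ 1 / u $ 1"]) (auto simp: pair2_eq_iff om_def field_simps)
  qed
qed

lemma ex_om_one:
  assumes "v \<noteq> 0"
  obtains w where "om v w = 1"
proof (cases "v $ 1 = 0")
  case True
  then have "v $ 2 \<noteq> 0" using assms by (auto simp: pair2_eq_iff)
  then show ?thesis using that[of "pair2 (-1 / v $ 2) 0"] by (simp add: om_def)
next
  case False
  then show ?thesis using that[of "pair2 0 (1 / v $ 1)"] by (simp add: om_def)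
qed

lemma homog_om: "homog 1 (om v)"
  using homog_add[OF homog_cmult[OF homog_var, of "v $ 1" 2] homog_cmult[OF homog_var, of "- (v $ 2)" 1]]
  by (simp add: om_def[abs_def])

lemma poly_le_om: "poly_le N (\<lambda>z. f z $ 1) \<Longrightarrow> poly_le N (\<lambda>z. f z $ 2) \<Longrightarrow> poly_le N (\<lambda>z. om v (f z))"
  unfolding om_def by (intro poly_le_diff poly_le_cmult)

lemma has_top_om:
  assumes "map_top N f T"
  shows "has_top N (\<lambda>z. om v (f z)) (\<lambda>z. om v (T z))"
proof -
  have t: "has_top N (\<lambda>z. f z $ i) (\<lambda>z. T z $ i)" for i using assms by (simp add: map_top_def)
  then have "poly_le N (\<lambda>z. om v (f z))" by (intro poly_le_om has_top_imp_poly_le)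
  then obtain U where U: "has_top N (\<lambda>z. om v (f z)) U" using ex_top by metis
  have "U z = om v (T z)" for z
  proof -
    have "(\<lambda>n. v $ 1 * (f (of_nat n *s z) $ 2 / of_nat n ^ N) - v $ 2 * (f (of_nat n *s z) $ 1 / of_nat n ^ N))
      \<longlonglongrightarrow> v $ 1 * T z $ 2 - v $ 2 * T z $ 1"
      by (intro tendsto_intros has_top_ray[OF t])
    then have "(\<lambda>n. om v (f (of_nat n *s z)) / of_nat n ^ N) \<longlonglongrightarrow> om v (T z)"
      by (simp add: om_def diff_divide_distrib)
    then show ?thesis using has_top_ray[OF U] LIMSEQ_unique by blast
  qed
  then have "U = (\<lambda>z. om v (T z))" by auto
  then show ?thesis using U by simp
qed

text \<open>The inverse of \<open>lin v w\<close> when \<open>om v w = 1\<close>.\<close>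

definition colin :: "complex^2 \<Rightarrow> complex^2 \<Rightarrow> complex^2 \<Rightarrow> complex^2" where
  "colin v w z = pair2 (- om w z) (om v z)"

lemma lin_colin:
  assumes "om v w = 1"
  shows "lin v w (colin v w z) = z" "colin v w (lin v w z) = z"
proof -
  have o: "v $ 1 * w $ 2 = 1 + v $ 2 * w $ 1" using assms by (simp add: om_def algebra_simps)
  show "lin v w (colin v w z) = z"
    unfolding pair2_eq_iff lin_def colin_def om_def
    using o by (simp add: algebra_simps) algebra
  show "colin v w (lin v w z) = z"
    unfolding pair2_eq_iff lin_def colin_def om_def
    using o by (simp add: algebra_simps) algebra
qed

lemma colin_top: "map_top 1 (colin v w) (colin v w)"
proof -
  have "homog 1 (\<lambda>z. - om w z)" using homog_cmult[OF homog_om[of w], of "-1"] by simp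
  then show ?thesis unfolding colin_def[abs_def] by (intro map_top_pair2 homog_has_top homog_om)
qed

lemma lin_top: "map_top 1 (lin v w) (lin v w)"
proof -
  have "homog 1 (\<lambda>z. lin v w z $ i)" for i
    using homog_add[OF homog_cmult[OF homog_var, of "v $ i" 1] homog_cmult[OF homog_var, of "w $ i" 2]]
    by (simp add: lin_def mult.commute)
  then show ?thesis by (simp add: map_top_def homog_has_top)
qed

lemma lin_diffeo:
  assumes "om v w = 1"
  shows "poly_diffeo (lin v w)" "inv (lin v w) = colin v w" "poly_diffeo (colin v w)" "inv (colin v w) = lin v w"
  using poly_diffeoI[OF map_top_imp_le[OF lin_top] map_top_imp_le[OF colin_top] lin_colin[OF assms]]
    poly_diffeoI[OF map_top_imp_le[OF colin_top] map_top_imp_le[OF lin_top] lin_colin(2,1)[OF assms]] by auto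

lemma poly_diffeo_nonconst:
  assumes "poly_diffeo f" "v \<noteq> 0"
  shows "\<exists>x y. om v (f x) \<noteq> om v (f y)"
proof -
  obtain w where "om v w = 1" using ex_om_one[OF assms(2)] .
  then have "om v (f (inv f w)) = 1" "om v (f (inv f 0)) = 0"
    using poly_diffeo_inverse[OF assms(1)] by (auto simp: om_simps)
  then show ?thesis by (metis zero_neq_one)
qed

lemma poly_diffeo_degree_pos: "poly_diffeo f \<Longrightarrow> poly_map_degree f > 0"
proof (rule ccontr)
  assume f: "poly_diffeo f" and "\<not> poly_map_degree f > 0"
  then have le: "poly_le 0 (\<lambda>z. om (pair2 1 0) (f z))"
    using poly_diffeo_map_le(1)[OF f] by (auto simp: map_le_def intro: poly_le_om)
  have "pair2 1 0 \<noteq> 0" by (simp add: pair2_eq_iff)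
  then obtain x y where "om (pair2 1 0) (f x) \<noteq> om (pair2 1 0) (f y)" using poly_diffeo_nonconst[OF f] by blast
  then show False using poly_le_nonconst_top[OF le] by (metis le_zero_eq less_irrefl)
qed

text \<open>One step of the factorization of plane polynomial automorphisms into linear maps and shears.\<close>

lemma jung_decomposition:
  assumes f: "poly_diffeo f" and D: "poly_map_degree f \<ge> 2"
  obtains v w s g q Tg b where "om v w = 1" "poly_diffeo g" "f = lin v w \<circ> (shear s \<circ> g)" "degree s \<ge> 2"
    "0 < q" "poly_map_degree f = degree s * q" "map_top q g Tg" "Tg b $ 2 \<noteq> 0"
proof -
  let ?D = "poly_map_degree f"
  have pm: "poly_map f" using f by (simp add: poly_diffeo_def)
  obtain T z0 where T: "map_top ?D f T" "T z0 \<noteq> 0" using poly_map_degree_top[OF pm] D by (metis not_less_eq_eq numeral_2_eq_2 zero_less_iff_neq_zero le_zero_eq nat.distinct(1))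
  have t: "has_top ?D (\<lambda>z. f z $ i) (\<lambda>z. T z $ i)" for i using T by (simp add: map_top_def)
  \<comment> \<open>all values of the leading form are multiples of \<open>v\<close>\<close>
  obtain v where v: "v \<noteq> 0" "\<And>z. om v (T z) = 0"
  proof (cases "\<exists>e. T e $ 2 \<noteq> 0")
    case False
    show thesis by (rule that[of "pair2 1 0"]) (use False in \<open>auto simp: om_def pair2_eq_iff\<close>)
  next
    case True
    then obtain e where e: "T e $ 2 \<noteq> 0" by blast
    have h: "T z $ 1 = T e $ 1 / T e $ 2 ^ 1 * T z $ 2 ^ 1" for z
      using top_power_relation[OF f t t _ _ _ _ e, of 1 z] D by simp
    have "om (pair2 (T e $ 1 / T e $ 2) 1) (T z) = 0" for z using h[of z] by (simp add: om_def)
    then show thesis by (rule that[rotated]) (simp add: pair2_eq_iff)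
  qed
  obtain w where vw: "om v w = 1" using ex_om_one[OF v(1)] .
  \<comment> \<open>in the basis \<open>v\<close>, \<open>w\<close> the second component has smaller degree than the first\<close>
  define f' where "f' = colin v w \<circ> f"
  have f': "poly_diffeo f'" unfolding f'_def using poly_diffeo_compose lin_diffeo[OF vw] f by blast
  have f'12: "f' z $ 1 = - om w (f z)" "f' z $ 2 = om v (f z)" for z by (auto simp: f'_def colin_def)
  have top1: "has_top ?D (\<lambda>z. f' z $ 1) (\<lambda>z. - om w (T z))"
    using has_top_om[OF T(1), of "- w"] by (simp add: f'12 om_def algebra_simps)
  have "has_top ?D (\<lambda>z. f' z $ 2) (\<lambda>z. om v (T z))"
    using has_top_om[OF T(1), of v] by (simp add: f'12)
  then have "has_top (Suc (?D - 1)) (\<lambda>z. f' z $ 2) (\<lambda>z. 0)" using v(2) D by simp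
  then have le2: "poly_le (?D - 1) (\<lambda>z. f' z $ 2)" by (rule has_top_zero_imp)
  have nz1: "- om w (T z0) \<noteq> 0"
  proof
    assume "- om w (T z0) = 0"
    then have "colin v w (T z0) = 0" using v(2) by (simp add: colin_def pair2_eq_iff)
    then have "T z0 = lin v w 0" using lin_colin(1)[OF vw] by metis
    then show False using T(2) by (simp add: lin_def)
  qed
  obtain x y where "f' x $ 2 \<noteq> f' y $ 2" unfolding f'12 using poly_diffeo_nonconst[OF f v(1)] by blast
  then obtain q TQ b where q: "0 < q" "q \<le> ?D - 1" "has_top q (\<lambda>z. f' z $ 2) TQ" "TQ b \<noteq> 0"
    using poly_le_nonconst_top[OF le2] by metis
  obtain s where s: "poly_le q (\<lambda>z. f' z $ 1 - poly s (f' z $ 2))" "s = 0 \<or> degree s * q \<le> ?D"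
    using jung_reduction[OF f' has_top_imp_poly_le[OF top1] q(3,4,1)] by blast
  define g where "g = shear (-s) \<circ> f'"
  have g: "poly_diffeo g" unfolding g_def by (intro poly_diffeo_compose shear_diffeo f')
  have g12: "g z $ 1 = f' z $ 1 - poly s (f' z $ 2)" "g z $ 2 = f' z $ 2" for z
    by (simp_all add: g_def shear_def)
  have sg: "shear s \<circ> g = f'" by (auto simp: g_def shear_inverse)
  have lf: "f = lin v w \<circ> (shear s \<circ> g)" unfolding sg f'_def by (auto simp: lin_colin[OF vw])
  have "map_le q g" using s(1) has_top_imp_poly_le[OF q(3)] by (simp add: map_le_def forall_2 g12)
  then obtain Tg where Tg: "map_top q g Tg" using ex_map_top by metis
  then have "has_top q (\<lambda>z. f' z $ 2) (\<lambda>z. Tg z $ 2)" by (simp add: map_top_def forall_2 g12)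
  then have "(\<lambda>z. Tg z $ 2) = TQ" using has_top_unique q(3) by blast
  then have nz: "Tg b $ 2 \<noteq> 0" using q(4) by (metis (mono_tags))
  have deg: "degree s * q = ?D"
  proof (rule ccontr)
    assume ne: "degree s * q \<noteq> ?D"
    have lt: "degree s * q < ?D"
      using s(2) ne D by (cases "s = 0") auto
    have "poly_le (max q (degree s * q)) (\<lambda>z. (f' z $ 1 - poly s (f' z $ 2)) + poly s (f' z $ 2))"
      by (intro poly_le_add poly_le_mono[OF s(1)] poly_le_mono[OF poly_le_poly[OF has_top_imp_poly_le[OF q(3)]]]) auto
    then have "poly_le (max q (degree s * q)) (\<lambda>z. f' z $ 1)" by simp
    then have "lower ?D (\<lambda>z. f' z $ 1)" by (rule poly_le_imp_lower) (use lt q D in auto)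
    then have "has_top ?D (\<lambda>z. f' z $ 1) (\<lambda>z. 0)" by (simp add: has_top_def homog_zero)
    then have "(\<lambda>z. - om w (T z)) = (\<lambda>z. 0)" using has_top_unique top1 by blast
    then show False using nz1 by metis
  qed
  have "degree s \<ge> 2"
  proof (rule ccontr)
    assume "\<not> degree s \<ge> 2"
    then have "degree s \<le> 1" by simp
    then have "degree s * q \<le> 1 * q" by (rule mult_right_mono) simp
    then show False using deg q D by linarith
  qed
  then show ?thesis using that[OF vw g lf _ q(1) deg[symmetric] Tg nz] by blast
qed

text \<open>The inverse of an affine automorphism is affine, with inverse linear part.\<close>

lemma affine_inverse_top:
  assumes g: "poly_diffeo g" and Tg: "map_top 1 g Tg"
  obtains U where "map_top 1 (inv g) U" "\<And>z. Tg (U z) = z"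
proof -
  note inv = poly_diffeo_inverse[OF g]
  have inj: "Tg h \<noteq> 0" if "h \<noteq> 0" for h
  proof
    assume h0: "Tg h = 0"
    have "g h $ i = g 0 $ i" for i
    proof -
      have "has_top 1 (\<lambda>z. g z $ i) (\<lambda>z. Tg z $ i)" using Tg by (simp add: map_top_def)
      then have le: "poly_le 0 (\<lambda>z. g z $ i - Tg z $ i)" by (simp add: has_top_def lower_def)
      have T0: "Tg 0 = 0" using map_top_scale[OF Tg, of 0 0] by simp
      have "g h $ i - Tg h $ i = g 0 $ i - Tg 0 $ i"
        using poly_le_nonconst_top[OF le, of h 0] by (metis le_zero_eq less_irrefl)
      then show ?thesis using h0 T0 by simp
    qed
    then have "g h = g 0" by (simp add: vec_eq_iff)
    then show False using that inv(1) by metis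
  qed
  let ?N = "poly_map_degree (inv g)"
  have gi: "poly_diffeo (inv g)" by (rule poly_diffeo_inv[OF g])
  have pos: "?N > 0" by (rule poly_diffeo_degree_pos[OF gi])
  obtain U z0 where U: "map_top ?N (inv g) U" "U z0 \<noteq> 0"
    using poly_map_degree_top[OF _ pos] gi by (metis poly_diffeo_def)
  have c: "map_top ?N id (Tg \<circ> U)"
  proof -
    have "g \<circ> inv g = id" using inv(2) by auto
    then show ?thesis using map_top_compose[OF Tg U(1) pos] by simp
  qed
  have i1: "map_top 1 id id" using homog_has_top[OF homog_var] by (simp add: map_top_def)
  have N1: "?N = 1"
  proof (rule ccontr)
    assume "?N \<noteq> 1"
    then have "map_top ?N id (\<lambda>z. 0)" using pos map_le_imp_top_zero[OF map_top_imp_le[OF i1], of ?N] by simp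
    then have "Tg \<circ> U = (\<lambda>z. 0)" using c map_top_unique by blast
    then show False using inj U(2) by (metis comp_apply)
  qed
  then have "Tg \<circ> U = id" using c i1 map_top_unique by metis
  then show ?thesis using that[of U] U(1) N1 by (metis comp_apply id_apply)
qed

lemma homog_one_om:
  assumes "homog 1 T"
  obtains u where "T = om u"
proof -
  have "\<exists>u. T = om u" if "homog n T" "n = 1" for n
    using that
  proof (induction rule: homog.induct)
    case (homog_add N F G)
    then obtain u u' where "F = om u" "G = om u'" by blast
    then show ?case by (intro exI[of _ "u + u'"]) (auto simp: om_simps)
  next
    case (homog_coord N F i)
    have "F z = F 0" for z
      using homog_scale[OF homog_coord(1), of 0 z] homog_coord by simp
    then have F: "F = (\<lambda>z. F 0)" by blast
    consider "i = 1" | "i = 2" using exhaust_2 by blast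
    then show ?case
    proof cases
      case 1 then show ?thesis using F by (intro exI[of _ "pair2 0 (- F 0)"]) (auto simp: om_def fun_eq_iff)
    next
      case 2 then show ?thesis using F by (intro exI[of _ "pair2 (F 0) 0"]) (auto simp: om_def fun_eq_iff)
    qed
  qed auto
  then show ?thesis using that assms by blast
qed

section \<open>Leading forms and regular conjugates\<close>

lemma om_pair2_zero: "om u (pair2 x 0) = - (u $ 2) * x"
  by (simp add: om_def)

text \<open>The leading form of an automorphism of degree at least two is a power of a linear form times
  a fixed vector, and the kernel of the linear form is the direction that belongs in the same way
  to the inverse automorphism.\<close>

lemma top_form_structure:
  assumes "poly_diffeo f" "poly_map_degree f = D" "D \<ge> 2"
  shows "\<exists>v v' \<kappa> \<kappa>' D'. v \<noteq> 0 \<and> v' \<noteq> 0 \<and> \<kappa> \<noteq> 0 \<and> \<kappa>' \<noteq> 0 \<and> D' \<ge> 2 \<and>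
    map_top D f (\<lambda>z. (\<kappa> * om v' z ^ D) *s v) \<and>
    map_top D' (inv f) (\<lambda>z. (\<kappa>' * om v z ^ D') *s v')"
  using assms
proof (induction D arbitrary: f rule: less_induct)
  case (less D)
  have "poly_map_degree f \<ge> 2" using less.prems by simp
  then obtain v w s g q Tg b where dec: "om v w = 1" "poly_diffeo g" "f = lin v w \<circ> (shear s \<circ> g)"
    "degree s \<ge> 2" "0 < q" "poly_map_degree f = degree s * q" "map_top q g Tg" "Tg b $ 2 \<noteq> 0"
    by (rule jung_decomposition[OF less.prems(1)]) (rule that)
  let ?k = "degree s" and ?a = "lead_coeff s"
  have Dkq: "D = ?k * q" using dec(6) less.prems by simp
  have a0: "?a \<noteq> 0" using dec(4) by auto
  have k0: "0 < ?k" using dec(4) by simp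
  have v0: "v \<noteq> 0" using dec(1) by (auto simp: om_simps)
  have topf: "map_top D f (\<lambda>z. (?a * (Tg z $ 2) ^ ?k) *s v)"
  proof -
    have "map_top (1 * (?k * q)) (lin v w \<circ> (shear s \<circ> g)) (lin v w \<circ> ((\<lambda>z. pair2 (?a * z $ 2 ^ ?k) 0) \<circ> Tg))"
      using dec(5) k0 by (intro map_top_compose[OF lin_top map_top_compose[OF shear_top[OF dec(4)] dec(7)]]) auto
    moreover have "lin v w \<circ> ((\<lambda>z. pair2 (?a * z $ 2 ^ ?k) 0) \<circ> Tg) = (\<lambda>z. (?a * (Tg z $ 2) ^ ?k) *s v)"
      by (auto simp: lin_def)
    ultimately show ?thesis by (simp only: dec(3)[symmetric] Dkq mult_1)
  qed
  have invf: "inv f = inv g \<circ> (shear (-s) \<circ> colin v w)"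
    unfolding dec(3) using dec(2) shear_diffeo[of s] lin_diffeo[OF dec(1)]
    by (simp add: poly_diffeo_compose o_assoc)
  have tops: "map_top (?k * 1) (shear (-s) \<circ> colin v w) ((\<lambda>z. pair2 (- ?a * z $ 2 ^ ?k) 0) \<circ> colin v w)"
    by (rule map_top_compose[OF _ colin_top]) (use shear_top[of "-s"] dec(4) in simp_all)
  then have tops: "map_top ?k (shear (-s) \<circ> colin v w) (\<lambda>z. pair2 (- ?a * om v z ^ ?k) 0)"
    by (simp add: o_def colin_def)
  show ?case
  proof (cases "q = 1")
    case True
    have Tg1: "map_top 1 g Tg" using dec(7) True by simp
    have "homog 1 (\<lambda>z. Tg z $ 2)" using Tg1 by (simp add: map_top_def has_top_def)
    then obtain v' where v': "(\<lambda>z. Tg z $ 2) = om v'" by (rule homog_one_om)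
    then have v'x: "Tg z $ 2 = om v' z" for z by metis
    obtain U where U: "map_top 1 (inv g) U" "\<And>z. Tg (U z) = z" using affine_inverse_top[OF dec(2) Tg1] by metis
    have v'0: "v' \<noteq> 0" using dec(8) v'x by (auto simp: om_simps)
    have "om v' (U (pair2 1 0)) = 0" using U(2) v'x[of "U (pair2 1 0)"] by simp
    then obtain l where l: "U (pair2 1 0) = l *s v'" using om_zero_parallel v'0 by blast
    have l0: "l \<noteq> 0"
    proof
      assume "l = 0"
      then have "U (pair2 1 0) = 0 *s U 0" using l by simp
      then have "pair2 1 0 = Tg (0 *s U 0)" using U(2) by metis
      also have "\<dots> = 0" using map_top_scale[OF Tg1, of 0] by simp
      finally show False by (simp add: pair2_eq_iff)
    qed
    have Ux: "U (pair2 x 0) = (x * l) *s v'" for x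
    proof -
      have "pair2 x 0 = x *s pair2 1 0" by (simp add: pair2_eq_iff)
      then show ?thesis using map_top_scale[OF U(1), of x "pair2 1 0"] l by (simp add: vector_smult_assoc)
    qed
    have "map_top (1 * ?k) (inv g \<circ> (shear (-s) \<circ> colin v w)) (U \<circ> (\<lambda>z. pair2 (- ?a * om v z ^ ?k) 0))"
      by (rule map_top_compose[OF U(1) tops k0])
    then have ti: "map_top ?k (inv f) (\<lambda>z. ((- ?a * l) * om v z ^ ?k) *s v')"
      by (simp add: invf o_def Ux mult_ac)
    have tf: "map_top D f (\<lambda>z. (?a * om v' z ^ D) *s v)" using topf v'x Dkq True by simp
    show ?thesis
      by (rule exI[of _ v], rule exI[of _ v'], rule exI[of _ ?a], rule exI[of _ "- ?a * l"], rule exI[of _ ?k])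
        (use v0 v'0 a0 l0 dec(4) tf ti in auto)
  next
    case False
    then have q2: "q \<ge> 2" using dec(5) by simp
    have degg: "poly_map_degree g = q" using poly_map_degree_eq[OF dec(7), of b] dec(8) by (metis zero_index)
    have "q < D" using Dkq dec(4) q2 by simp
    from less.IH[OF this dec(2) degg q2] obtain vg vg' \<kappa> \<kappa>' E where
      g: "vg \<noteq> 0" "vg' \<noteq> 0" "\<kappa> \<noteq> 0" "\<kappa>' \<noteq> 0" "E \<ge> 2"
      "map_top q g (\<lambda>z. (\<kappa> * om vg' z ^ q) *s vg)" "map_top E (inv g) (\<lambda>z. (\<kappa>' * om vg z ^ E) *s vg')" by blast
    have Tg: "Tg = (\<lambda>z. (\<kappa> * om vg' z ^ q) *s vg)" using map_top_unique[OF dec(7) g(6)] .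
    then have vg2: "vg $ 2 \<noteq> 0" using dec(8) by auto
    have "(\<kappa> * om vg' z ^ q * vg $ 2) ^ ?k = (\<kappa> * vg $ 2) ^ ?k * om vg' z ^ D" for z
      by (simp add: power_mult_distrib Dkq mult_ac power_mult)
    then have tf: "map_top D f (\<lambda>z. ((?a * (\<kappa> * vg $ 2) ^ ?k) * om vg' z ^ D) *s v)"
      using topf unfolding Tg by (simp add: mult.assoc)
    have ti0: "map_top (E * ?k) (inv f) ((\<lambda>z. (\<kappa>' * om vg z ^ E) *s vg') \<circ> (\<lambda>z. pair2 (- ?a * om v z ^ ?k) 0))"
      unfolding invf by (rule map_top_compose[OF g(7) tops k0])
    have tie: "\<kappa>' * om vg (pair2 (- ?a * om v z ^ ?k) 0) ^ E = (\<kappa>' * (vg $ 2 * ?a) ^ E) * om v z ^ (E * ?k)" for z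
      unfolding om_pair2_zero by (simp add: power_mult_distrib mult_ac flip: power_mult)
    have ti: "map_top (E * ?k) (inv f) (\<lambda>z. ((\<kappa>' * (vg $ 2 * ?a) ^ E) * om v z ^ (E * ?k)) *s vg')"
      using ti0 unfolding comp_def tie .
    have "E * ?k \<ge> 2 * 1" using g(5) k0 by (intro mult_mono) auto
    then show ?thesis
      by - (rule exI[of _ v], rule exI[of _ vg'], rule exI[of _ "?a * (\<kappa> * vg $ 2) ^ ?k"],
          rule exI[of _ "\<kappa>' * (vg $ 2 * ?a) ^ E"], rule exI[of _ "E * ?k"],
          use v0 g a0 vg2 tf ti in auto)
  qed
qed

lemma funpow_conjugate:
  assumes "bij \<phi>" "f = inv \<phi> \<circ> (h \<circ> \<phi>)"
  shows "f ^^ n = inv \<phi> \<circ> ((h ^^ n) \<circ> \<phi>)"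
proof (induction n)
  case 0
  then show ?case using assms(1) by (simp add: bij_is_inj)
next
  case (Suc n)
  have "\<phi> (inv \<phi> x) = x" for x using assms(1) by (simp add: bij_is_surj surj_f_inv_f)
  then show ?case by (simp add: Suc.IH) (auto simp: assms(2))
qed

lemma poly_diffeo_funpow: "poly_diffeo f \<Longrightarrow> poly_diffeo (f ^^ n)"
proof (induction n)
  case 0
  have "map_le 1 id" by (simp add: map_le_def poly_le_var[unfolded One_nat_def])
  then have "poly_diffeo (id :: complex^2 \<Rightarrow> complex^2)"
    using poly_diffeoI(1)[of 1 id 1 id] id_apply by metis
  then show ?case unfolding funpow.simps(1) .
qed (auto intro: poly_diffeo_compose)

lemma root_sandwich:
  fixes a :: "nat \<Rightarrow> real"
  assumes "0 < c" "0 \<le> D" "\<And>n. D ^ n / c \<le> a n" "\<And>n. a n \<le> c * D ^ n"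
  shows "(\<lambda>n. root n (a n)) \<longlonglongrightarrow> D"
proof (rule tendsto_sandwich)
  have "(\<lambda>n. D * root n (1 / c)) \<longlonglongrightarrow> D * 1"
    by (intro tendsto_intros LIMSEQ_root_const) (use assms in simp)
  then show "(\<lambda>n. D * root n (1 / c)) \<longlonglongrightarrow> D" by simp
  have "(\<lambda>n. D * root n c) \<longlonglongrightarrow> D * 1"
    by (intro tendsto_intros LIMSEQ_root_const) (use assms in simp)
  then show "(\<lambda>n. D * root n c) \<longlonglongrightarrow> D" by simp
  show "\<forall>\<^sub>F n in sequentially. D * root n (1 / c) \<le> root n (a n)"
    using eventually_gt_at_top[of 0]
  proof eventually_elim
    case (elim n)
    have "root n (D ^ n * (1 / c)) \<le> root n (a n)" using elim assms(3)[of n] by (simp add: real_root_le_iff)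
    then show ?case using elim assms(2) by (simp only: real_root_mult real_root_power_cancel)
  qed
  show "\<forall>\<^sub>F n in sequentially. root n (a n) \<le> D * root n c"
    using eventually_gt_at_top[of 0]
  proof eventually_elim
    case (elim n)
    have "root n (a n) \<le> root n (D ^ n * c)" using elim assms(4)[of n] by (simp add: real_root_le_iff mult.commute)
    then show ?case using elim assms(2) by (simp only: real_root_mult real_root_power_cancel)
  qed
qed

lemma poly_map_degree_compose:
  assumes "poly_diffeo f" "poly_diffeo g"
  shows "poly_map_degree (f \<circ> g) \<le> poly_map_degree f * poly_map_degree g"
  using poly_map_degree_le map_le_compose poly_diffeo_map_le(1) assms by blast

lemma poly_map_degree_conjugate:
  assumes "poly_diffeo \<phi>" "poly_diffeo h" "f = inv \<phi> \<circ> (h \<circ> \<phi>)"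
  shows "poly_map_degree (f ^^ n) \<le> poly_map_degree (inv \<phi>) * poly_map_degree \<phi> * poly_map_degree (h ^^ n)"
    and "poly_map_degree (h ^^ n) \<le> poly_map_degree (inv \<phi>) * poly_map_degree \<phi> * poly_map_degree (f ^^ n)"
proof -
  have bij: "bij \<phi>" using assms by (simp add: poly_diffeo_def)
  have d: "poly_diffeo (inv \<phi>)" "poly_diffeo (h ^^ n)" "poly_diffeo (f ^^ n)"
    using assms by (auto intro!: poly_diffeo_inv poly_diffeo_funpow poly_diffeo_compose)
  have eq: "f ^^ n = inv \<phi> \<circ> ((h ^^ n) \<circ> \<phi>)" by (rule funpow_conjugate[OF bij assms(3)])
  have "poly_map_degree (f ^^ n) \<le> poly_map_degree (inv \<phi>) * poly_map_degree ((h ^^ n) \<circ> \<phi>)"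
    unfolding eq by (intro poly_map_degree_compose poly_diffeo_compose d assms)
  also have "\<dots> \<le> poly_map_degree (inv \<phi>) * (poly_map_degree (h ^^ n) * poly_map_degree \<phi>)"
    by (intro mult_left_mono poly_map_degree_compose d assms) auto
  finally show "poly_map_degree (f ^^ n) \<le> poly_map_degree (inv \<phi>) * poly_map_degree \<phi> * poly_map_degree (h ^^ n)"
    by (simp add: mult_ac)
  have "h ^^ n = \<phi> \<circ> ((f ^^ n) \<circ> inv \<phi>)"
    using poly_diffeo_inverse[OF assms(1)] by (auto simp: eq)
  then have "poly_map_degree (h ^^ n) \<le> poly_map_degree \<phi> * poly_map_degree ((f ^^ n) \<circ> inv \<phi>)"
    using poly_map_degree_compose[OF assms(1), of "(f ^^ n) \<circ> inv \<phi>"] poly_diffeo_compose(1)[OF d(3,1)] by simp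
  also have "\<dots> \<le> poly_map_degree \<phi> * (poly_map_degree (f ^^ n) * poly_map_degree (inv \<phi>))"
    by (intro mult_left_mono poly_map_degree_compose d assms) auto
  finally show "poly_map_degree (h ^^ n) \<le> poly_map_degree (inv \<phi>) * poly_map_degree \<phi> * poly_map_degree (f ^^ n)"
    by (simp add: mult_ac)
qed

text \<open>The dynamical degree is \<open>D\<close> as soon as the degrees of the iterates of one conjugate are
  comparable to \<open>D ^ n\<close>.\<close>

lemma dyn_degree_conjugate:
  assumes "poly_diffeo \<phi>" "poly_diffeo h" "f = inv \<phi> \<circ> (h \<circ> \<phi>)"
    and C: "1 \<le> C" and D: "1 \<le> D" and deg: "\<And>n. D ^ n \<le> C * poly_map_degree (h ^^ n)"
    "\<And>n. poly_map_degree (h ^^ n) \<le> C * D ^ n"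
  shows "dyn_degree f = real D"
proof -
  let ?p = "poly_map_degree (inv \<phi>) * poly_map_degree \<phi>"
  let ?c = "C * ?p"
  have p: "?p > 0" using poly_diffeo_degree_pos assms(1) poly_diffeo_inv by auto
  have up: "poly_map_degree (f ^^ n) \<le> ?c * D ^ n" for n
  proof -
    have "poly_map_degree (f ^^ n) \<le> ?p * (C * D ^ n)"
      using poly_map_degree_conjugate(1)[OF assms(1-3), of n] deg(2)[of n] by (meson le_trans mult_le_mono2)
    then show ?thesis by (simp add: mult_ac)
  qed
  have lo: "D ^ n \<le> ?c * poly_map_degree (f ^^ n)" for n
  proof -
    have "D ^ n \<le> C * (?p * poly_map_degree (f ^^ n))"
      using poly_map_degree_conjugate(2)[OF assms(1-3), of n] deg(1)[of n] by (meson le_trans mult_le_mono2)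
    then show ?thesis by (simp add: mult_ac)
  qed
  have "(\<lambda>n. root n (real (poly_map_degree (f ^^ n)))) \<longlonglongrightarrow> real D"
  proof (rule root_sandwich[of "real ?c"])
    show "0 < real ?c" using p C by simp
    show "real D ^ n / real ?c \<le> real (poly_map_degree (f ^^ n))" for n
    proof -
      have "real (D ^ n) \<le> real (?c * poly_map_degree (f ^^ n))" using lo[of n] by (rule of_nat_mono)
      then show ?thesis using p C by (simp add: field_simps)
    qed
    show "real (poly_map_degree (f ^^ n)) \<le> real ?c * real D ^ n" for n
      using of_nat_mono[OF up[of n], where 'a = real] by simp
  qed simp
  then show ?thesis unfolding dyn_degree_def by (rule limI)
qed

text \<open>Degrees multiply under iteration of a regular map, because the iterates of the leading form do
  not vanish at \<open>v\<close>.\<close>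

lemma regular_iterate_degree:
  assumes top: "map_top D h (\<lambda>z. (\<kappa> * om v' z ^ D) *s v)" and "D > 0" "\<kappa> \<noteq> 0" "om v' v \<noteq> 0"
  shows "poly_map_degree (h ^^ n) = D ^ n"
proof -
  let ?T = "\<lambda>z. (\<kappa> * om v' z ^ D) *s v"
  have v: "v \<noteq> 0" using assms(4) by (auto simp: om_simps)
  have "map_top (D ^ n) (h ^^ n) (?T ^^ n) \<and> (\<exists>c. c \<noteq> 0 \<and> (?T ^^ n) v = c *s v)"
  proof (induction n)
    case 0
    show ?case
      by (auto simp: map_top_def homog_has_top homog_var[unfolded One_nat_def] intro!: exI[of _ 1])
  next
    case (Suc n)
    then obtain c where c: "c \<noteq> 0" "(?T ^^ n) v = c *s v" by blast
    have "map_top (D * D ^ n) (h \<circ> h ^^ n) (?T \<circ> ?T ^^ n)"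
      using Suc assms(2) by (intro map_top_compose[OF top]) auto
    moreover have "(?T \<circ> ?T ^^ n) v = (\<kappa> * (c * om v' v) ^ D) *s v" by (simp add: c(2) om_simps)
    moreover have "\<kappa> * (c * om v' v) ^ D \<noteq> 0" using assms c by simp
    ultimately show ?case unfolding funpow.simps(2) power_Suc by blast
  qed
  then obtain c where "map_top (D ^ n) (h ^^ n) (?T ^^ n)" "c \<noteq> 0" "(?T ^^ n) v = c *s v" by blast
  moreover have "c *s v \<noteq> 0" using v \<open>c \<noteq> 0\<close> by simp
  ultimately show ?thesis using poly_map_degree_eq[of "D ^ n" "h ^^ n" "?T ^^ n" v] by metis
qed

text \<open>A representative of minimal degree in the conjugacy class is regular: the direction of its
  leading form is not in the kernel of the linear form.\<close>

lemma regular_conjugate: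
  assumes f: "poly_diffeo f" and dyn: "dyn_degree f > 1"
  obtains \<phi> h v v' \<kappa> \<kappa>' D D' where "poly_diffeo \<phi>" "poly_diffeo h" "f = inv \<phi> \<circ> (h \<circ> \<phi>)"
    "D \<ge> 2" "D' \<ge> 2" "\<kappa> \<noteq> 0" "\<kappa>' \<noteq> 0" "om v' v \<noteq> 0"
    "map_top D h (\<lambda>z. (\<kappa> * om v' z ^ D) *s v)" "map_top D' (inv h) (\<lambda>z. (\<kappa>' * om v z ^ D') *s v')"
proof -
  \<comment> \<open>the automorphisms conjugate to \<open>f\<close>\<close>
  define C where "C = (\<lambda>h. \<exists>\<phi>. poly_diffeo \<phi> \<and> poly_diffeo h \<and> f = inv \<phi> \<circ> (h \<circ> \<phi>))"
  have idd: "poly_diffeo id" using poly_diffeo_funpow[OF f, of 0] by simp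
  have "C f" unfolding C_def using idd f by (intro exI[of _ id]) simp
  then obtain h where h: "C h" "\<And>h'. C h' \<Longrightarrow> poly_map_degree h \<le> poly_map_degree h'"
    using ex_has_least_nat[of C f poly_map_degree] by auto
  have C_conj: "C (inv \<theta> \<circ> (h' \<circ> \<theta>))" if "C h'" "poly_diffeo \<theta>" for h' \<theta>
  proof -
    obtain \<phi> where p: "poly_diffeo \<phi>" "poly_diffeo h'" "f = inv \<phi> \<circ> (h' \<circ> \<phi>)" using \<open>C h'\<close> unfolding C_def by blast
    have th: "\<theta> (inv \<theta> x) = x" for x using poly_diffeo_inverse[OF that(2)] by simp
    have "poly_diffeo (inv \<theta> \<circ> \<phi>)" "inv (inv \<theta> \<circ> \<phi>) = inv \<phi> \<circ> \<theta>"
      using poly_diffeo_compose[OF poly_diffeo_inv[OF that(2)] p(1)] that(2)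
      by (auto simp: inv_inv_eq poly_diffeo_def)
    moreover have "f = (inv \<phi> \<circ> \<theta>) \<circ> ((inv \<theta> \<circ> (h' \<circ> \<theta>)) \<circ> (inv \<theta> \<circ> \<phi>))"
      unfolding p(3) by (auto simp: th)
    moreover have "poly_diffeo (inv \<theta> \<circ> (h' \<circ> \<theta>))"
      by (intro poly_diffeo_compose poly_diffeo_inv that p)
    ultimately show ?thesis unfolding C_def by (intro exI[of _ "inv \<theta> \<circ> \<phi>"]) simp
  qed
  \<comment> \<open>bounded degrees of the iterates would give dynamical degree one\<close>
  have bounded_False: False if "C h'" "\<And>n. map_le B (h' ^^ n)" for h' B
  proof -
    obtain \<phi> where p: "poly_diffeo \<phi>" "poly_diffeo h'" "f = inv \<phi> \<circ> (h' \<circ> \<phi>)" using \<open>C h'\<close> unfolding C_def by blast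
    have dpos: "poly_map_degree (h' ^^ n) > 0" for n using poly_diffeo_degree_pos poly_diffeo_funpow p(2) by blast
    have "dyn_degree f = real 1"
    proof (rule dyn_degree_conjugate[OF p, of "max 1 B" 1])
      show "1 ^ n \<le> max 1 B * poly_map_degree (h' ^^ n)" for n using dpos[of n] by simp
      show "poly_map_degree (h' ^^ n) \<le> max 1 B * 1 ^ n" for n
        using poly_map_degree_le[OF that(2)[of n]] by simp
    qed simp_all
    then show False using dyn by simp
  qed
  obtain \<phi> where p: "poly_diffeo \<phi>" "poly_diffeo h" "f = inv \<phi> \<circ> (h \<circ> \<phi>)" using h(1) unfolding C_def by blast
  let ?D = "poly_map_degree h"
  have D2: "?D \<ge> 2"
  proof (rule ccontr)
    assume "\<not> ?D \<ge> 2"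
    then have le: "map_le 1 h" using poly_diffeo_map_le(1)[OF p(2)] map_le_mono by fastforce
    have "map_le 1 (h ^^ n)" for n
    proof (induction n)
      case 0 show ?case by (simp add: map_le_def poly_le_var[unfolded One_nat_def])
    next
      case (Suc n) then show ?case using map_le_compose[OF le Suc] by (simp only: funpow.simps(2) mult_1)
    qed
    then show False using bounded_False h(1) by blast
  qed
  obtain v v' \<kappa> \<kappa>' D' where ts: "v \<noteq> 0" "v' \<noteq> 0" "\<kappa> \<noteq> 0" "\<kappa>' \<noteq> 0" "D' \<ge> 2"
    "map_top ?D h (\<lambda>z. (\<kappa> * om v' z ^ ?D) *s v)" "map_top D' (inv h) (\<lambda>z. (\<kappa>' * om v z ^ D') *s v')"
    using top_form_structure[OF p(2) refl D2] by blast
  have "om v' v \<noteq> 0"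
  proof
    assume om0: "om v' v = 0"
    obtain u w s g q Tg b where dec: "om u w = 1" "poly_diffeo g" "h = lin u w \<circ> (shear s \<circ> g)" "degree s \<ge> 2"
      "0 < q" "?D = degree s * q" "map_top q g Tg" "Tg b $ 2 \<noteq> 0"
      by (rule jung_decomposition[OF p(2) D2]) (rule that)
    let ?k = "degree s" and ?a = "lead_coeff s"
    have k0: "0 < ?k" and a0: "?a \<noteq> 0" using dec(4) by auto
    have u0: "u \<noteq> 0" using dec(1) by (auto simp: om_simps)
    have "map_top (1 * (?k * q)) (lin u w \<circ> (shear s \<circ> g)) (lin u w \<circ> ((\<lambda>z. pair2 (?a * z $ 2 ^ ?k) 0) \<circ> Tg))"
      using dec(5) k0 by (intro map_top_compose[OF lin_top map_top_compose[OF shear_top[OF dec(4)] dec(7)]]) auto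
    moreover have "lin u w \<circ> ((\<lambda>z. pair2 (?a * z $ 2 ^ ?k) 0) \<circ> Tg) = (\<lambda>z. (?a * (Tg z $ 2) ^ ?k) *s u)"
      by (auto simp: lin_def)
    ultimately have "map_top ?D h (\<lambda>z. (?a * (Tg z $ 2) ^ ?k) *s u)" by (simp only: dec(3)[symmetric] dec(6) mult_1)
    then have "(\<lambda>z. (?a * (Tg z $ 2) ^ ?k) *s u) = (\<lambda>z. (\<kappa> * om v' z ^ ?D) *s v)"
      using map_top_unique ts(6) by blast
    then have eq: "(?a * (Tg z $ 2) ^ ?k) *s u = (\<kappa> * om v' z ^ ?D) *s v" for z by metis
    define \<beta> where "\<beta> = ?a * (Tg b $ 2) ^ ?k"
    have "\<beta> \<noteq> 0" using a0 dec(8) by (simp add: \<beta>_def)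
    moreover have "\<beta> *s u = (\<kappa> * om v' b ^ ?D) *s v" using eq[of b] by (simp add: \<beta>_def)
    ultimately have u: "u = (inverse \<beta> * (\<kappa> * om v' b ^ ?D)) *s v"
      by (metis left_inverse vector_smult_assoc vector_smult_lid)
    then have "om v' u = 0" using om0 by (metis om_simps(2) mult_zero_right)
    then have "(?a * (Tg u $ 2) ^ ?k) *s u = 0" using eq[of u] D2 by (simp add: power_0_left)
    then have Tu: "Tg u $ 2 = 0" using a0 u0 by simp
    \<comment> \<open>conjugated with the linear map, \<open>h\<close> becomes \<open>g1\<close> followed by the shear, and the second component of the leading form of \<open>g1\<close> vanishes at \<open>(1, 0)\<close>\<close>
    define g1 where "g1 = g \<circ> lin u w"
    define T1 where "T1 = Tg \<circ> lin u w"
    have g1d: "poly_diffeo g1" unfolding g1_def using poly_diffeo_compose dec(2) lin_diffeo[OF dec(1)] by blast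
    have top1: "map_top q g1 T1"
      using map_top_compose[OF dec(7) lin_top, of u w] by (simp add: g1_def T1_def)
    have lin10: "lin u w (pair2 1 0) = u" by (simp add: lin_def)
    have T10: "T1 (pair2 1 0) $ 2 = 0" using Tu by (simp add: T1_def lin10)
    have T1nz: "T1 (colin u w b) $ 2 \<noteq> 0" using dec(8) by (simp add: T1_def lin_colin[OF dec(1)])
    define h1 where "h1 = inv (lin u w) \<circ> (h \<circ> lin u w)"
    have "C h1" unfolding h1_def using C_conj[OF h(1)] lin_diffeo[OF dec(1)] by blast
    have h1: "h1 = shear s \<circ> g1"
      unfolding h1_def lin_diffeo(2)[OF dec(1)] dec(3) g1_def by (auto simp: lin_colin[OF dec(1)])
    show False
    proof (cases "q = 1")
      case False
      then have q2: "q \<ge> 2" using dec(5) by simp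
      have degg: "poly_map_degree g1 = q" using poly_map_degree_eq[OF top1, of "colin u w b"] T1nz by (metis zero_index)
      obtain vg vg' \<mu> where g: "\<mu> \<noteq> 0" "map_top q g1 (\<lambda>z. (\<mu> * om vg' z ^ q) *s vg)"
        using top_form_structure[OF g1d degg q2] by blast
      have T1: "T1 = (\<lambda>z. (\<mu> * om vg' z ^ q) *s vg)" using map_top_unique[OF top1 g(2)] .
      have vg2: "vg $ 2 \<noteq> 0" using T1nz unfolding T1 by auto
      have "(\<mu> * om vg' (pair2 1 0) ^ q) * vg $ 2 = 0"
        using T10 by (simp only: T1 vector_smult_component)
      then have "\<mu> * om vg' (pair2 1 0) ^ q = 0" using vg2 by simp
      then have "T1 (pair2 1 0) = 0" by (simp only: T1 vector_smult_lzero)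
      then have T1x': "T1 (x *s pair2 1 0) = 0" for x using map_top_scale[OF top1, of x "pair2 1 0"] by simp
      have "pair2 x 0 = x *s pair2 1 0" for x by (simp add: pair2_eq_iff)
      then have T1x: "T1 (pair2 x 0) = 0" for x using T1x' by metis
      \<comment> \<open>conjugation with the shear cancels the leading form, against minimality of the degree\<close>
      define h2 where "h2 = inv (shear s) \<circ> (h1 \<circ> shear s)"
      have "C h2" unfolding h2_def by (intro C_conj \<open>C h1\<close> shear_diffeo)
      have m2: "h2 = g1 \<circ> shear s" unfolding h2_def h1 shear_diffeo(2) by (auto simp: shear_inverse)
      have mt: "map_top (q * ?k) (g1 \<circ> shear s) (T1 \<circ> (\<lambda>z. pair2 (?a * z $ 2 ^ ?k) 0))"
        by (rule map_top_compose[OF top1 shear_top[OF dec(4)] k0])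
      have sk: "Suc (?D - 1) = q * ?k" using D2 dec(6) by (simp add: mult.commute)
      have tz: "T1 \<circ> (\<lambda>z. pair2 (?a * z $ 2 ^ ?k) 0) = (\<lambda>z. 0)" using T1x by auto
      have "map_top (Suc (?D - 1)) h2 (\<lambda>z. 0)"
        using mt unfolding m2[symmetric] sk[symmetric] tz .
      then have "map_le (?D - 1) h2" by (rule map_top_zero_imp)
      then have "poly_map_degree h2 \<le> ?D - 1" by (rule poly_map_degree_le)
      then show False using h(2)[OF \<open>C h2\<close>] D2 by simp
    next
      case True
      \<comment> \<open>\<open>h1\<close> is triangular, so its iterates have bounded degree\<close>
      have aff: "\<exists>\<alpha> \<beta> \<gamma>. \<forall>z. g1 z $ i = \<alpha> * z $ 1 + \<beta> * z $ 2 + \<gamma>" for i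
      proof -
        have t: "has_top 1 (\<lambda>z. g1 z $ i) (\<lambda>z. T1 z $ i)" using top1 True by (simp add: map_top_def)
        then obtain y where y: "(\<lambda>z. T1 z $ i) = om y" using homog_one_om by (metis has_top_def)
        have le: "poly_le 0 (\<lambda>z. g1 z $ i - T1 z $ i)" using t by (simp add: has_top_def lower_def)
        have "g1 z $ i - T1 z $ i = g1 0 $ i - T1 0 $ i" for z
          using poly_le_nonconst_top[OF le, of z 0] by (metis le_zero_eq less_irrefl)
        moreover have "T1 z $ i = om y z" for z using y by metis
        ultimately have "g1 z $ i = - y $ 2 * z $ 1 + y $ 1 * z $ 2 + g1 0 $ i" for z
          by (metis (no_types, lifting) om_simps(6) om_def diff_0_right diff_eq_eq add.commute mult_minus_left uminus_add_conv_diff)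
        then show ?thesis by blast
      qed
      obtain \<alpha> \<beta> \<gamma> where g11: "\<And>z. g1 z $ 1 = \<alpha> * z $ 1 + \<beta> * z $ 2 + \<gamma>" using aff[of 1] by blast
      obtain \<alpha>' b' c' where "\<And>z. g1 z $ 2 = \<alpha>' * z $ 1 + b' * z $ 2 + c'" using aff[of 2] by blast
      moreover have "\<alpha>' = 0"
      proof -
        have "has_top 1 (\<lambda>z. g1 z $ 2) (om (pair2 b' (- \<alpha>')))"
          using homog_om[of "pair2 b' (- \<alpha>')"] calculation
          by (simp add: has_top_def lower_def om_def[abs_def] poly_le_const)
        moreover have "has_top 1 (\<lambda>z. g1 z $ 2) (\<lambda>z. T1 z $ 2)" using top1 True by (simp add: map_top_def)
        ultimately have "om (pair2 b' (- \<alpha>')) = (\<lambda>z. T1 z $ 2)" using has_top_unique by blast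
        then have "om (pair2 b' (- \<alpha>')) (pair2 1 0) = 0" using T10 by metis
        then show ?thesis by (simp add: om_def)
      qed
      ultimately have g12: "\<And>z. g1 z $ 2 = b' * z $ 2 + c'" by simp
      have h1x: "h1 z $ 1 = \<alpha> * z $ 1 + (\<beta> * z $ 2 + \<gamma> + poly s (b' * z $ 2 + c'))" "h1 z $ 2 = b' * z $ 2 + c'" for z
        by (simp_all add: h1 shear_def g11 g12)
      define t where "t = [:\<gamma>, \<beta>:] + pcompose s [:c', b':]"
      have tdeg: "degree t \<le> ?k"
        unfolding t_def by (rule degree_add_le) (use dec(4) degree_pcompose_le[of s "[:c', b':]"] in \<open>auto split: if_splits\<close>)
      have "\<exists>A U B E. degree U \<le> ?k \<and> (\<forall>z. (h1 ^^ n) z $ 1 = A * z $ 1 + poly U (z $ 2)) \<and> (\<forall>z. (h1 ^^ n) z $ 2 = B * z $ 2 + E)" for n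
      proof (induction n)
        case 0
        show ?case by (rule exI[of _ 1], rule exI[of _ 0], rule exI[of _ 1], rule exI[of _ 0]) simp
      next
        case (Suc n)
        then obtain A U B E where IH: "degree U \<le> ?k" "\<And>z. (h1 ^^ n) z $ 1 = A * z $ 1 + poly U (z $ 2)"
          "\<And>z. (h1 ^^ n) z $ 2 = B * z $ 2 + E" by blast
        define U' where "U' = smult \<alpha> U + pcompose t [:E, B:]"
        have "degree (pcompose t [:E, B:]) \<le> ?k"
          using degree_pcompose_le[of t "[:E, B:]"] tdeg by (auto split: if_splits)
        then have "degree U' \<le> ?k" unfolding U'_def using IH(1) by (intro degree_add_le) (auto intro: order_trans[OF degree_smult_le])
        moreover have "(h1 ^^ Suc n) z $ 1 = (\<alpha> * A) * z $ 1 + poly U' (z $ 2)" for z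
          by (simp add: h1x IH U'_def t_def poly_pcompose algebra_simps)
        moreover have "(h1 ^^ Suc n) z $ 2 = (b' * B) * z $ 2 + (b' * E + c')" for z
          by (simp add: h1x IH algebra_simps)
        ultimately show ?case by blast
      qed
      have "map_le ?k (h1 ^^ n)" for n
      proof -
        obtain A U B E where IH: "degree U \<le> ?k" "\<And>z. (h1 ^^ n) z $ 1 = A * z $ 1 + poly U (z $ 2)"
          "\<And>z. (h1 ^^ n) z $ 2 = B * z $ 2 + E"
          using \<open>\<And>n. \<exists>A U B E. _ n A U B E\<close> by blast
        have v: "poly_le ?k (\<lambda>z. z $ i)" for i by (rule poly_le_mono[OF poly_le_var]) (use dec(4) in simp)
        have "poly_le ?k (\<lambda>z. poly U (z $ 2))"
          by (rule poly_le_mono[OF poly_le_poly[OF poly_le_var]]) (use IH(1) in simp)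
        then show ?thesis unfolding map_le_def forall_2 IH
          by (intro conjI poly_le_add poly_le_cmult v poly_le_const)
      qed
      then show False using bounded_False \<open>C h1\<close> by blast
    qed
  qed
  then show ?thesis using that[OF p D2 ts(5,3,4) _ ts(6,7)] by blast
qed

section \<open>The escape rate\<close>

lemma affine_top_injective:
  assumes a: "poly_diffeo a" and T: "map_top 1 a T" and v: "v \<noteq> 0"
  shows "T v \<noteq> 0"
proof
  assume T0: "T v = 0"
  obtain U where U: "map_top 1 (inv a) U" "\<And>z. T (U z) = z" using affine_inverse_top[OF a T] by metis
  obtain V where V: "map_top 1 (inv (inv a)) V" "\<And>z. U (V z) = z"
    using affine_inverse_top[OF poly_diffeo_inv[OF a] U(1)] by metis
  have "inv (inv a) = a" using a by (simp add: poly_diffeo_def inv_inv_eq)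
  then have "V = T" using V(1) T map_top_unique by metis
  then have "U (T v) = v" using V(2) by metis
  moreover have "U 0 = 0" using map_top_scale[OF U(1), of 0 0] by simp
  ultimately show False using T0 v by simp
qed

text \<open>Composing with enough iterates of the regular map \<open>h\<close> makes the leading form of
  \<open>inv \<phi>\<close> nondegenerate in the attracting direction \<open>v\<close>: otherwise the degrees of these
  compositions would decrease forever.\<close>

lemma eventually_nondegenerate:
  assumes \<phi>: "poly_diffeo \<phi>" and h: "poly_diffeo h"
    and top': "map_top D' (inv h) (\<lambda>z. (\<kappa>' * om v z ^ D') *s v')"
    and nz: "D' \<ge> 2" "\<kappa>' \<noteq> 0" "om v' v \<noteq> 0"
  obtains k E T where "E > 0" "map_top E (inv \<phi> \<circ> (h ^^ k)) T" "T v \<noteq> 0"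
proof -
  define a where "a k = inv \<phi> \<circ> (h ^^ k)" for k
  have ad: "poly_diffeo (a k)" for k
    unfolding a_def by (intro poly_diffeo_compose poly_diffeo_inv poly_diffeo_funpow \<phi> h)
  let ?e = "\<lambda>k. poly_map_degree (a k)"
  have epos: "?e k > 0" for k using poly_diffeo_degree_pos ad by blast
  have v0: "v \<noteq> 0" using nz(3) by (auto simp: om_simps)
  have "\<exists>k T. map_top (?e k) (a k) T \<and> T v \<noteq> 0"
  proof (rule ccontr)
    assume neg: "\<not> ?thesis"
    have step: "?e (Suc k) < ?e k" for k
    proof -
      obtain T z where T: "map_top (?e (Suc k)) (a (Suc k)) T" "T z \<noteq> 0"
        using poly_map_degree_top[OF _ epos] ad by (metis poly_diffeo_def)
      have Tv: "T v = 0" using neg T by blast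
      have "?e (Suc k) \<noteq> 1" using affine_top_injective[OF ad, of "Suc k" T v] T Tv v0 by metis
      then have e2: "?e (Suc k) \<ge> 2" using epos[of "Suc k"] by linarith
      obtain u u' \<mu> where u: "u \<noteq> 0" "u' \<noteq> 0" "\<mu> \<noteq> 0"
        "map_top (?e (Suc k)) (a (Suc k)) (\<lambda>z. (\<mu> * om u' z ^ ?e (Suc k)) *s u)"
        using top_form_structure[OF ad refl e2] by blast
      have Tu: "T z = (\<mu> * om u' z ^ ?e (Suc k)) *s u" for z using map_top_unique[OF T(1) u(4)] by metis
      have "om u' v = 0" using Tv u(1,3) unfolding Tu by simp
      then obtain b where b: "v = b *s u'" using om_zero_parallel u(2) by blast
      have "om u' v' \<noteq> 0"
      proof
        assume "om u' v' = 0"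
        then have "om v' u' = 0" by (simp add: om_def mult.commute)
        then show False using nz(3) b by (simp add: om_simps)
      qed
      then have Tv': "T v' \<noteq> 0" using u(1,3) unfolding Tu by simp
      obtain w where w: "om v w = 1" using ex_om_one[OF v0] .
      have hh: "inv h (h x) = x" "h (inv h x) = x" for x using poly_diffeo_inverse[OF h] by auto
      have "a (Suc k) \<circ> inv h = a k"
        unfolding a_def funpow_Suc_right by (auto simp: hh)
      then have "map_top (?e (Suc k) * D') (a k) (T \<circ> (\<lambda>z. (\<kappa>' * om v z ^ D') *s v'))"
        using map_top_compose[OF T(1) top'] nz(1) by simp
      moreover have "(T \<circ> (\<lambda>z. (\<kappa>' * om v z ^ D') *s v')) w = \<kappa>' ^ ?e (Suc k) *s T v'"
        using map_top_scale[OF T(1)] w by simp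
      moreover have "\<kappa>' ^ ?e (Suc k) *s T v' \<noteq> 0" using Tv' nz(2) by simp
      ultimately have "?e k = ?e (Suc k) * D'" by (metis poly_map_degree_eq)
      moreover have "?e (Suc k) * 1 < ?e (Suc k) * D'" using nz(1) epos[of "Suc k"] by (intro mult_strict_left_mono) auto
      ultimately show ?thesis by simp
    qed
    have "?e k + k \<le> ?e 0" for k
    proof (induction k)
      case (Suc k) then show ?case using step[of k] by simp
    qed simp
    from this[of "?e 0"] show False using epos[of "?e 0"] by simp
  qed
  then show ?thesis using that epos a_def by metis
qed

lemma log_plus_nonneg: "0 \<le> log_plus t"
  by (simp add: log_plus_def)

lemma log_plus_mono: "s \<le> t \<Longrightarrow> log_plus s \<le> log_plus t"
  by (simp add: log_plus_def)

lemma log_plus_eq_ln: "1 \<le> t \<Longrightarrow> log_plus t = ln t"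
  by (simp add: log_plus_def max_def)

lemma continuous_log_plus: "continuous_on UNIV (\<lambda>z :: complex^2. log_plus (norm z))"
  unfolding log_plus_def by (intro continuous_intros) auto

lemma log_plus_growth:
  assumes "map_le N f"
  obtains K where "K \<ge> 0" "\<And>x. log_plus (norm (f x)) \<le> real N * log_plus (norm x) + K"
proof -
  obtain C where C: "C > 0" "\<And>z. norm (f z) \<le> C * (1 + norm z) ^ N" using map_le_growth[OF assms] by metis
  define B where "B = max 1 (C * 2 ^ N)"
  have "log_plus (norm (f x)) \<le> real N * log_plus (norm x) + ln B" for x
  proof -
    let ?t = "max 1 (norm x)"
    have "(1 + norm x) ^ N \<le> (2 * ?t) ^ N" by (intro power_mono) auto
    then have "C * (1 + norm x) ^ N \<le> C * (2 ^ N * ?t ^ N)"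
      using C(1) by (simp only: power_mult_distrib) simp
    also have "\<dots> \<le> B * ?t ^ N"
      unfolding mult.assoc[symmetric] by (intro mult_right_mono) (auto simp: B_def)
    finally have 1: "norm (f x) \<le> B * ?t ^ N" using C(2)[of x] by linarith
    have "1 * 1 \<le> B * ?t ^ N" by (intro mult_mono one_le_power) (auto simp: B_def)
    then have "max 1 (norm (f x)) \<le> B * ?t ^ N" using 1 by simp
    then have "log_plus (norm (f x)) \<le> ln (B * ?t ^ N)" unfolding log_plus_def by (subst ln_le_cancel_iff) auto
    also have "\<dots> = ln B + real N * ln ?t"
      by (subst ln_mult) (auto simp: B_def ln_realpow)
    finally show ?thesis by (simp add: log_plus_def)
  qed
  then show ?thesis using that[of "ln B"] by (simp add: B_def)
qed

lemma realpow_at_top: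
  assumes "1 < (x :: real)"
  shows "filterlim (\<lambda>n. x ^ n) at_top sequentially"
  by (rule filterlim_at_infinity_imp_filterlim_at_top[OF filterlim_realpow_sequentially_gt1])
    (use assms in auto)

lemma map_le_funpow_continuous: "map_le N h \<Longrightarrow> continuous_on UNIV (h ^^ n)"
proof (induction n)
  case 0
  then show ?case by (simp add: continuous_on_id)
next
  case (Suc n)
  have "continuous_on UNIV (h \<circ> h ^^ n)"
    using Suc map_le_continuous[of N h UNIV] by (intro continuous_on_compose) (auto intro: continuous_on_subset)
  then show ?case unfolding funpow.simps(2) .
qed

text \<open>For a map \<open>h\<close> of degree at most \<open>D\<close>, a suitable constant added to \<open>log\<^sup>+\<close> makes the
  approximations of the escape rate a decreasing sequence.\<close>

lemma escape_rate:
  assumes h: "map_le D h" and D: "D \<ge> 2"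
  obtains K where "K \<ge> 0"
    "\<And>z. decseq (\<lambda>m. (log_plus (norm ((h ^^ m) z)) + K) / real D ^ m)"
    "\<And>z. convergent (\<lambda>m. log_plus (norm ((h ^^ m) z)) / real D ^ m)"
    "\<And>z m. lim (\<lambda>m. log_plus (norm ((h ^^ m) z)) / real D ^ m) \<le> (log_plus (norm ((h ^^ m) z)) + K) / real D ^ m"
    "\<And>z. (\<lambda>m. (log_plus (norm ((h ^^ m) z)) + K) / real D ^ m) \<longlonglongrightarrow> lim (\<lambda>m. log_plus (norm ((h ^^ m) z)) / real D ^ m)"
proof -
  obtain K where K: "K \<ge> 0" "\<And>x. log_plus (norm (h x)) \<le> real D * log_plus (norm x) + K"
    using log_plus_growth[OF h] by metis
  let ?l = "\<lambda>z m. log_plus (norm ((h ^^ m) z))"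
  let ?u = "\<lambda>z m. (?l z m + K) / real D ^ m"
  have dec: "decseq (?u z)" for z
  proof (rule decseq_SucI)
    fix m
    have "?l z (Suc m) + K \<le> real D * ?l z m + 2 * K" using K(2)[of "(h ^^ m) z"] by simp
    also have "\<dots> \<le> real D * (?l z m + K)"
      using mult_right_mono[of 2 "real D" K] D K(1) by (simp add: algebra_simps)
    finally have "?u z (Suc m) \<le> real D * (?l z m + K) / real D ^ Suc m" using D by (intro divide_right_mono) auto
    then show "?u z (Suc m) \<le> ?u z m" using D by simp
  qed
  have nonneg: "0 \<le> ?u z m" for z m using K(1) by (auto intro!: divide_nonneg_nonneg simp: log_plus_nonneg)
  have lim: "\<exists>L. ?u z \<longlonglongrightarrow> L \<and> (\<forall>m. L \<le> ?u z m)" for z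
  proof (rule decseq_convergent[OF dec[of z], of 0])
    show "\<forall>i. 0 \<le> ?u z i" using nonneg by blast
  qed blast
  have D0: "(\<lambda>m. K / real D ^ m) \<longlonglongrightarrow> 0"
  proof -
    have "(\<lambda>m. K * (1 / real D) ^ m) \<longlonglongrightarrow> K * 0"
      using D by (intro tendsto_intros LIMSEQ_power_zero) auto
    then show ?thesis by (simp add: power_divide)
  qed
  have main: "\<exists>L. ?u z \<longlonglongrightarrow> L \<and> (\<forall>m. L \<le> ?u z m) \<and> (\<lambda>m. ?l z m / real D ^ m) \<longlonglongrightarrow> L" for z
  proof -
    obtain L where L: "?u z \<longlonglongrightarrow> L" "\<And>m. L \<le> ?u z m" using lim[of z] by blast
    have "(\<lambda>m. ?u z m - K / real D ^ m) \<longlonglongrightarrow> L - 0" by (intro tendsto_diff L D0)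
    moreover have "?u z m - K / real D ^ m = ?l z m / real D ^ m" for m by (simp add: add_divide_distrib)
    ultimately show ?thesis using L by auto
  qed
  show ?thesis
  proof (rule that[of K])
    show "K \<ge> 0" by fact
    show "decseq (?u z)" for z by (rule dec)
    fix z
    obtain L where L: "?u z \<longlonglongrightarrow> L" "\<And>m. L \<le> ?u z m" "(\<lambda>m. ?l z m / real D ^ m) \<longlonglongrightarrow> L" using main[of z] by blast
    have lL: "lim (\<lambda>m. ?l z m / real D ^ m) = L" using L(3) by (rule limI)
    show "convergent (\<lambda>m. ?l z m / real D ^ m)" using L(3) convergentI by blast
    show "lim (\<lambda>m. ?l z m / real D ^ m) \<le> ?u z m" for m using L(2) lL by simp
    show "?u z \<longlonglongrightarrow> lim (\<lambda>m. ?l z m / real D ^ m)" using L(1) lL by simp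
  qed
qed

text \<open>An escaping orbit of a regular map leaves in the direction \<open>v\<close>, so a polynomial map that
  is nondegenerate in that direction multiplies the escape rate by its degree.\<close>

lemma escape_rate_image:
  assumes top: "map_top D h (\<lambda>z. (\<kappa> * om v' z ^ D) *s v)" and D: "D \<ge> 2" and v: "v \<noteq> 0"
    and a: "map_top E a T" "T v \<noteq> 0" and E: "E > 0"
    and G: "(\<lambda>m. log_plus (norm ((h ^^ m) z)) / real D ^ m) \<longlonglongrightarrow> G"
  shows "(\<lambda>m. log_plus (norm (a ((h ^^ m) z))) / real D ^ m) \<longlonglongrightarrow> real E * G"
proof (cases "G = 0")
  case True
  obtain K where K: "K \<ge> 0" "\<And>x. log_plus (norm (a x)) \<le> real E * log_plus (norm x) + K"
    using log_plus_growth[OF map_top_imp_le[OF a(1)]] by metis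
  have D0: "(\<lambda>m. K * (1 / real D) ^ m) \<longlonglongrightarrow> K * 0"
    using D by (intro tendsto_intros LIMSEQ_power_zero) auto
  have "(\<lambda>m. real E * (log_plus (norm ((h ^^ m) z)) / real D ^ m) + K * (1 / real D) ^ m) \<longlonglongrightarrow> real E * G + K * 0"
    by (intro tendsto_add D0 tendsto_mult_left G)
  then have up: "(\<lambda>m. real E * (log_plus (norm ((h ^^ m) z)) / real D ^ m) + K * (1 / real D) ^ m) \<longlonglongrightarrow> 0"
    using True by simp
  have "(\<lambda>m. log_plus (norm (a ((h ^^ m) z))) / real D ^ m) \<longlonglongrightarrow> 0"
  proof (rule tendsto_sandwich[OF _ _ tendsto_const up])
    show "\<forall>\<^sub>F m in sequentially. 0 \<le> log_plus (norm (a ((h ^^ m) z))) / real D ^ m"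
      by (auto intro!: always_eventually divide_nonneg_nonneg simp: log_plus_nonneg)
    show "\<forall>\<^sub>F m in sequentially. log_plus (norm (a ((h ^^ m) z))) / real D ^ m \<le>
       real E * (log_plus (norm ((h ^^ m) z)) / real D ^ m) + K * (1 / real D) ^ m"
    proof (intro always_eventually allI)
      fix m
      have "log_plus (norm (a ((h ^^ m) z))) / real D ^ m \<le> (real E * log_plus (norm ((h ^^ m) z)) + K) / real D ^ m"
        using K(2) by (intro divide_right_mono) auto
      then show "log_plus (norm (a ((h ^^ m) z))) / real D ^ m \<le>
       real E * (log_plus (norm ((h ^^ m) z)) / real D ^ m) + K * (1 / real D) ^ m"
        by (simp add: add_divide_distrib power_divide)
    qed
  qed
  then show ?thesis using True by simp
next
  case False
  let ?z = "\<lambda>m. (h ^^ m) z"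
  let ?x = "\<lambda>m. log_plus (norm (?z m))"
  have "G \<ge> 0" by (rule LIMSEQ_le_const[OF G]) (auto intro!: divide_nonneg_nonneg simp: log_plus_nonneg)
  then have Gpos: "G > 0" using False by simp
  have Dinf: "filterlim (\<lambda>m. real D ^ m) at_top sequentially"
    using D by (intro realpow_at_top) simp
  have scale: "filterlim (\<lambda>m. b m) at_top sequentially" if "(\<lambda>m. b m / real D ^ m) \<longlonglongrightarrow> c" "c > 0" for b c
  proof -
    have "filterlim (\<lambda>m. (b m / real D ^ m) * real D ^ m) at_top sequentially"
      by (rule filterlim_tendsto_pos_mult_at_top[OF that Dinf])
    then show ?thesis using D by simp
  qed
  have xinf: "filterlim ?x at_top sequentially" by (rule scale[OF G Gpos])
  have big: "\<forall>\<^sub>F m in sequentially. 1 < norm (?z m)"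
  proof -
    have "\<forall>\<^sub>F m in sequentially. 0 < ?x m" using xinf by (simp add: filterlim_at_top_dense)
    then show ?thesis
    proof eventually_elim
      case (elim m)
      then show ?case by (cases "1 < norm (?z m)") (simp_all add: log_plus_def max_def split: if_splits)
    qed
  qed
  have big': "\<forall>\<^sub>F m in sequentially. 1 < norm (?z (Suc m))" using big by (rule eventually_sequentially_Suc[THEN iffD2])
  have G': "(\<lambda>m. ?x (Suc m) / real D ^ Suc m) \<longlonglongrightarrow> G" using G by (rule LIMSEQ_Suc)
  \<comment> \<open>the error terms of order \<open>D - 1\<close> are negligible along the orbit\<close>
  have ratio: "(\<lambda>m. norm (?z m) ^ (D - 1) / norm (?z (Suc m))) \<longlonglongrightarrow> 0"
  proof -
    have "(\<lambda>m. real D * (?x (Suc m) / real D ^ Suc m) - real (D - 1) * (?x m / real D ^ m)) \<longlonglongrightarrow> real D * G - real (D - 1) * G"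
      by (intro tendsto_intros G G')
    moreover have "real D * G - real (D - 1) * G = G" using D by (simp add: of_nat_diff algebra_simps)
    moreover have "real D * (?x (Suc m) / real D ^ Suc m) - real (D - 1) * (?x m / real D ^ m) =
       (?x (Suc m) - real (D - 1) * ?x m) / real D ^ m" for m using D by (simp add: diff_divide_distrib)
    ultimately have "(\<lambda>m. (?x (Suc m) - real (D - 1) * ?x m) / real D ^ m) \<longlonglongrightarrow> G" by simp
    then have inf: "filterlim (\<lambda>m. ?x (Suc m) - real (D - 1) * ?x m) at_top sequentially" by (rule scale[OF _ Gpos])
    have "filterlim (\<lambda>m. - (?x (Suc m) - real (D - 1) * ?x m)) at_bot sequentially"
      using inf by (simp add: filterlim_uminus_at_bot)
    then have "(\<lambda>m. exp (- (?x (Suc m) - real (D - 1) * ?x m))) \<longlonglongrightarrow> 0"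
      by (rule filterlim_compose[OF exp_at_bot])
    moreover have "\<forall>\<^sub>F m in sequentially. exp (- (?x (Suc m) - real (D - 1) * ?x m)) = norm (?z m) ^ (D - 1) / norm (?z (Suc m))"
      using big big'
    proof eventually_elim
      case (elim m)
      have "?x (Suc m) = ln (norm (?z (Suc m)))" "?x m = ln (norm (?z m))"
        using elim by (auto simp: log_plus_eq_ln)
      then have "exp (- (?x (Suc m) - real (D - 1) * ?x m)) = exp (real (D - 1) * ln (norm (?z m))) / exp (ln (norm (?z (Suc m))))"
        by (simp add: exp_diff)
      also have "exp (real (D - 1) * ln (norm (?z m))) = norm (?z m) ^ (D - 1)"
      proof -
        have "norm (?z m) > 0" using elim by linarith
        then show ?thesis by (simp only: exp_of_nat_mult exp_ln)
      qed
      also have "exp (ln (norm (?z (Suc m)))) = norm (?z (Suc m))"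
        using elim(2) by (intro exp_ln) linarith
      finally show ?case .
    qed
    ultimately show ?thesis by (rule Lim_transform_eventually)
  qed
  define c where "c m = \<kappa> * om v' (?z m) ^ D" for m
  \<comment> \<open>the next point of the orbit is \<open>c m *s v\<close> up to a negligible error\<close>
  define R where "R m = ?z (Suc m) - c m *s v" for m
  obtain C where C: "C > 0" "\<And>x. norm (h x - (\<kappa> * om v' x ^ D) *s v) \<le> C * (1 + norm x) ^ (D - 1)"
  proof -
    have le: "map_le (D - 1) (\<lambda>x. h x - (\<kappa> * om v' x ^ D) *s v)"
      using top D by (simp add: map_top_def map_le_def has_top_def lower_def)
    show thesis by (rule map_le_growth[OF le]) (rule that)
  qed
  have Rsmall: "(\<lambda>m. norm (R m) / norm (?z (Suc m))) \<longlonglongrightarrow> 0"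
  proof (rule Lim_null_comparison)
    show "(\<lambda>m. C * 2 ^ (D - 1) * (norm (?z m) ^ (D - 1) / norm (?z (Suc m)))) \<longlonglongrightarrow> 0"
      using tendsto_mult_left[OF ratio, of "C * 2 ^ (D - 1)"] by simp
    show "\<forall>\<^sub>F m in sequentially. norm (norm (R m) / norm (?z (Suc m))) \<le> C * 2 ^ (D - 1) * (norm (?z m) ^ (D - 1) / norm (?z (Suc m)))"
      using big big'
    proof eventually_elim
      case (elim m)
      have "norm (R m) \<le> C * (1 + norm (?z m)) ^ (D - 1)" using C(2)[of "?z m"] by (simp add: R_def c_def)
      also have "\<dots> \<le> C * (2 * norm (?z m)) ^ (D - 1)"
        using elim C(1) by (intro mult_left_mono power_mono) auto
      finally have "norm (R m) \<le> C * 2 ^ (D - 1) * norm (?z m) ^ (D - 1)" by (simp add: power_mult_distrib)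
      then have "norm (R m) / norm (?z (Suc m)) \<le> C * 2 ^ (D - 1) * norm (?z m) ^ (D - 1) / norm (?z (Suc m))"
        by (intro divide_right_mono) auto
      then show ?case by simp
    qed
  qed
  have chalf: "\<forall>\<^sub>F m in sequentially. norm (?z (Suc m)) / 2 \<le> norm (c m) * norm v"
  proof -
    have "\<forall>\<^sub>F m in sequentially. norm (R m) / norm (?z (Suc m)) < 1 / 2"
      using Rsmall by (rule order_tendstoD) simp
    then show ?thesis using big'
    proof eventually_elim
      case (elim m)
      have "0 < norm (?z (Suc m))" using elim(2) by linarith
      then have "norm (R m) < 1 / 2 * norm (?z (Suc m))" using elim(1) by (simp only: pos_divide_less_eq)
      moreover have "norm (?z (Suc m)) \<le> norm (c m *s v) + norm (R m)"
        using norm_triangle_ineq[of "c m *s v" "R m"] by (simp add: R_def)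
      ultimately show ?case by (simp add: norm_smult)
    qed
  qed
  have zinf: "filterlim (\<lambda>m. norm (?z (Suc m))) at_top sequentially"
  proof -
    have e: "filterlim (\<lambda>m. exp (?x m)) at_top sequentially" by (rule filterlim_compose[OF exp_at_top xinf])
    have "\<forall>\<^sub>F m in sequentially. exp (?x m) \<le> norm (?z m)"
      using big
    proof eventually_elim
      case (elim m)
      then have "?x m = ln (norm (?z m))" "0 < norm (?z m)" by (simp add: log_plus_eq_ln, linarith)
      then show ?case by simp
    qed
    then have "filterlim (\<lambda>m. norm (?z m)) at_top sequentially" by (rule filterlim_at_top_mono[OF e])
    then show ?thesis by (rule filterlim_compose[OF _ filterlim_Suc])
  qed
  have nv: "norm v > 0" using v by simp
  have cinf: "filterlim c at_infinity sequentially"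
  proof -
    have "filterlim (\<lambda>m. 1 / (2 * norm v) * norm (?z (Suc m))) at_top sequentially"
      using nv by (intro filterlim_tendsto_pos_mult_at_top[OF tendsto_const _ zinf]) auto
    moreover have "\<forall>\<^sub>F m in sequentially. 1 / (2 * norm v) * norm (?z (Suc m)) \<le> norm (c m)"
      using chalf by eventually_elim (use nv in \<open>simp add: field_simps\<close>)
    ultimately have "filterlim (\<lambda>m. norm (c m)) at_top sequentially" by (rule filterlim_at_top_mono)
    then show ?thesis by (rule filterlim_norm_at_top_imp_at_infinity)
  qed
  have cne: "\<forall>\<^sub>F m in sequentially. c m \<noteq> 0"
    using cinf eventually_not_equal_at_infinity[of 0] filterlim_iff by blast
  define w where "w m = inverse (c m) *s ?z (Suc m)" for m
  have wv: "w \<longlonglongrightarrow> v"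
  proof -
    have "(\<lambda>m. w m - v) \<longlonglongrightarrow> 0"
    proof (rule Lim_null_comparison)
      show "(\<lambda>m. 2 * norm v * (norm (R m) / norm (?z (Suc m)))) \<longlonglongrightarrow> 0"
        using tendsto_mult_left[OF Rsmall, of "2 * norm v"] by simp
      show "\<forall>\<^sub>F m in sequentially. norm (w m - v) \<le> 2 * norm v * (norm (R m) / norm (?z (Suc m)))"
        using cne chalf big'
      proof eventually_elim
        case (elim m)
        have "w m - v = inverse (c m) *s R m"
          using elim by (simp add: w_def R_def vec_eq_iff algebra_simps)
        then have "norm (w m - v) = norm (R m) / norm (c m)"
          by (simp add: norm_smult norm_inverse divide_inverse)
        also have "\<dots> \<le> norm (R m) / (norm (?z (Suc m)) / (2 * norm v))"
        proof (rule divide_left_mono)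
          show "norm (?z (Suc m)) / (2 * norm v) \<le> norm (c m)" using elim nv by (simp add: field_simps)
          show "0 < norm (c m) * (norm (?z (Suc m)) / (2 * norm v))"
            using elim nv by (intro mult_pos_pos divide_pos_pos) auto
        qed simp
        finally show ?case by (simp add: field_simps)
      qed
    qed
    then show ?thesis by (simp add: LIM_zero_iff)
  qed
  have zw: "\<forall>\<^sub>F m in sequentially. ?z (Suc m) = c m *s w m"
    using cne by eventually_elim (simp add: w_def vector_smult_assoc)
  have "(\<lambda>m. inverse (c m ^ E) *s a (c m *s w m)) \<longlonglongrightarrow> T v" by (rule map_top_limit[OF a(1) cinf wv])
  then have "(\<lambda>m. ln (norm (inverse (c m ^ E) *s a (c m *s w m)))) \<longlonglongrightarrow> ln (norm (T v))"
    using a(2) by (intro tendsto_ln tendsto_norm) auto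
  moreover have "(\<lambda>m. ln (norm (w m))) \<longlonglongrightarrow> ln (norm v)" using v by (intro tendsto_ln tendsto_norm wv) auto
  ultimately have diff: "(\<lambda>m. ln (norm (inverse (c m ^ E) *s a (c m *s w m))) - real E * ln (norm (w m))) \<longlonglongrightarrow> ln (norm (T v)) - real E * ln (norm v)"
    by (intro tendsto_diff tendsto_mult_left)
  have azinf: "filterlim (\<lambda>m. norm (a (?z (Suc m)))) at_top sequentially"
  proof -
    have "(\<lambda>m. norm (inverse (c m ^ E) *s a (c m *s w m))) \<longlonglongrightarrow> norm (T v)"
      by (intro tendsto_norm map_top_limit[OF a(1) cinf wv])
    moreover have "filterlim (\<lambda>m. norm (c m) ^ E) at_top sequentially"
      using E by (intro filterlim_pow_at_top filterlim_compose[OF filterlim_norm_at_top cinf]) auto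
    ultimately have "filterlim (\<lambda>m. norm (inverse (c m ^ E) *s a (c m *s w m)) * norm (c m) ^ E) at_top sequentially"
      using a(2) by (intro filterlim_tendsto_pos_mult_at_top) auto
    moreover have "\<forall>\<^sub>F m in sequentially. norm (inverse (c m ^ E) *s a (c m *s w m)) * norm (c m) ^ E \<le> norm (a (?z (Suc m)))"
      using zw cne
    proof eventually_elim
      case (elim m)
      have "inverse k * x * k = x" if "k \<noteq> 0" for k x :: real using that by simp
      from this[of "norm (c m) ^ E" "norm (a (c m *s w m))"]
      have "norm (inverse (c m ^ E) *s a (c m *s w m)) * norm (c m) ^ E = norm (a (c m *s w m))"
        unfolding norm_smult norm_inverse norm_power using elim(2) by simp
      then show ?case unfolding elim(1) by (rule eq_refl)
    qed
    ultimately show ?thesis by (rule filterlim_at_top_mono)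
  qed
  have abig: "\<forall>\<^sub>F m in sequentially. 1 < norm (a (?z (Suc m)))"
    using azinf by (simp add: filterlim_at_top_dense)
  have "(\<lambda>m. (ln (norm (inverse (c m ^ E) *s a (c m *s w m))) - real E * ln (norm (w m))) * inverse (real D ^ Suc m)) \<longlonglongrightarrow> (ln (norm (T v)) - real E * ln (norm v)) * 0"
  proof (intro tendsto_mult diff)
    have "(\<lambda>m. inverse (real D ^ m)) \<longlonglongrightarrow> 0" using Dinf by (rule tendsto_inverse_0_at_top)
    then show "(\<lambda>m. inverse (real D ^ Suc m)) \<longlonglongrightarrow> 0" by (rule LIMSEQ_Suc)
  qed
  then have "(\<lambda>m. (ln (norm (inverse (c m ^ E) *s a (c m *s w m))) - real E * ln (norm (w m))) * inverse (real D ^ Suc m)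
       + real E * (?x (Suc m) / real D ^ Suc m)) \<longlonglongrightarrow> (ln (norm (T v)) - real E * ln (norm v)) * 0 + real E * G"
    by (intro tendsto_add tendsto_mult_left G')
  moreover have "\<forall>\<^sub>F m in sequentially. (ln (norm (inverse (c m ^ E) *s a (c m *s w m))) - real E * ln (norm (w m))) * inverse (real D ^ Suc m)
       + real E * (?x (Suc m) / real D ^ Suc m) = log_plus (norm (a (?z (Suc m)))) / real D ^ Suc m"
    using zw cne big' abig
  proof eventually_elim
    case (elim m)
    have z: "norm (?z (Suc m)) = norm (c m) * norm (w m)" using elim(1) by (simp add: norm_smult)
    have pos: "norm (c m) > 0" "norm (w m) > 0" using elim(2,3) z by (auto simp: zero_less_mult_iff)
    have xs: "?x (Suc m) = ln (norm (c m)) + ln (norm (w m))"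
      using elim(3) pos unfolding z by (simp add: log_plus_eq_ln ln_mult)
    have na: "norm (a (?z (Suc m))) > 0" using elim(4) by linarith
    have "ln (norm (inverse (c m ^ E) *s a (c m *s w m))) = ln (norm (a (?z (Suc m))) / norm (c m) ^ E)"
      unfolding elim(1)[symmetric] by (simp add: norm_smult norm_inverse norm_power divide_inverse mult.commute)
    also have "\<dots> = ln (norm (a (?z (Suc m)))) - real E * ln (norm (c m))"
      using na pos by (simp add: ln_div ln_realpow)
    finally have L: "ln (norm (inverse (c m ^ E) *s a (c m *s w m))) = log_plus (norm (a (?z (Suc m)))) - real E * ln (norm (c m))"
      using elim(4) by (simp add: log_plus_eq_ln)
    show ?case unfolding xs L divide_inverse by algebra
  qed
  ultimately have "(\<lambda>m. log_plus (norm (a (?z (Suc m)))) / real D ^ Suc m) \<longlonglongrightarrow> (ln (norm (T v)) - real E * ln (norm v)) * 0 + real E * G"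
    by (rule Lim_transform_eventually)
  then have "(\<lambda>m. log_plus (norm (a (?z (Suc m)))) / real D ^ Suc m) \<longlonglongrightarrow> real E * G" by simp
  then show ?thesis by (rule LIMSEQ_imp_Suc)
qed

lemma dyn_degree_regular:
  assumes "poly_diffeo \<phi>" "poly_diffeo h" "f = inv \<phi> \<circ> (h \<circ> \<phi>)" "D \<ge> 2" "\<kappa> \<noteq> 0" "om v' v \<noteq> 0"
    "map_top D h (\<lambda>z. (\<kappa> * om v' z ^ D) *s v)"
  shows "dyn_degree f = real D"
proof (rule dyn_degree_conjugate[OF assms(1-3), of 1 D])
  have "poly_map_degree (h ^^ n) = D ^ n" for n
    using regular_iterate_degree[OF assms(7)] assms(4-6) by simp
  then show "D ^ n \<le> 1 * poly_map_degree (h ^^ n)" "poly_map_degree (h ^^ n) \<le> 1 * D ^ n" for n by simp_all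
qed (use assms(4) in auto)

text \<open>The escape rate exists as a limit everywhere, and it tends to zero at every point with bounded
  forward orbit. It equals a constant multiple of the escape rate of a regular conjugate, read in the
  coordinate \<open>\<phi>\<close>.\<close>

lemma green_function:
  assumes f: "poly_diffeo f" and dyn: "dyn_degree f > 1"
  shows "\<And>w. convergent (\<lambda>n. log_plus (norm ((f ^^ n) w)) / dyn_degree f ^ n)"
    and "\<And>y w. y \<longlonglongrightarrow> w \<Longrightarrow> w \<in> K_plus f \<Longrightarrow> (\<lambda>j. G_plus f (y j)) \<longlonglongrightarrow> 0"
    and "dyn_degree (inv f) > 1"
proof -
  obtain \<phi> h v v' \<kappa> \<kappa>' D D' where c: "poly_diffeo \<phi>" "poly_diffeo h" "f = inv \<phi> \<circ> (h \<circ> \<phi>)"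
    "D \<ge> 2" "D' \<ge> 2" "\<kappa> \<noteq> 0" "\<kappa>' \<noteq> 0" "om v' v \<noteq> 0"
    "map_top D h (\<lambda>z. (\<kappa> * om v' z ^ D) *s v)" "map_top D' (inv h) (\<lambda>z. (\<kappa>' * om v z ^ D') *s v')"
    by (rule regular_conjugate[OF f dyn]) (rule that)
  have bij: "bij \<phi>" "bij h" using c by (auto simp: poly_diffeo_def)
  have dD: "dyn_degree f = real D" by (rule dyn_degree_regular[OF c(1-4,6,8,9)])
  have om': "om v v' \<noteq> 0" using c(8) by (simp add: om_def algebra_simps)
  have "inv f = inv \<phi> \<circ> (inv h \<circ> \<phi>)"
    unfolding c(3) using c(1,2) bij
    by (simp add: poly_diffeo_compose poly_diffeo_inv inv_inv_eq o_assoc)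
  then have "dyn_degree (inv f) = real D'"
    by (rule dyn_degree_regular[OF c(1) poly_diffeo_inv[OF c(2)] _ c(5,7) om' c(10)])
  then show "dyn_degree (inv f) > 1" using c(5) by simp
  obtain k E T where E: "E > 0" "map_top E (inv \<phi> \<circ> (h ^^ k)) T" "T v \<noteq> 0"
    by (rule eventually_nondegenerate[OF c(1,2,10,5,7,8)]) (rule that)
  have v0: "v \<noteq> 0" using c(8) by (auto simp: om_simps)
  have hle: "map_le D h" by (rule map_top_imp_le[OF c(9)])
  obtain K where K: "K \<ge> 0"
    "\<And>z. decseq (\<lambda>m. (log_plus (norm ((h ^^ m) z)) + K) / real D ^ m)"
    "\<And>z. convergent (\<lambda>m. log_plus (norm ((h ^^ m) z)) / real D ^ m)"
    "\<And>z m. lim (\<lambda>m. log_plus (norm ((h ^^ m) z)) / real D ^ m) \<le> (log_plus (norm ((h ^^ m) z)) + K) / real D ^ m"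
    "\<And>z. (\<lambda>m. (log_plus (norm ((h ^^ m) z)) + K) / real D ^ m) \<longlonglongrightarrow> lim (\<lambda>m. log_plus (norm ((h ^^ m) z)) / real D ^ m)"
    by (rule escape_rate[OF hle c(4)]) (rule that)
  define Gh where "Gh z = lim (\<lambda>m. log_plus (norm ((h ^^ m) z)) / real D ^ m)" for z
  have Gh: "(\<lambda>m. log_plus (norm ((h ^^ m) z)) / real D ^ m) \<longlonglongrightarrow> Gh z" for z
    unfolding Gh_def using K(3) by (simp add: convergent_LIMSEQ_iff)
  define b where "b = real E / real D ^ k"
  have bpos: "b > 0" using E(1) c(4) by (simp add: b_def)
  have conv: "(\<lambda>n. log_plus (norm ((f ^^ n) w)) / dyn_degree f ^ n) \<longlonglongrightarrow> b * Gh (\<phi> w)" for w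
  proof -
    have "(\<lambda>m. log_plus (norm ((inv \<phi> \<circ> (h ^^ k)) ((h ^^ m) (\<phi> w)))) / real D ^ m * (1 / real D ^ k)) \<longlonglongrightarrow> real E * Gh (\<phi> w) * (1 / real D ^ k)"
      by (intro tendsto_mult_right escape_rate_image[OF c(9,4) v0 E(2,3,1) Gh])
    moreover have "log_plus (norm ((inv \<phi> \<circ> (h ^^ k)) ((h ^^ m) (\<phi> w)))) / real D ^ m * (1 / real D ^ k) =
       log_plus (norm ((f ^^ (m + k)) w)) / dyn_degree f ^ (m + k)" for m
      unfolding dD funpow_conjugate[OF bij(1) c(3)] by (simp add: funpow_add power_add add.commute[of m k])
    ultimately have "(\<lambda>m. log_plus (norm ((f ^^ (m + k)) w)) / dyn_degree f ^ (m + k)) \<longlonglongrightarrow> b * Gh (\<phi> w)"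
      by (simp add: b_def)
    then show ?thesis by (rule LIMSEQ_offset)
  qed
  then show "convergent (\<lambda>n. log_plus (norm ((f ^^ n) w)) / dyn_degree f ^ n)" for w
    using convergentI by blast
  have Gp: "G_plus f w = b * Gh (\<phi> w)" for w
    unfolding G_plus_def using conv by (rule limI)
  have Ghnn: "Gh z \<ge> 0" for z
    by (rule LIMSEQ_le_const[OF Gh]) (auto intro!: divide_nonneg_nonneg simp: log_plus_nonneg)
  fix y w assume y: "y \<longlonglongrightarrow> w" and w: "w \<in> K_plus f"
  have "G_plus f w = 0"
  proof -
    obtain B where B: "\<And>n. norm ((f ^^ n) w) \<le> B" using w unfolding K_plus_def bounded_iff by auto
    have dinf: "filterlim (\<lambda>m. real D ^ m) at_top sequentially"
      using c(4) by (intro realpow_at_top) simp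
    have Z: "(\<lambda>n. log_plus (norm ((f ^^ n) w)) / dyn_degree f ^ n) \<longlonglongrightarrow> 0"
    proof (rule Lim_null_comparison)
      show "(\<lambda>n. log_plus B * inverse (real D ^ n)) \<longlonglongrightarrow> 0"
        using tendsto_mult_left[OF tendsto_inverse_0_at_top[OF dinf], of "log_plus B"] by simp
      show "\<forall>\<^sub>F n in sequentially. norm (log_plus (norm ((f ^^ n) w)) / dyn_degree f ^ n) \<le> log_plus B * inverse (real D ^ n)"
        unfolding dD using B by (intro always_eventually allI)
          (auto simp: log_plus_nonneg divide_inverse intro!: mult_right_mono log_plus_mono)
    qed
    show ?thesis using LIMSEQ_unique[OF conv Z] Gp by simp
  qed
  then have G0: "Gh (\<phi> w) = 0" using bpos by (simp add: Gp)
  have \<phi>cont: "continuous_on UNIV \<phi>" using poly_diffeo_map_le(1)[OF c(1)] by (rule map_le_continuous)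
  have "(\<lambda>j. Gh (\<phi> (y j))) \<longlonglongrightarrow> 0"
  proof (rule order_tendstoI)
    fix e :: real assume "e < 0"
    then show "\<forall>\<^sub>F j in sequentially. e < Gh (\<phi> (y j))" using Ghnn by (intro always_eventually allI) (meson less_le_trans)
  next
    fix e :: real assume e: "0 < e"
    have "\<forall>\<^sub>F m in sequentially. (log_plus (norm ((h ^^ m) (\<phi> w))) + K) / real D ^ m < e"
      using K(5)[of "\<phi> w"] e G0 unfolding Gh_def[symmetric] by (auto dest: order_tendstoD)
    then obtain m where m: "(log_plus (norm ((h ^^ m) (\<phi> w))) + K) / real D ^ m < e"
      by (meson eventually_sequentially order_refl)
    have hm: "continuous_on UNIV (h ^^ m)" by (rule map_le_funpow_continuous[OF hle])
    have "continuous_on UNIV (\<lambda>x. log_plus (norm ((h ^^ m) (\<phi> x))))"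
      by (rule continuous_on_compose2[OF continuous_log_plus continuous_on_compose2[OF hm \<phi>cont]]) auto
    then have "(\<lambda>j. log_plus (norm ((h ^^ m) (\<phi> (y j))))) \<longlonglongrightarrow> log_plus (norm ((h ^^ m) (\<phi> w)))"
      using y continuous_on_tendsto_compose by fastforce
    then have "(\<lambda>j. (log_plus (norm ((h ^^ m) (\<phi> (y j)))) + K) / real D ^ m) \<longlonglongrightarrow> (log_plus (norm ((h ^^ m) (\<phi> w))) + K) / real D ^ m"
      using c(4) by (intro tendsto_intros) auto
    then have "\<forall>\<^sub>F j in sequentially. (log_plus (norm ((h ^^ m) (\<phi> (y j)))) + K) / real D ^ m < e"
      using m by (rule order_tendstoD(2))
    then show "\<forall>\<^sub>F j in sequentially. Gh (\<phi> (y j)) < e"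
      by eventually_elim (use K(4) Gh_def in \<open>auto intro: le_less_trans\<close>)
  qed
  then show "(\<lambda>j. G_plus f (y j)) \<longlonglongrightarrow> 0"
    unfolding Gp using tendsto_mult_left[of _ 0 sequentially b] by fastforce
qed

text \<open>The escape rate is multiplied by the dynamical degree under \<open>f\<close>.\<close>

lemma G_plus_scaling:
  assumes f: "poly_diffeo f" and dyn: "dyn_degree f > 1"
  shows "G_plus f ((f ^^ k) w) = dyn_degree f ^ k * G_plus f w"
proof -
  let ?d = "dyn_degree f"
  have "(\<lambda>n. log_plus (norm ((f ^^ n) w)) / ?d ^ n) \<longlonglongrightarrow> G_plus f w"
    unfolding G_plus_def using green_function(1)[OF f dyn] by (simp add: convergent_LIMSEQ_iff)
  then have "(\<lambda>n. ?d ^ k * (log_plus (norm ((f ^^ (n + k)) w)) / ?d ^ (n + k))) \<longlonglongrightarrow> ?d ^ k * G_plus f w"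
    by (intro tendsto_mult_left LIMSEQ_ignore_initial_segment)
  moreover have "?d ^ k * (log_plus (norm ((f ^^ (n + k)) w)) / ?d ^ (n + k)) = log_plus (norm ((f ^^ n) ((f ^^ k) w))) / ?d ^ n" for n
    using dyn by (simp add: funpow_add power_add)
  ultimately show ?thesis unfolding G_plus_def by (simp add: limI)
qed

section \<open>Injectively immersed curves and their limits\<close>

lemma entire_map_continuous:
  assumes "entire_map g"
  shows "continuous_on S g"
proof -
  have "continuous_on S (\<lambda>z. g z $ i)" for i
    using assms unfolding entire_map_def by (meson holomorphic_on_imp_continuous_on continuous_on_subset subset_UNIV)
  then show ?thesis using continuous_on_vec_lambda[of S "\<lambda>i z. g z $ i"] by (simp add: vec_lambda_eta)
qed

lemma nth_deriv_1: "nth_deriv 1 g z $ i = deriv (\<lambda>z. g z $ i) z"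
  by (simp add: nth_deriv_def)

lemma entire_map_has_derivative:
  assumes "entire_map g"
  shows "(g has_derivative (\<lambda>h. h *s nth_deriv 1 g z)) (at z)"
proof -
  have d: "((\<lambda>z. g z $ i) has_derivative (\<lambda>h. nth_deriv 1 g z $ i * h)) (at z)" for i
    using assms holomorphic_derivI[of "\<lambda>z. g z $ i" UNIV z]
    unfolding entire_map_def has_field_derivative_def nth_deriv_1 by auto
  have "((\<lambda>z. pair2 (g z $ 1) (g z $ 2)) has_derivative (\<lambda>h. pair2 (nth_deriv 1 g z $ 1 * h) (nth_deriv 1 g z $ 2 * h))) (at z)"
    by (intro has_derivative_pair2 d)
  moreover have "(\<lambda>h. pair2 (nth_deriv 1 g z $ 1 * h) (nth_deriv 1 g z $ 2 * h)) = (\<lambda>h. h *s nth_deriv 1 g z)"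
    by (auto simp: pair2_eq_iff fun_eq_iff)
  ultimately show ?thesis by (simp add: pair2_eta)
qed

lemma nth_deriv_1_eqI:
  assumes "(g has_derivative (\<lambda>h. h *s v)) (at z)"
  shows "nth_deriv 1 g z = v"
proof -
  have "((\<lambda>z. g z $ i) has_field_derivative v $ i) (at z)" for i
  proof -
    have "(\<lambda>h. (h *s v) $ i) = (*) (v $ i)" by (auto simp: mult.commute)
    then show ?thesis using bounded_linear.has_derivative[OF bounded_linear_vec_nth assms, of i]
      by (simp only: has_field_derivative_def)
  qed
  then show ?thesis unfolding vec_eq_iff nth_deriv_1 using DERIV_imp_deriv by blast
qed

text \<open>A nonempty countable closed set of complex numbers has an isolated point.\<close>

lemma countable_closed_isolated:
  fixes T :: "complex set"
  assumes "closed T" "countable T" "T \<noteq> {}"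
  obtains s e where "s \<in> T" "e > 0" "ball s e \<inter> T = {s}"
proof -
  have "\<exists>s\<in>T. \<exists>e>0. ball s e \<inter> T = {s}"
  proof (rule ccontr)
    assume neg: "\<not> ?thesis"
    have "T \<subseteq> closure (\<Inter>((\<lambda>t. T - {t}) ` T))"
    proof (rule Baire)
      fix U assume "U \<in> (\<lambda>t. T - {t}) ` T"
      then obtain t where t: "t \<in> T" "U = T - {t}" by blast
      have "x \<in> closure U" if "x \<in> T" for x
      proof (cases "x = t")
        case False then show ?thesis using that t closure_subset[of U] by auto
      next
        case True
        show ?thesis unfolding closure_approachable
        proof (intro allI impI)
          fix e :: real assume "e > 0"
          then have "ball t e \<inter> T \<noteq> {t}" using neg t by blast
          moreover have "t \<in> ball t e \<inter> T" using t \<open>e > 0\<close> by simp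
          ultimately obtain u where "u \<in> ball t e" "u \<in> T" "u \<noteq> t" by blast
          then show "\<exists>y\<in>U. dist y x < e" using t True by (auto simp: dist_commute)
        qed
      qed
      moreover have "openin (top_of_set T) U" unfolding t(2)
        by (simp add: openin_delete)
      ultimately show "openin (top_of_set T) U \<and> T \<subseteq> closure U" by blast
    qed (use assms in auto)
    moreover have "\<Inter>((\<lambda>t. T - {t}) ` T) = {}" using assms(3) by auto
    ultimately show False using assms(3) by simp
  qed
  then show ?thesis using that by blast
qed

lemma countable_isolated_points:
  fixes \<Gamma> :: "'a :: second_countable_topology set"
  shows "countable {p \<in> \<Gamma>. \<exists>U. open U \<and> U \<inter> \<Gamma> = {p}}"
proof -
  obtain B :: "'a set set" where B: "countable B" "topological_basis B" using ex_countable_basis by blast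
  define I where "I = {p \<in> \<Gamma>. \<exists>U. open U \<and> U \<inter> \<Gamma> = {p}}"
  have "\<exists>V. V \<in> B \<and> V \<inter> \<Gamma> = {p}" if p: "p \<in> I" for p
  proof -
    obtain U where U: "open U" "U \<inter> \<Gamma> = {p}" using p unfolding I_def by blast
    then have "p \<in> U" by blast
    then obtain V where "V \<in> B" "p \<in> V" "V \<subseteq> U" using topological_basisE[OF B(2) U(1)] by blast
    then show ?thesis using U(2) by (intro exI[of _ V]) auto
  qed
  then have "\<forall>p\<in>I. \<exists>V. V \<in> B \<and> V \<inter> \<Gamma> = {p}" by blast
  from bchoice[OF this] obtain V where V: "\<And>p. p \<in> I \<Longrightarrow> V p \<in> B \<and> V p \<inter> \<Gamma> = {p}" by blast
  have "inj_on V I" by (rule inj_onI) (metis V singleton_inject)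
  moreover have "countable (V ` I)" by (rule countable_subset[OF _ B(1)]) (use V in blast)
  ultimately show ?thesis using countable_image_inj_on I_def by blast
qed

lemma inj_hol_immersionD:
  assumes "inj_hol_immersion g"
  shows "entire_map g" "inj g" "nth_deriv 1 g z \<noteq> 0"
  using assms by (auto simp: inj_hol_immersion_def)

text \<open>Near a parameter at which the graph of the reparametrization is not isolated, the
  reparametrization is holomorphic.\<close>

lemma reparametrization_local:
  assumes h1: "inj_hol_immersion h1" and h2: "inj_hol_immersion h2" and B: "\<And>w. h1 (B w) = h2 w"
    and acc: "\<And>e. e > 0 \<Longrightarrow> \<exists>w. w \<noteq> w0 \<and> dist w w0 < e \<and> dist (B w) (B w0) < e"
  shows "\<exists>r>0. B holomorphic_on ball w0 r"
proof -
  note h1D = inj_hol_immersionD[OF h1] and h2D = inj_hol_immersionD[OF h2]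
  have hol1: "(\<lambda>z. h1 z $ i) holomorphic_on UNIV" and hol2: "(\<lambda>z. h2 z $ i) holomorphic_on UNIV" for i
    using h1D h2D by (auto simp: entire_map_def)
  obtain i where i: "deriv (\<lambda>z. h1 z $ i) (B w0) \<noteq> 0"
    using h1D(3)[of "B w0"] by (metis nth_deriv_1 vec_eq_iff zero_index)
  define F where "F = (\<lambda>z. h1 z $ i)"
  obtain r where r: "r > 0" "open (F ` ball (B w0) r)" "inj_on F (ball (B w0) r)"
    using has_complex_derivative_locally_invertible[OF hol1[of i] UNIV_I open_UNIV i] unfolding F_def by metis
  have Fhol: "F holomorphic_on ball (B w0) r" unfolding F_def using hol1 holomorphic_on_subset by blast
  obtain g where g: "g holomorphic_on (F ` ball (B w0) r)" "\<And>z. z \<in> ball (B w0) r \<Longrightarrow> g (F z) = z"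
    using holomorphic_has_inverse[OF Fhol open_ball r(3)] by metis
  have "F (B w0) \<in> F ` ball (B w0) r" using r(1) by simp
  then have w0: "w0 \<in> (\<lambda>w. h2 w $ i) -` (F ` ball (B w0) r)" unfolding F_def by (simp add: B)
  have "open ((\<lambda>w. h2 w $ i) -` (F ` ball (B w0) r))"
    using r(2) holomorphic_on_imp_continuous_on[OF hol2[of i]] by (rule open_vimage)
  then obtain s where s': "s > 0" "ball w0 s \<subseteq> (\<lambda>w. h2 w $ i) -` (F ` ball (B w0) r)"
    using w0 by (rule openE)
  have s: "s > 0" "\<And>w. w \<in> ball w0 s \<Longrightarrow> h2 w $ i \<in> F ` ball (B w0) r"
    using s'(1) subsetD[OF s'(2)] by (simp_all only: vimage_eq)
  define b where "b = (\<lambda>w. g (h2 w $ i))"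
  have bhol: "b holomorphic_on ball w0 s"
  proof -
    have "(g \<circ> (\<lambda>w. h2 w $ i)) holomorphic_on ball w0 s"
      using s(2) by (intro holomorphic_on_compose_gen[OF _ g(1)]) (auto intro: holomorphic_on_subset[OF hol2])
    then show ?thesis by (simp add: b_def o_def)
  qed
  have bB: "b w = B w" if "dist (B w) (B w0) < r" for w
  proof -
    have "B w \<in> ball (B w0) r" using that by (simp add: dist_commute)
    then show ?thesis using g(2)[of "B w"] by (simp add: b_def F_def B)
  qed
  define U where "U = {w \<in> ball w0 s. dist (B w) (B w0) < r}"
  have lim: "w0 islimpt U"
    unfolding islimpt_approachable
  proof (intro allI impI)
    fix e :: real assume "e > 0"
    then obtain w where w: "w \<noteq> w0" "dist w w0 < min e (min r s)" "dist (B w) (B w0) < min e (min r s)"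
      using acc[of "min e (min r s)"] r(1) s(1) by auto
    then show "\<exists>w'\<in>U. w' \<noteq> w0 \<and> dist w' w0 < e"
      by (intro bexI[of _ w]) (auto simp: U_def dist_commute)
  qed
  have hb: "h1 (b w) $ j = h2 w $ j" if w: "w \<in> ball w0 s" for w j
  proof -
    have "h1 (b w) $ j - h2 w $ j = 0"
    proof (rule analytic_continuation[of "\<lambda>w. h1 (b w) $ j - h2 w $ j" "ball w0 s" U w0])
      have "((\<lambda>z. h1 z $ j) \<circ> b) holomorphic_on ball w0 s"
        by (rule holomorphic_on_compose_gen[OF bhol hol1]) auto
      then show "(\<lambda>w. h1 (b w) $ j - h2 w $ j) holomorphic_on ball w0 s"
        by (intro holomorphic_on_diff) (auto simp: o_def intro: holomorphic_on_subset[OF hol2])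
      show "h1 (b w) $ j - h2 w $ j = 0" if "w \<in> U" for w
        using that bB[of w] by (simp add: U_def B)
    qed (use s(1) w lim in \<open>auto simp: U_def\<close>)
    then show ?thesis by simp
  qed
  have "B w = b w" if "w \<in> ball w0 s" for w
  proof -
    have "h1 (B w) = h1 (b w)" using hb[OF that] by (simp add: B vec_eq_iff)
    then show ?thesis using h1D(2) by (simp add: inj_eq)
  qed
  then have "B holomorphic_on ball w0 s" using bhol by (metis holomorphic_transform)
  then show ?thesis using s(1) by blast
qed

text \<open>Two injective immersions of the plane with the same image differ by a holomorphic change of
  parameter, although neither need be an embedding. The exceptional parameters, at which the graph
  of \<open>B\<close> has an isolated point, form a countable closed set. At an isolated point of that set
  \<open>B\<close> would have a pole, so \<open>h1\<close> would be bounded near infinity.\<close>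

lemma reparametrization_holomorphic:
  assumes h1: "inj_hol_immersion h1" and h2: "inj_hol_immersion h2" and B: "\<And>w. h1 (B w) = h2 w"
  shows "B holomorphic_on UNIV"
proof -
  note h1D = inj_hol_immersionD[OF h1] and h2D = inj_hol_immersionD[OF h2]
  have injB: "inj B" using h2D(2) B by (metis injD injI)
  \<comment> \<open>the parameters \<open>w\<close> for which \<open>(w, B w)\<close> is not isolated in the graph of \<open>B\<close>\<close>
  define N where "N = {w0. \<forall>e>0. \<exists>w. w \<noteq> w0 \<and> dist w w0 < e \<and> dist (B w) (B w0) < e}"
  define T where "T = - N"
  have loc: "\<exists>r>0. B holomorphic_on ball w0 r" if "w0 \<in> N" for w0
    using that unfolding N_def by (intro reparametrization_local[OF h1 h2 B]) auto
  have holN: "w \<in> N" if "B holomorphic_on ball w0 r" "w \<in> ball w0 r" for w w0 r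
    unfolding N_def
  proof (intro CollectI allI impI)
    fix e :: real assume e: "e > 0"
    have "isCont B w" using that holomorphic_on_imp_continuous_on continuous_on_eq_continuous_at by blast
    then obtain d where d: "d > 0" "\<And>x. dist x w < d \<Longrightarrow> dist (B x) (B w) < e"
      using e unfolding continuous_at_eps_delta by blast
    let ?x = "w + of_real (min d e / 2)"
    have "dist ?x w = min d e / 2" using d(1) e by (simp add: dist_norm)
    then have "?x \<noteq> w" "dist ?x w < e" "dist ?x w < d" using d(1) e by auto
    then show "\<exists>x. x \<noteq> w \<and> dist x w < e \<and> dist (B x) (B w) < e" using d(2) by blast
  qed
  have "open N" unfolding open_contains_ball using loc holN by blast
  then have clT: "closed T" by (simp add: T_def closed_def)
  have cntT: "countable T"
  proof -
    let ?\<Gamma> = "range (\<lambda>w. (w, B w))"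
    let ?I = "{p \<in> ?\<Gamma>. \<exists>U. open U \<and> U \<inter> ?\<Gamma> = {p}}"
    have inI: "(w, B w) \<in> ?I" if "w \<in> T" for w
    proof -
      have "\<not> (\<forall>e>0. \<exists>x. x \<noteq> w \<and> dist x w < e \<and> dist (B x) (B w) < e)"
        using that by (simp add: T_def N_def)
      then obtain e where "e > 0" "\<not> (\<exists>x. x \<noteq> w \<and> dist x w < e \<and> dist (B x) (B w) < e)" by blast
      then have e: "e > 0" "\<And>x. x \<noteq> w \<Longrightarrow> dist x w < e \<Longrightarrow> \<not> dist (B x) (B w) < e" by auto
      have "(ball w e \<times> ball (B w) e) \<inter> ?\<Gamma> = {(w, B w)}"
      proof -
        have "B x = B w \<and> x = w" if "dist w x < e" "dist (B w) (B x) < e" for x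
          using e(2)[of x] that by (cases "x = w") (auto simp: dist_commute)
        then show ?thesis using e(1) by auto
      qed
      then show ?thesis by (auto intro!: exI[of _ "ball w e \<times> ball (B w) e"] open_Times)
    qed
    have "T \<subseteq> fst ` ?I"
    proof
      fix w assume "w \<in> T"
      then have "fst (w, B w) \<in> fst ` ?I" by (intro imageI inI)
      then show "w \<in> fst ` ?I" by (simp only: fst_conv)
    qed
    then show ?thesis by (rule countable_subset[OF _ countable_image[OF countable_isolated_points]])
  qed
  have "T = {}"
  proof (rule ccontr)
    assume "T \<noteq> {}"
    then obtain s e where s: "s \<in> T" "e > 0" "ball s e \<inter> T = {s}"
      using countable_closed_isolated[OF clT cntT] by metis
    \<comment> \<open>a sequence tending to \<open>s\<close> with bounded images would put \<open>s\<close> into \<open>N\<close>\<close>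
    have pole: "\<exists>d>0. \<forall>w. w \<noteq> s \<longrightarrow> dist w s < d \<longrightarrow> M < norm (B w)" for M
    proof (rule ccontr)
      assume neg: "\<not> ?thesis"
      have "\<exists>w. w \<noteq> s \<and> dist w s < inverse (real (Suc n)) \<and> norm (B w) \<le> M" for n
      proof -
        have "inverse (real (Suc n)) > 0" by simp
        then show ?thesis using neg by (metis linorder_not_less)
      qed
      then have "\<forall>n. \<exists>w. w \<noteq> s \<and> dist w s < inverse (real (Suc n)) \<and> norm (B w) \<le> M" by blast
      from choice[OF this] obtain x where x: "\<And>n. x n \<noteq> s" "\<And>n. dist (x n) s < inverse (real (Suc n))" "\<And>n. norm (B (x n)) \<le> M"
        by blast
      have xs: "x \<longlonglongrightarrow> s"
      proof (rule tendstoI)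
        fix d :: real assume "d > 0"
        then have "\<forall>\<^sub>F n in sequentially. inverse (real (Suc n)) < d"
          using LIMSEQ_inverse_real_of_nat by (rule order_tendstoD(2)[rotated])
        then show "\<forall>\<^sub>F n in sequentially. dist (x n) s < d" by eventually_elim (use x(2) less_trans in blast)
      qed
      have "bounded (range (\<lambda>n. B (x n)))" unfolding bounded_iff using x(3) by auto
      then obtain l r where r: "strict_mono (r :: nat \<Rightarrow> nat)" "((\<lambda>n. B (x n)) \<circ> r) \<longlonglongrightarrow> l"
        using bounded_imp_convergent_subsequence by blast
      have c1: "isCont h1 l" "isCont h2 s" using entire_map_continuous[OF h1D(1), of UNIV] entire_map_continuous[OF h2D(1), of UNIV]
        by (auto simp: continuous_on_eq_continuous_at)
      have "(\<lambda>n. h1 (((\<lambda>n. B (x n)) \<circ> r) n)) \<longlonglongrightarrow> h1 l" by (rule isCont_tendsto_compose[OF c1(1) r(2)])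
      moreover have xr: "(x \<circ> r) \<longlonglongrightarrow> s" by (rule LIMSEQ_subseq_LIMSEQ[OF xs r(1)])
      have "(\<lambda>n. h2 ((x \<circ> r) n)) \<longlonglongrightarrow> h2 s" by (rule isCont_tendsto_compose[OF c1(2) xr])
      ultimately have "h1 l = h2 s" by (simp add: B o_def LIMSEQ_unique)
      then have l: "l = B s" using h1D(2) by (metis B injD)
      have "s \<in> N" unfolding N_def
      proof (intro CollectI allI impI)
        fix d :: real assume d: "d > 0"
        have "\<forall>\<^sub>F n in sequentially. dist ((x \<circ> r) n) s < d \<and> dist (((\<lambda>n. B (x n)) \<circ> r) n) (B s) < d"
          using xr r(2) d unfolding l by (intro eventually_conj) (auto dest: tendstoD)
        then obtain n where "dist (x (r n)) s < d" "dist (B (x (r n))) (B s) < d"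
          unfolding eventually_sequentially by auto
        then show "\<exists>w. w \<noteq> s \<and> dist w s < d \<and> dist (B w) (B s) < d" using x(1) by blast
      qed
      then show False using s(1) by (simp add: T_def)
    qed
    obtain d where d: "d > 0" "\<And>w. w \<noteq> s \<Longrightarrow> dist w s < d \<Longrightarrow> 1 < norm (B w)" using pole[of 1] by blast
    define e' where "e' = min d e"
    have e': "e' > 0" using d s by (simp add: e'_def)
    \<comment> \<open>\<open>1 / B\<close> extends holomorphically to \<open>s\<close>, so by the open mapping theorem \<open>B\<close> takes all large values near \<open>s\<close>\<close>
    define k where "k w = (if w = s then 0 else inverse (B w))" for w
    have khol: "k holomorphic_on ball s e'"
    proof (rule no_isolated_singularity)
      have "k field_differentiable (at w)" if w: "w \<in> ball s e' - {s}" for w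
      proof -
        have "w \<in> ball s e" "w \<noteq> s" using w by (simp_all add: e'_def)
        then have "w \<notin> T" using s(3) by (metis IntI singletonD)
        then have "w \<in> N" by (simp add: T_def)
        then obtain r where r: "r > 0" "B holomorphic_on ball w r" using loc by blast
        have "B field_differentiable (at w)"
          using r holomorphic_on_imp_differentiable_at[of B "ball w r" w] by simp
        moreover have "B w \<noteq> 0" using d(2)[of w] w by (auto simp: e'_def dist_commute)
        ultimately have "(\<lambda>w. inverse (B w)) field_differentiable (at w)" by (rule field_differentiable_inverse)
        then obtain D where D: "((\<lambda>w. inverse (B w)) has_field_derivative D) (at w)"
          unfolding field_differentiable_def by blast
        have "(k has_field_derivative D) (at w)"
          by (rule has_field_derivative_transform_within_open[OF D, of "- {s}"]) (use w in \<open>auto simp: k_def\<close>)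
        then show ?thesis unfolding field_differentiable_def by blast
      qed
      then show hol': "k holomorphic_on ball s e' - {s}"
        by (meson field_differentiable_at_within holomorphic_on_def)
      show "continuous_on (ball s e') k"
        unfolding continuous_on_eq_continuous_at[OF open_ball]
      proof
        fix w assume w: "w \<in> ball s e'"
        show "isCont k w"
        proof (cases "w = s")
          case False
          have "open (ball s e' - {s})" by (intro open_Diff) auto
          then show ?thesis
            using hol' holomorphic_on_imp_continuous_on[of k "ball s e' - {s}"] w False by (auto simp: continuous_on_eq_continuous_at)
        next
          case True
          show ?thesis unfolding True continuous_at_eps_delta
          proof (intro allI impI)
            fix \<epsilon> :: real assume \<epsilon>: "\<epsilon> > 0"
            obtain d' where d': "d' > 0" "\<And>w. w \<noteq> s \<Longrightarrow> dist w s < d' \<Longrightarrow> inverse \<epsilon> < norm (B w)"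
              using pole[of "inverse \<epsilon>"] by blast
            have "dist (k x) (k s) < \<epsilon>" if "dist x s < d'" for x
            proof (cases "x = s")
              case False
              have "inverse (norm (B x)) < inverse (inverse \<epsilon>)"
                using d'(2)[OF False that] \<epsilon> by (intro less_imp_inverse_less) auto
              then show ?thesis using False by (simp add: k_def norm_inverse)
            qed (use \<epsilon> in simp)
            then show "\<exists>d>0. \<forall>x. dist x s < d \<longrightarrow> dist (k x) (k s) < \<epsilon>" using d'(1) by blast
          qed
        qed
      qed
    qed auto
    have "\<not> k constant_on ball s e'"
    proof
      assume "k constant_on ball s e'"
      then obtain c where c: "\<And>w. w \<in> ball s e' \<Longrightarrow> k w = c" unfolding constant_on_def by blast
      let ?w = "s + of_real (e' / 2)"
      have w: "dist ?w s = e' / 2" using e' by (simp add: dist_norm)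
      then have "?w \<noteq> s" "?w \<in> ball s e'" using e' by (auto simp: dist_commute)
      moreover have "norm (B ?w) > 1" using d(2)[of ?w] w e' by (auto simp: e'_def)
      ultimately have "k ?w \<noteq> 0" by (auto simp: k_def)
      moreover have "k s = 0" by (simp add: k_def)
      ultimately show False using c[of s] c[of ?w] e' \<open>?w \<in> ball s e'\<close> by simp
    qed
    then have "open (k ` ball s e')" using open_mapping_thm[OF khol] by auto
    moreover have "0 \<in> k ` ball s e'" using e' by (auto simp: k_def image_iff intro!: bexI[of _ s])
    ultimately obtain \<rho> where \<rho>: "\<rho> > 0" "ball 0 \<rho> \<subseteq> k ` ball s e'" by (metis open_contains_ball)
    have cover: "h1 b \<in> h2 ` cball s e' \<union> h1 ` cball 0 (inverse \<rho>)" for b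
    proof (cases "norm b \<le> inverse \<rho>")
      case False
      then have b: "inverse \<rho> < norm b" "b \<noteq> 0" using \<rho>(1) by (auto simp: not_le)
      have "inverse (norm b) < inverse (inverse \<rho>)" using b \<rho>(1) by (intro less_imp_inverse_less) auto
      then have "inverse b \<in> ball 0 \<rho>" by (simp add: norm_inverse)
      then obtain w where w: "w \<in> ball s e'" "inverse b = k w" using \<rho>(2) by blast
      then have "w \<noteq> s" using b by (auto simp: k_def)
      then have "b = B w" using w(2) by (metis k_def inverse_inverse_eq)
      then show ?thesis using w(1) B by (metis UnI1 ball_subset_cball imageI subsetD)
    qed auto
    have cmp: "compact (h2 ` cball s e' \<union> h1 ` cball 0 (inverse \<rho>))"
      by (intro compact_Un compact_continuous_image entire_map_continuous h1D h2D compact_cball)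
    have "bounded (range h1)"
      by (rule bounded_subset[OF compact_imp_bounded[OF cmp]]) (rule image_subsetI, rule cover)
    then obtain M where M: "\<And>b. norm (h1 b) \<le> M" unfolding bounded_iff by blast
    have "(\<lambda>z. h1 z $ i) constant_on UNIV" for i
    proof (rule Liouville_theorem)
      show "(\<lambda>z. h1 z $ i) holomorphic_on UNIV" using h1D(1) by (simp add: entire_map_def)
      show "bounded (range (\<lambda>z. h1 z $ i))"
        unfolding bounded_iff using M by (auto intro: order_trans[OF Finite_Cartesian_Product.norm_nth_le])
    qed
    then have "h1 0 $ i = h1 1 $ i" for i unfolding constant_on_def by (metis UNIV_I)
    then have "h1 0 = h1 1" by (simp add: vec_eq_iff)
    then show False using h1D(2) by (auto dest: injD)
  qed
  then have "N = UNIV" unfolding T_def by (metis double_complement Compl_empty_eq)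
  then have "B field_differentiable (at w)" for w
    using loc[of w] holomorphic_on_imp_differentiable_at[OF _ open_ball] by fastforce
  then show ?thesis by (simp add: holomorphic_on_def field_differentiable_at_within)
qed

text \<open>The change of parameter is a biholomorphic map of the plane, hence affine.\<close>

lemma reparametrization_affine:
  assumes h1: "inj_hol_immersion h1" and h2: "inj_hol_immersion h2" and ran: "range h1 = range h2"
  obtains a b where "b \<noteq> 0" "\<And>w. h2 w = h1 (a + b * w)"
proof -
  note h1D = inj_hol_immersionD[OF h1] and h2D = inj_hol_immersionD[OF h2]
  have "\<forall>w. \<exists>z. h1 z = h2 w" using ran by (metis imageE rangeI)
  then obtain B where B: "\<And>w. h1 (B w) = h2 w" by metis
  have "\<forall>z. \<exists>w. h2 w = h1 z" using ran by (metis imageE rangeI)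
  then obtain C where C: "\<And>z. h2 (C z) = h1 z" by metis
  have Bhol: "B holomorphic_on UNIV" by (rule reparametrization_holomorphic[OF h1 h2 B])
  have Chol: "C holomorphic_on UNIV" by (rule reparametrization_holomorphic[OF h2 h1 C])
  have BC: "B (C z) = z" "C (B z) = z" for z using B C h1D(2) h2D(2) by (metis injD)+
  have injB: "inj B" using BC by (metis injI)
  \<comment> \<open>\<open>B\<close> is proper, hence a polynomial; being injective it has no critical point\<close>
  have "compact {z. B z \<in> K}" if "compact K" for K
  proof -
    have "{z. B z \<in> K} = C ` K"
    proof (intro set_eqI iffI)
      fix z assume "z \<in> {z. B z \<in> K}"
      then show "z \<in> C ` K" using BC(2)[of z] by (metis imageI mem_Collect_eq)
    qed (auto simp: BC)
    moreover have "compact (C ` K)"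
      using that Chol holomorphic_on_imp_continuous_on continuous_on_subset by (intro compact_continuous_image) blast+
    ultimately show ?thesis by simp
  qed
  then obtain c n where cn: "0 < n" "c n \<noteq> 0" "B = (\<lambda>z. \<Sum>i\<le>n. c i * z ^ i)"
    using proper_map_polyfun_eq[OF Bhol] by blast
  define p where "p = (\<Sum>i\<le>n. monom (c i) i)"
  have p: "B = poly p" by (auto simp: cn(3) p_def poly_sum poly_monom)
  have "poly (pderiv p) z \<noteq> 0" for z
  proof -
    have "deriv B z \<noteq> 0" using holomorphic_injective_imp_regular[OF Bhol open_UNIV injB] by simp
    then show ?thesis using DERIV_imp_deriv[OF poly_DERIV[of p z]] by (simp add: p)
  qed
  then have "constant (poly (pderiv p))" using fundamental_theorem_of_algebra by blast
  then have "degree (pderiv p) = 0" by (simp add: constant_degree)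
  then have "degree p \<le> 1" by (simp add: degree_pderiv)
  then have pl: "p = [:coeff p 0, coeff p 1:]"
    by (intro poly_eqI) (auto simp: coeff_pCons coeff_eq_0 split: nat.split)
  have Bl: "B w = coeff p 0 + coeff p 1 * w" for w
    unfolding p by (subst pl) (simp add: mult.commute)
  have c1: "coeff p 1 \<noteq> 0"
  proof
    assume "coeff p 1 = 0"
    then have "B 0 = B 1" using Bl[of 0] Bl[of 1] by simp
    then show False using injD[OF injB, of 0 1] by simp
  qed
  show ?thesis by (rule that[OF c1, of "coeff p 0"]) (rule B[unfolded Bl, symmetric])
qed

lemma loc_unif_limit_component:
  assumes "loc_unif_limit G g" "compact C"
  shows "uniform_limit C (\<lambda>n z. G n z $ i) (\<lambda>z. g z $ i) sequentially"
  using bounded_linear.uniform_limit[OF bounded_linear_vec_nth] assms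
  unfolding loc_unif_limit_def by blast

lemma entire_map_limit:
  assumes "loc_unif_limit G g" "\<And>n. entire_map (G n)"
  shows "entire_map g"
  unfolding entire_map_def
proof
  fix i
  show "(\<lambda>z. g z $ i) holomorphic_on UNIV"
  proof (rule holomorphic_uniform_sequence[of UNIV "\<lambda>n z. G n z $ i"])
    show "(\<lambda>z. G n z $ i) holomorphic_on UNIV" for n using assms(2) by (simp add: entire_map_def)
    show "\<exists>d>0. cball x d \<subseteq> UNIV \<and> uniform_limit (cball x d) (\<lambda>n z. G n z $ i) (\<lambda>z. g z $ i) sequentially" for x
      using loc_unif_limit_component[OF assms(1), of "cball x 1"] by (intro exI[of _ 1]) auto
  qed auto
qed

lemma loc_unif_limit_subseq:
  assumes "loc_unif_limit G g" "filterlim m at_top sequentially"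
  shows "loc_unif_limit (\<lambda>k. G (m k)) g"
  using assms filterlim_compose unfolding loc_unif_limit_def by fast

lemma loc_unif_limit_pointwise:
  assumes G: "loc_unif_limit G g" and ent: "\<And>n. entire_map (G n)" and s: "s \<longlonglongrightarrow> s0"
  shows "(\<lambda>k. G k (s k)) \<longlonglongrightarrow> g s0"
proof -
  have g: "isCont g s0" using entire_map_continuous[OF entire_map_limit[OF G ent], of UNIV]
    by (simp add: continuous_on_eq_continuous_at)
  obtain R where R: "\<And>k. norm (s k) \<le> R" using convergent_imp_bounded[OF s] unfolding bounded_iff by auto
  have u: "uniform_limit (cball 0 R) G g sequentially" using G by (simp add: loc_unif_limit_def)
  have "(\<lambda>k. G k (s k) - g (s k)) \<longlonglongrightarrow> 0"
  proof (rule tendstoI)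
    fix e :: real assume "e > 0"
    with u have "\<forall>\<^sub>F n in sequentially. \<forall>x\<in>cball 0 R. dist (G n x) (g x) < e" by (rule uniform_limitD)
    then show "\<forall>\<^sub>F k in sequentially. dist (G k (s k) - g (s k)) 0 < e"
      by eventually_elim (use R in \<open>simp add: dist_norm\<close>)
  qed
  moreover have "(\<lambda>k. g (s k)) \<longlonglongrightarrow> g s0" by (rule isCont_tendsto_compose[OF g s])
  ultimately have "(\<lambda>k. (G k (s k) - g (s k)) + g (s k)) \<longlonglongrightarrow> 0 + g s0" by (rule tendsto_add)
  then show ?thesis by simp
qed

text \<open>Locally uniform convergence of entire maps gives convergence of the derivatives, also at
  converging parameters.\<close>

lemma nth_deriv_limit:
  assumes G: "loc_unif_limit G g" and ent: "\<And>n. entire_map (G n)" and s: "s \<longlonglongrightarrow> s0"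
  shows "(\<lambda>k. nth_deriv 1 (G k) (s k)) \<longlonglongrightarrow> nth_deriv 1 g s0"
proof (rule vec_tendstoI)
  fix i
  have gent: "entire_map g" by (rule entire_map_limit[OF G ent])
  have gh: "(\<lambda>z. g z $ i) holomorphic_on UNIV" and Gh: "(\<lambda>z. G n z $ i) holomorphic_on UNIV" for n
    using gent ent by (auto simp: entire_map_def)
  obtain R where R: "\<And>k. norm (s k) \<le> R" using convergent_imp_bounded[OF s] unfolding bounded_iff by auto
  have u: "uniform_limit (cball 0 (R + 1)) (\<lambda>n z. G n z $ i) (\<lambda>z. g z $ i) sequentially"
    by (rule loc_unif_limit_component[OF G]) simp
  have "(\<lambda>k. deriv (\<lambda>z. G k z $ i) (s k) - deriv (\<lambda>z. g z $ i) (s k)) \<longlonglongrightarrow> 0"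
  proof (rule tendstoI)
    fix e :: real assume e: "e > 0"
    then have "\<forall>\<^sub>F n in sequentially. \<forall>x\<in>cball 0 (R + 1). dist (G n x $ i) (g x $ i) < e / 2"
      using uniform_limitD[OF u, of "e / 2"] by simp
    then show "\<forall>\<^sub>F k in sequentially. dist (deriv (\<lambda>z. G k z $ i) (s k) - deriv (\<lambda>z. g z $ i) (s k)) 0 < e"
    proof eventually_elim
      case (elim k)
      let ?f = "\<lambda>z. G k z $ i - g z $ i"
      have fh: "?f holomorphic_on UNIV" by (intro holomorphic_on_diff gh Gh)
      have "norm ((deriv ^^ 1) ?f (s k)) \<le> fact 1 * (e / 2) / 1 ^ 1"
      proof (rule Cauchy_inequality)
        show "?f holomorphic_on ball (s k) 1" using fh holomorphic_on_subset by blast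
        show "continuous_on (cball (s k) 1) ?f"
          using fh holomorphic_on_imp_continuous_on continuous_on_subset by blast
        show "norm (?f x) \<le> e / 2" if "norm (s k - x) = 1" for x
        proof -
          have "norm x \<le> R + 1" using R[of k] that norm_triangle_ineq2[of x "s k"] by (simp add: norm_minus_commute)
          then show ?thesis using elim by (auto simp: dist_norm intro: less_imp_le)
        qed
      qed simp
      moreover have "deriv ?f (s k) = deriv (\<lambda>z. G k z $ i) (s k) - deriv (\<lambda>z. g z $ i) (s k)"
        using gh Gh[of k] by (intro deriv_diff) (auto intro: holomorphic_on_imp_differentiable_at)
      ultimately show ?case using e by (simp add: dist_norm)
    qed
  qed
  moreover have "(\<lambda>k. deriv (\<lambda>z. g z $ i) (s k)) \<longlonglongrightarrow> deriv (\<lambda>z. g z $ i) s0"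
  proof -
    have "continuous_on UNIV (deriv (\<lambda>z. g z $ i))"
      by (intro holomorphic_on_imp_continuous_on holomorphic_deriv gh) auto
    then show ?thesis using s isCont_tendsto_compose continuous_on_eq_continuous_at by blast
  qed
  ultimately have "(\<lambda>k. (deriv (\<lambda>z. G k z $ i) (s k) - deriv (\<lambda>z. g z $ i) (s k)) + deriv (\<lambda>z. g z $ i) (s k)) \<longlonglongrightarrow> 0 + deriv (\<lambda>z. g z $ i) s0"
    by (rule tendsto_add)
  then show "(\<lambda>k. nth_deriv 1 (G k) (s k) $ i) \<longlonglongrightarrow> nth_deriv 1 g s0 $ i" unfolding nth_deriv_1 by simp
qed

text \<open>Maps close to two curves that cross transversally also cross, by Brouwer's theorem.\<close>

lemma transversal_crossing_persists:
  assumes G: "loc_unif_limit G g" and H: "loc_unif_limit H h"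
    and ent: "\<And>n. entire_map (G n)" "\<And>n. entire_map (H n)"
    and gh: "g 0 = h 0" and om: "om (nth_deriv 1 g 0) (nth_deriv 1 h 0) \<noteq> 0" and \<rho>: "\<rho> > 0"
  shows "\<forall>\<^sub>F n in sequentially. \<exists>s t. norm s \<le> \<rho> \<and> norm t \<le> \<rho> \<and> G n s = H n t"
proof -
  let ?u = "nth_deriv 1 g 0" and ?v = "nth_deriv 1 h 0"
  let ?d = "om ?u ?v"
  have gent: "entire_map g" "entire_map h" using entire_map_limit[OF G ent(1)] entire_map_limit[OF H ent(2)] by auto
  \<comment> \<open>inverse of the map \<open>(s, t) \<mapsto> s *s ?u - t *s ?v\<close>\<close>
  define L where "L w = (om w ?v / ?d, om w ?u / ?d)" for w
  have lin: "linear L"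
  proof (rule linearI)
    have "om (c *\<^sub>R x) z = c *\<^sub>R om x z" for c x z by (simp add: om_def scaleR_right_diff_distrib)
    then show "L (c *\<^sub>R x) = c *\<^sub>R L x" for c x by (simp add: L_def scaleR_conv_of_real[where 'a = complex])
  qed (simp add: L_def om_simps add_divide_distrib)
  have bl: "bounded_linear L" using lin by (simp add: linear_conv_bounded_linear)
  have Luv: "L (s *s ?u - t *s ?v) = (s, t)" for s t
  proof -
    have "om (s *s ?u - t *s ?v) ?v = s * ?d" "om (s *s ?u - t *s ?v) ?u = t * ?d"
      by (simp_all add: om_def algebra_simps)
    then show ?thesis using om by (simp add: L_def)
  qed
  obtain K where K: "K > 0" "\<And>w. norm (L w) \<le> K * norm w"
    using bounded_linear.pos_bounded[OF bl] by (metis mult.commute)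
  define \<epsilon> where "\<epsilon> = 1 / (4 * K)"
  have \<epsilon>: "\<epsilon> > 0" using K by (simp add: \<epsilon>_def)
  obtain d1 where d1: "d1 > 0" "\<And>y. norm y < d1 \<Longrightarrow> norm (g y - g 0 - y *s ?u) \<le> \<epsilon> * norm y"
    using entire_map_has_derivative[OF gent(1), of 0] \<epsilon> unfolding has_derivative_at_alt by fastforce
  obtain d2 where d2: "d2 > 0" "\<And>y. norm y < d2 \<Longrightarrow> norm (h y - h 0 - y *s ?v) \<le> \<epsilon> * norm y"
    using entire_map_has_derivative[OF gent(2), of 0] \<epsilon> unfolding has_derivative_at_alt by fastforce
  define r where "r = min \<rho> (min d1 d2 / 2)"
  have r: "r > 0" "r < d1" "r < d2" "r \<le> \<rho>" using d1 d2 \<rho> by (auto simp: r_def)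
  have e: "\<epsilon> * r > 0" using \<epsilon> r by simp
  have "\<forall>\<^sub>F n in sequentially. \<forall>x\<in>cball 0 r. dist (G n x) (g x) < \<epsilon> * r"
    using G e unfolding loc_unif_limit_def by (intro uniform_limitD) auto
  moreover have "\<forall>\<^sub>F n in sequentially. \<forall>x\<in>cball 0 r. dist (H n x) (h x) < \<epsilon> * r"
    using H e unfolding loc_unif_limit_def by (intro uniform_limitD) auto
  ultimately show ?thesis
  proof eventually_elim
    case (elim n)
    \<comment> \<open>\<open>\<Phi>\<close> differs from the identity by at most \<open>r\<close> on the ball of radius \<open>r\<close>\<close>
    define \<Phi> where "\<Phi> p = L (G n (fst p) - H n (snd p))" for p
    have "\<exists>y\<in>cball (0 :: complex \<times> complex) r. \<Phi> y = 0"
    proof (rule brouwer_surjective_cball[of 0 r \<Phi> 0 "{0}"])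
      have c: "continuous_on (cball 0 r) (\<lambda>p. G n (fst p) - H n (snd p))"
        by (intro continuous_intros continuous_on_compose2[OF entire_map_continuous[OF ent(1)[of n], of UNIV]]
            continuous_on_compose2[OF entire_map_continuous[OF ent(2)[of n], of UNIV]]) auto
      show "continuous_on (cball 0 r) \<Phi>" unfolding \<Phi>_def
        by (rule bounded_linear.continuous_on[OF bl c])
      fix x y :: "complex \<times> complex" assume x: "x \<in> {0}" and y: "y \<in> cball 0 r"
      obtain s t where st: "y = (s, t)" by force
      have ns: "norm s \<le> r" "norm t \<le> r" using y norm_fst_le[of s t] norm_snd_le[of t s] by (auto simp: st)
      have "y - \<Phi> y = L ((s *s ?u - t *s ?v) - (G n s - H n t))"
        unfolding linear_diff[OF lin, of "s *s ?u - t *s ?v"] by (simp only: Luv \<Phi>_def st fst_conv snd_conv)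
      also have "(s *s ?u - t *s ?v) - (G n s - H n t) =
         (h t - h 0 - t *s ?v) - (g s - g 0 - s *s ?u) - (G n s - g s) + (H n t - h t)"
        using gh by (simp add: algebra_simps)
      finally have eq: "y - \<Phi> y = L ((h t - h 0 - t *s ?v) - (g s - g 0 - s *s ?u) - (G n s - g s) + (H n t - h t))" .
      have n1: "norm (h t - h 0 - t *s ?v) \<le> \<epsilon> * r"
        using d2(2)[of t] ns r \<epsilon> by (meson le_less_trans mult_left_mono order_trans less_imp_le)
      have n2: "norm (g s - g 0 - s *s ?u) \<le> \<epsilon> * r"
        using d1(2)[of s] ns r \<epsilon> by (meson le_less_trans mult_left_mono order_trans less_imp_le)
      have n3: "norm (G n s - g s) \<le> \<epsilon> * r" "norm (H n t - h t) \<le> \<epsilon> * r"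
        using elim ns by (auto simp: dist_norm intro: less_imp_le)
      have "norm ((h t - h 0 - t *s ?v) - (g s - g 0 - s *s ?u) - (G n s - g s) + (H n t - h t)) \<le> 4 * (\<epsilon> * r)"
      proof -
        have "norm (a - b - c + e) \<le> norm a + norm b + norm c + norm e" for a b c e :: "complex^2" by norm
        from this[of "h t - h 0 - t *s ?v" "g s - g 0 - s *s ?u" "G n s - g s" "H n t - h t"]
        show ?thesis using n1 n2 n3 by linarith
      qed
      then have "norm (y - \<Phi> y) \<le> K * (4 * (\<epsilon> * r))"
        unfolding eq using K by (meson mult_left_mono order_trans less_imp_le)
      also have "\<dots> = r" using K by (simp add: \<epsilon>_def)
      finally show "x + (y - \<Phi> y) \<in> cball 0 r" using x by simp
    qed (use r in auto)
    then obtain s t where st: "(s, t) \<in> cball (0 :: complex \<times> complex) r" "\<Phi> (s, t) = 0" by force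
    have "L (G n s - H n t) = 0" using st(2) by (simp add: \<Phi>_def)
    then have o: "om (G n s - H n t) ?v = 0" "om (G n s - H n t) ?u = 0" using om by (auto simp: L_def zero_prod_def)
    have "G n s - H n t = 0"
    proof (rule ccontr)
      assume nz: "G n s - H n t \<noteq> 0"
      obtain a b where "?v = a *s (G n s - H n t)" "?u = b *s (G n s - H n t)"
        using om_zero_parallel[OF o(1) nz] om_zero_parallel[OF o(2) nz] by blast
      then have "?d = 0" by (simp only: om_simps mult_zero_right)
      then show False using om by contradiction
    qed
    then have "G n s = H n t" by simp
    moreover have "norm s \<le> \<rho>" "norm t \<le> \<rho>"
      using st(1) norm_fst_le[of s t] norm_snd_le[of t s] r(4) by auto
    ultimately show ?case by blast
  qed
qed

text \<open>Limits of disjoint or equal leaves do not cross transversally: nearby leaves would cross as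
  well, hence coincide, and then an affine change of parameter makes the tangents at the crossing
  point parallel.\<close>

lemma limits_tangent:
  assumes G: "loc_unif_limit G g" and H: "loc_unif_limit H h"
    and imm: "\<And>n. inj_hol_immersion (G n)" "\<And>n. inj_hol_immersion (H n)"
    and gh: "g 0 = h 0"
    and leaves: "\<And>n. range (G n) \<inter> range (H n) = {} \<or> range (G n) = range (H n)"
  shows "om (nth_deriv 1 g 0) (nth_deriv 1 h 0) = 0"
proof (rule ccontr)
  assume om: "om (nth_deriv 1 g 0) (nth_deriv 1 h 0) \<noteq> 0"
  have ent: "\<And>n. entire_map (G n)" "\<And>n. entire_map (H n)" using imm inj_hol_immersionD(1) by auto
  have "\<forall>k. \<exists>n s t. n \<ge> k \<and> norm s \<le> inverse (real (Suc k)) \<and> norm t \<le> inverse (real (Suc k)) \<and> G n s = H n t"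
  proof
    fix k
    have "\<forall>\<^sub>F n in sequentially. \<exists>s t. norm s \<le> inverse (real (Suc k)) \<and> norm t \<le> inverse (real (Suc k)) \<and> G n s = H n t"
      by (rule transversal_crossing_persists[OF G H ent gh om]) simp
    then have "\<forall>\<^sub>F n in sequentially. n \<ge> k \<and> (\<exists>s t. norm s \<le> inverse (real (Suc k)) \<and> norm t \<le> inverse (real (Suc k)) \<and> G n s = H n t)"
      using eventually_ge_at_top[of k] by eventually_elim auto
    then show "\<exists>n s t. n \<ge> k \<and> norm s \<le> inverse (real (Suc k)) \<and> norm t \<le> inverse (real (Suc k)) \<and> G n s = H n t"
      unfolding eventually_sequentially by blast
  qed
  from choice[OF this] obtain m where
    "\<forall>k. \<exists>s t. m k \<ge> k \<and> norm s \<le> inverse (real (Suc k)) \<and> norm t \<le> inverse (real (Suc k)) \<and> G (m k) s = H (m k) t" by blast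
  from choice[OF this] obtain s where
    "\<forall>k. \<exists>t. m k \<ge> k \<and> norm (s k) \<le> inverse (real (Suc k)) \<and> norm t \<le> inverse (real (Suc k)) \<and> G (m k) (s k) = H (m k) t" by blast
  from choice[OF this] obtain t where
    st: "\<And>k. m k \<ge> k" "\<And>k. norm (s k) \<le> inverse (real (Suc k))" "\<And>k. norm (t k) \<le> inverse (real (Suc k))"
      "\<And>k. G (m k) (s k) = H (m k) (t k)" by blast
  have m: "filterlim m at_top sequentially"
    using st(1) by (intro filterlim_at_top_mono[OF filterlim_ident]) auto
  have s0: "s \<longlonglongrightarrow> 0" by (rule Lim_null_comparison[OF _ LIMSEQ_inverse_real_of_nat]) (use st in auto)
  have t0: "t \<longlonglongrightarrow> 0" by (rule Lim_null_comparison[OF _ LIMSEQ_inverse_real_of_nat]) (use st in auto)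
  have par: "om (nth_deriv 1 (G (m k)) (s k)) (nth_deriv 1 (H (m k)) (t k)) = 0" for k
  proof -
    have "range (G (m k)) = range (H (m k))"
      using leaves[of "m k"] st(4)[of k] by (metis IntI empty_iff rangeI)
    then obtain a b where ab: "b \<noteq> 0" "\<And>w. H (m k) w = G (m k) (a + b * w)"
      using reparametrization_affine[OF imm(1) imm(2)] by metis
    have "s k = a + b * t k" using st(4)[of k] ab(2)[of "t k"] inj_hol_immersionD(2)[OF imm(1)[of "m k"]]
      by (metis injD)
    then have d: "(G (m k) has_derivative (\<lambda>h. h *s nth_deriv 1 (G (m k)) (s k))) (at (a + b * t k))"
      using entire_map_has_derivative[OF ent(1)] by metis
    have "((\<lambda>w. a + b * w) has_derivative (\<lambda>h. b * h)) (at (t k))" by (auto intro!: derivative_eq_intros)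
    from has_derivative_compose[OF this d]
    have "(H (m k) has_derivative (\<lambda>h. (b * h) *s nth_deriv 1 (G (m k)) (s k))) (at (t k))"
      using ab(2) by (simp add: fun_eq_iff[symmetric] cong: if_cong) (metis (no_types, lifting) ext)
    then have "(H (m k) has_derivative (\<lambda>h. h *s (b *s nth_deriv 1 (G (m k)) (s k)))) (at (t k))"
      by (simp add: vector_smult_assoc mult.commute)
    then have "nth_deriv 1 (H (m k)) (t k) = b *s nth_deriv 1 (G (m k)) (s k)" by (rule nth_deriv_1_eqI)
    then show ?thesis by (simp only: om_simps mult_zero_right)
  qed
  have "(\<lambda>k. nth_deriv 1 (G (m k)) (s k)) \<longlonglongrightarrow> nth_deriv 1 g 0"
    by (rule nth_deriv_limit[OF loc_unif_limit_subseq[OF G m] ent(1) s0])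
  moreover have "(\<lambda>k. nth_deriv 1 (H (m k)) (t k)) \<longlonglongrightarrow> nth_deriv 1 h 0"
    by (rule nth_deriv_limit[OF loc_unif_limit_subseq[OF H m] ent(2) t0])
  ultimately have "(\<lambda>k. om (nth_deriv 1 (G (m k)) (s k)) (nth_deriv 1 (H (m k)) (t k))) \<longlonglongrightarrow> om (nth_deriv 1 g 0) (nth_deriv 1 h 0)"
    unfolding om_def by (intro tendsto_intros)
  then show False using om unfolding par by (simp add: LIMSEQ_const_iff)
qed

section \<open>Polynomial maps acting on curves and orbits\<close>

lemma map_le_derivative:
  assumes "map_le N f"
  obtains f' where "\<And>z. (f has_derivative f' z) (at z)" "\<And>z c v. f' z (c *s v) = c *s f' z v"
    "\<And>z v z0 v0. z \<longlonglongrightarrow> z0 \<Longrightarrow> v \<longlonglongrightarrow> v0 \<Longrightarrow> (\<lambda>n. f' (z n) (v n)) \<longlonglongrightarrow> f' z0 v0"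
proof -
  have le: "poly_le N (\<lambda>z. f z $ i)" for i using assms by (simp add: map_le_def)
  obtain P1 P2 where P: "lower N P1" "lower N P2"
    "\<And>z. ((\<lambda>z. f z $ 1) has_derivative (\<lambda>h. P1 z * h $ 1 + P2 z * h $ 2)) (at z)"
    by (rule poly_le_deriv[OF le[of 1]]) (rule that)
  obtain Q1 Q2 where Q: "lower N Q1" "lower N Q2"
    "\<And>z. ((\<lambda>z. f z $ 2) has_derivative (\<lambda>h. Q1 z * h $ 1 + Q2 z * h $ 2)) (at z)"
    by (rule poly_le_deriv[OF le[of 2]]) (rule that)
  define f' where "f' z h = pair2 (P1 z * h $ 1 + P2 z * h $ 2) (Q1 z * h $ 1 + Q2 z * h $ 2)"
    for z h :: "complex^2"
  have lim: "(\<lambda>n. F (z n)) \<longlonglongrightarrow> F z0" if "lower N F" "z \<longlonglongrightarrow> z0" for F and z :: "nat \<Rightarrow> complex^2" and z0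
    using poly_le_continuous[OF lower_imp_poly_le[OF that(1)], of UNIV] that(2)
    by (metis continuous_on_eq_continuous_within UNIV_I isCont_tendsto_compose)
  show ?thesis
  proof (rule that[of f'])
    show "(f has_derivative f' z) (at z)" for z
      using has_derivative_pair2[OF P(3) Q(3), of z] by (simp add: pair2_eta f'_def[abs_def])
    show "f' z (c *s v) = c *s f' z v" for z c and v :: "complex^2" by (simp add: f'_def pair2_eq_iff algebra_simps)
    show "(\<lambda>n. f' (z n) (v n)) \<longlonglongrightarrow> f' z0 v0" if "z \<longlonglongrightarrow> z0" "v \<longlonglongrightarrow> v0"
      for z v :: "nat \<Rightarrow> complex^2" and z0 v0
    proof (rule vec_tendstoI)
      fix i :: 2
      have 1: "(\<lambda>n. P1 (z n) * v n $ 1 + P2 (z n) * v n $ 2) \<longlonglongrightarrow> P1 z0 * v0 $ 1 + P2 z0 * v0 $ 2"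
        by (intro tendsto_intros lim that P Q)
      have 2: "(\<lambda>n. Q1 (z n) * v n $ 1 + Q2 (z n) * v n $ 2) \<longlonglongrightarrow> Q1 z0 * v0 $ 1 + Q2 z0 * v0 $ 2"
        by (intro tendsto_intros lim that P Q)
      show "(\<lambda>n. f' (z n) (v n) $ i) \<longlonglongrightarrow> f' z0 v0 $ i"
        using exhaust_2[of i] 1 2 by (auto simp: f'_def)
    qed
  qed
qed

lemma entire_mapI:
  assumes "\<And>z. \<exists>v. (g has_derivative (\<lambda>h. h *s v)) (at z)"
  shows "entire_map g"
  unfolding entire_map_def
proof
  fix i
  have "(\<lambda>z. g z $ i) field_differentiable (at z)" for z
  proof -
    obtain v where v: "(g has_derivative (\<lambda>h. h *s v)) (at z)" using assms by blast
    have "(\<lambda>h. (h *s v) $ i) = (*) (v $ i)" by (auto simp: mult.commute)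
    then show ?thesis using bounded_linear.has_derivative[OF bounded_linear_vec_nth v, of i]
      unfolding field_differentiable_def has_field_derivative_def by (intro exI[of _ "v $ i"]) (simp only:)
  qed
  then show "(\<lambda>z. g z $ i) holomorphic_on UNIV"
    by (simp add: holomorphic_on_def field_differentiable_at_within)
qed

lemma compose_curve_derivative:
  assumes "(f has_derivative f') (at (g z))" "\<And>c v. f' (c *s v) = c *s f' v" "entire_map g"
  shows "((\<lambda>z. f (g z)) has_derivative (\<lambda>h. h *s f' (nth_deriv 1 g z))) (at z)"
  using has_derivative_compose[OF entire_map_has_derivative[OF assms(3)] assms(1)] by (simp add: assms(2))

lemma rescale_curve_derivative:
  assumes "entire_map g"
  shows "((\<lambda>z. g (c * z)) has_derivative (\<lambda>h. h *s (c *s nth_deriv 1 g (c * z)))) (at z)"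
proof -
  have "((\<lambda>z. c * z) has_derivative (\<lambda>h. c * h)) (at z)" by (auto intro!: derivative_eq_intros)
  from has_derivative_compose[OF this entire_map_has_derivative[OF assms]]
  show ?thesis by (simp add: vector_smult_assoc mult.commute)
qed

lemma poly_diffeo_compose_immersion:
  assumes f: "poly_diffeo f" and g: "inj_hol_immersion g"
  shows "inj_hol_immersion (f \<circ> g)"
proof -
  note gD = inj_hol_immersionD[OF g]
  obtain f' where f': "\<And>z. (f has_derivative f' z) (at z)" "\<And>z c v. f' z (c *s v) = c *s f' z v"
    by (rule map_le_derivative[OF poly_diffeo_map_le(1)[OF f]]) (rule that)
  obtain F' where F': "\<And>z. (inv f has_derivative F' z) (at z)" "\<And>z c v. F' z (c *s v) = c *s F' z v"
    by (rule map_le_derivative[OF poly_diffeo_map_le(2)[OF f]]) (rule that)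
  have d: "((f \<circ> g) has_derivative (\<lambda>h. h *s f' (g z) (nth_deriv 1 g z))) (at z)" for z
    unfolding o_def by (rule compose_curve_derivative[OF f' gD(1)])
  have ent: "entire_map (f \<circ> g)" by (rule entire_mapI) (use d in blast)
  have nd: "nth_deriv 1 (f \<circ> g) z = f' (g z) (nth_deriv 1 g z)" for z by (rule nth_deriv_1_eqI[OF d])
  have "nth_deriv 1 (f \<circ> g) z \<noteq> 0" for z
  proof
    assume z0: "nth_deriv 1 (f \<circ> g) z = 0"
    have "((\<lambda>z. inv f ((f \<circ> g) z)) has_derivative (\<lambda>h. h *s F' ((f \<circ> g) z) (nth_deriv 1 (f \<circ> g) z))) (at z)"
      by (rule compose_curve_derivative[OF F' ent])
    moreover have "(\<lambda>z. inv f ((f \<circ> g) z)) = g" by (auto simp: poly_diffeo_inverse[OF f])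
    ultimately have "nth_deriv 1 g z = F' ((f \<circ> g) z) 0" unfolding z0 using nth_deriv_1_eqI by metis
    also have "\<dots> = 0" using F'(2)[of "(f \<circ> g) z" 0 0] by simp
    finally show False using gD(3) by blast
  qed
  moreover have "inj (f \<circ> g)" using f gD(2) by (simp add: poly_diffeo_def bij_is_inj inj_compose)
  ultimately show ?thesis using ent by (simp add: inj_hol_immersion_def)
qed

text \<open>At a periodic point of \<open>f\<close> the derivative of the inverse has the inverse eigenvalues, so the
  contracted and the expanded direction are exchanged.\<close>

lemma saddle_points_inv_subset:
  assumes f: "poly_diffeo f"
  shows "saddle_points f \<subseteq> saddle_points (inv f)"
proof
  fix x assume "x \<in> saddle_points f"
  then obtain n A \<alpha> \<beta> v w where s: "n \<ge> 1" "(f ^^ n) x = x" "((f ^^ n) has_derivative A) (at x)"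
    "v \<noteq> 0" "A v = \<alpha> *s v" "cmod \<alpha> < 1" "w \<noteq> 0" "A w = \<beta> *s w" "cmod \<beta> > 1"
    unfolding saddle_points_def by blast
  have fn: "poly_diffeo (f ^^ n)" by (rule poly_diffeo_funpow[OF f])
  have invn: "(inv f) ^^ n = inv (f ^^ n)" using f by (simp add: poly_diffeo_def inv_fn)
  obtain B where B: "\<And>z. (inv (f ^^ n) has_derivative B z) (at z)" "\<And>z c v. B z (c *s v) = c *s B z v"
    by (rule map_le_derivative[OF poly_diffeo_map_le(2)[OF fn]]) (rule that)
  have "((\<lambda>z. inv (f ^^ n) ((f ^^ n) z)) has_derivative (\<lambda>h. B ((f ^^ n) x) (A h))) (at x)"
    by (rule has_derivative_compose[OF s(3) B(1)])
  then have "((\<lambda>z. z) has_derivative (\<lambda>h. B x (A h))) (at x)"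
    by (simp add: poly_diffeo_inverse[OF fn] s(2))
  then have "(\<lambda>h. B x (A h)) = (\<lambda>h. h)" using has_derivative_unique has_derivative_ident by blast
  then have BA: "B x (A h) = h" for h by meson
  have eig: "\<gamma> \<noteq> 0 \<and> B x u = inverse \<gamma> *s u" if "u \<noteq> 0" "A u = \<gamma> *s u" for u \<gamma>
  proof -
    have e: "\<gamma> *s B x u = u" using BA[of u] that(2) B(2) by simp
    then have "\<gamma> \<noteq> 0" using that(1) by auto
    then show ?thesis using arg_cong[OF e, of "\<lambda>y. inverse \<gamma> *s y"] by (simp add: vector_smult_assoc)
  qed
  have a: "\<alpha> \<noteq> 0" "B x v = inverse \<alpha> *s v" using eig[OF s(4,5)] by auto
  have b: "\<beta> \<noteq> 0" "B x w = inverse \<beta> *s w" using eig[OF s(7,8)] by auto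
  have "cmod (inverse \<alpha>) > 1" using a(1) s(6) by (simp add: norm_inverse one_less_inverse)
  moreover have "cmod (inverse \<beta>) < 1" using s(9) by (simp add: norm_inverse inverse_less_1_iff)
  moreover have "((inv f) ^^ n) x = x" using s(2) poly_diffeo_inverse(1)[OF fn, of x] by (simp add: invn)
  moreover have "((inv f) ^^ n has_derivative B x) (at x)" unfolding invn by (rule B(1))
  ultimately show "x \<in> saddle_points (inv f)"
    unfolding saddle_points_def using s(1,4,7) a(2) b(2) by blast
qed

lemma J_star_inv:
  assumes f: "poly_diffeo f"
  shows "J_star (inv f) = J_star f"
proof -
  have "inv (inv f) = f" using f by (simp add: poly_diffeo_def inv_inv_eq)
  then have "saddle_points (inv f) = saddle_points f"
    using saddle_points_inv_subset[OF f] saddle_points_inv_subset[OF poly_diffeo_inv[OF f]] by simp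
  then show ?thesis by (simp add: J_star_def)
qed

text \<open>The limit set of a bounded orbit is invariant. If it is finite, \<open>f\<close> permutes it, and the
  limit point nearest to the orbit at time \<open>n\<close> is eventually carried by \<open>f\<close> to the one nearest at
  time \<open>n + 1\<close>. Hence the orbit is asymptotic to that of one of these points.\<close>

lemma finite_limit_set_shadowing:
  fixes f :: "complex^2 \<Rightarrow> complex^2"
  assumes cont: "continuous_on UNIV f" and inj: "inj f" and bnd: "bounded (range (\<lambda>n. (f ^^ n) r))"
    and fin: "finite C" and lim: "\<And>m x. strict_mono m \<Longrightarrow> (\<lambda>k. (f ^^ m k) r) \<longlonglongrightarrow> x \<Longrightarrow> x \<in> C"
  shows "\<exists>p\<in>C. r \<in> W_stable f p"
proof -
  define \<Omega> where "\<Omega> = {x. \<exists>m. strict_mono (m :: nat \<Rightarrow> nat) \<and> (\<lambda>k. (f ^^ m k) r) \<longlonglongrightarrow> x}"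
  have \<Omega>C: "\<Omega> \<subseteq> C" using lim by (auto simp: \<Omega>_def)
  then have fin\<Omega>: "finite \<Omega>" using fin finite_subset by blast
  have isC: "isCont f x" for x using cont by (simp add: continuous_on_eq_continuous_at)
  have "f x \<in> \<Omega>" if x: "x \<in> \<Omega>" for x
  proof -
    obtain m where m: "strict_mono (m :: nat \<Rightarrow> nat)" "(\<lambda>k. (f ^^ m k) r) \<longlonglongrightarrow> x" using x by (auto simp: \<Omega>_def)
    have "(\<lambda>k. f ((f ^^ m k) r)) \<longlonglongrightarrow> f x" by (rule isCont_tendsto_compose[OF isC m(2)])
    then have "(\<lambda>k. (f ^^ (Suc \<circ> m) k) r) \<longlonglongrightarrow> f x" by simp
    moreover have "strict_mono (Suc \<circ> m)" using m(1) by (simp add: strict_mono_def)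
    ultimately show ?thesis unfolding \<Omega>_def by blast
  qed
  then have f\<Omega>: "f ` \<Omega> \<subseteq> \<Omega>" by blast
  then have surj: "f ` \<Omega> = \<Omega>" using endo_inj_surj[OF fin\<Omega>] inj inj_on_subset by blast
  \<comment> \<open>by compactness the orbit approaches the set of its limit points\<close>
  have near: "\<forall>\<^sub>F n in sequentially. \<exists>c\<in>\<Omega>. dist ((f ^^ n) r) c < e" if e: "e > 0" for e
  proof (rule ccontr)
    assume neg: "\<not> ?thesis"
    then have "infinite {n. \<not> (\<exists>c\<in>\<Omega>. dist ((f ^^ n) r) c < e)}"
      by (simp add: not_eventually frequently_sequentially infinite_nat_iff_unbounded_le)
    then obtain m :: "nat \<Rightarrow> nat" where m: "strict_mono m" "\<And>k. m k \<in> {n. \<not> (\<exists>c\<in>\<Omega>. dist ((f ^^ n) r) c < e)}"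
      using infinite_enumerate by blast
    have "bounded (range (\<lambda>k. (f ^^ m k) r))" by (rule bounded_subset[OF bnd]) auto
    then obtain x s where s: "strict_mono (s :: nat \<Rightarrow> nat)" "((\<lambda>k. (f ^^ m k) r) \<circ> s) \<longlonglongrightarrow> x"
      using bounded_imp_convergent_subsequence by blast
    have "x \<in> \<Omega>" unfolding \<Omega>_def using strict_mono_o[OF m(1) s(1)] s(2)
      by (intro CollectI exI[of _ "m \<circ> s"]) (simp add: o_def)
    moreover obtain k where "dist ((f ^^ m (s k)) r) x < e"
      using tendstoD[OF s(2) e] unfolding eventually_sequentially by auto
    ultimately show False using m(2)[of "s k"] by blast
  qed
  obtain \<sigma> where \<sigma>: "\<sigma> > 0" "\<And>a b. a \<in> \<Omega> \<Longrightarrow> b \<in> \<Omega> \<Longrightarrow> dist a b < \<sigma> \<Longrightarrow> a = b"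
  proof -
    have "\<exists>d>0. \<forall>a\<in>\<Omega>. \<forall>b\<in>\<Omega>. dist a b < d \<longrightarrow> a = b"
    proof (cases "\<exists>a\<in>\<Omega>. \<exists>b\<in>\<Omega>. a \<noteq> b")
      case False then show ?thesis by (intro exI[of _ 1]) auto
    next
      case True
      let ?D = "(\<lambda>(a, b). dist a b) ` {p \<in> \<Omega> \<times> \<Omega>. fst p \<noteq> snd p}"
      have finD: "finite ?D" using fin\<Omega> by simp
      have "?D \<noteq> {}" using True by auto
      then have "Min ?D \<in> ?D" using finD by (intro Min_in)
      then have "Min ?D > 0" by auto
      moreover have "a = b" if "a \<in> \<Omega>" "b \<in> \<Omega>" "dist a b < Min ?D" for a b
      proof (rule ccontr)
        assume "a \<noteq> b"
        then have "dist a b \<in> ?D" using that by (auto simp: image_iff intro!: bexI[of _ "(a, b)"])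
        then show False using Min_le[OF finD] that(3) by (meson not_less)
      qed
      ultimately show ?thesis by blast
    qed
    then show thesis using that by blast
  qed
  have "\<forall>c\<in>\<Omega>. \<exists>\<eta>>0. \<forall>z. dist z c < \<eta> \<longrightarrow> dist (f z) (f c) < \<sigma> / 2"
    using isC \<sigma>(1) unfolding continuous_at_eps_delta by (meson half_gt_zero)
  from bchoice[OF this] obtain \<eta> where \<eta>: "\<And>c. c \<in> \<Omega> \<Longrightarrow> \<eta> c > 0"
    "\<And>c z. c \<in> \<Omega> \<Longrightarrow> dist z c < \<eta> c \<Longrightarrow> dist (f z) (f c) < \<sigma> / 2" by blast
  obtain \<eta>0 where \<eta>0: "\<eta>0 > 0" "\<And>c. c \<in> \<Omega> \<Longrightarrow> \<eta>0 \<le> \<eta> c"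
  proof (cases "\<Omega> = {}")
    case True then show thesis using that[of 1] by simp
  next
    case False
    show thesis by (rule that[of "Min (\<eta> ` \<Omega>)"]) (use False fin\<Omega> \<eta>(1) in auto)
  qed
  define \<epsilon> where "\<epsilon> = min \<eta>0 (\<sigma> / 2)"
  have \<epsilon>: "\<epsilon> > 0" using \<eta>0 \<sigma> by (simp add: \<epsilon>_def)
  obtain N where N: "\<And>n. n \<ge> N \<Longrightarrow> \<exists>c\<in>\<Omega>. dist ((f ^^ n) r) c < \<epsilon>"
    using near[OF \<epsilon>] unfolding eventually_sequentially by blast
  then have "\<forall>n. \<exists>c. n \<ge> N \<longrightarrow> c \<in> \<Omega> \<and> dist ((f ^^ n) r) c < \<epsilon>" by blast
  from choice[OF this] obtain c where c: "\<And>n. n \<ge> N \<Longrightarrow> c n \<in> \<Omega>" "\<And>n. n \<ge> N \<Longrightarrow> dist ((f ^^ n) r) (c n) < \<epsilon>" by blast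
  have step: "f (c n) = c (Suc n)" if n: "n \<ge> N" for n
  proof (rule \<sigma>(2))
    show "f (c n) \<in> \<Omega>" "c (Suc n) \<in> \<Omega>" using c(1) f\<Omega> n by auto
    have "dist ((f ^^ n) r) (c n) < \<eta> (c n)" using c[OF n] \<eta>0(2)[of "c n"] by (simp add: \<epsilon>_def)
    then have "dist (f ((f ^^ n) r)) (f (c n)) < \<sigma> / 2" using \<eta>(2) c(1)[OF n] by blast
    moreover have "dist ((f ^^ Suc n) r) (c (Suc n)) < \<sigma> / 2" using c(2)[of "Suc n"] n by (simp add: \<epsilon>_def)
    ultimately show "dist (f (c n)) (c (Suc n)) < \<sigma>"
      using dist_triangle_half_r[of "f ((f ^^ n) r)" "f (c n)" \<sigma> "c (Suc n)"] by simp
  qed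
  have "(f ^^ n) ` \<Omega> = \<Omega>" for n
  proof (induction n)
    case (Suc n)
    then show ?case by (simp only: funpow.simps(2) image_comp[symmetric] surj)
  qed simp
  then have "c N \<in> (f ^^ N) ` \<Omega>" using c(1)[of N] by simp
  then obtain p where p: "p \<in> \<Omega>" "(f ^^ N) p = c N" by auto
  have orb: "(f ^^ (N + k)) p = c (N + k)" for k
  proof (induction k)
    case (Suc k) then show ?case using step[of "N + k"] by simp
  qed (use p in simp)
  have "(\<lambda>n. dist ((f ^^ n) r) ((f ^^ n) p)) \<longlonglongrightarrow> 0"
  proof (rule tendstoI)
    fix e :: real assume e: "e > 0"
    then have "\<forall>\<^sub>F n in sequentially. \<exists>c\<in>\<Omega>. dist ((f ^^ n) r) c < min e (\<sigma> / 2)" using \<sigma>(1) by (intro near) simp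
    then show "\<forall>\<^sub>F n in sequentially. dist (dist ((f ^^ n) r) ((f ^^ n) p)) 0 < e"
      using eventually_ge_at_top[of N]
    proof eventually_elim
      case (elim n)
      then obtain c' where c': "c' \<in> \<Omega>" "dist ((f ^^ n) r) c' < min e (\<sigma> / 2)" by blast
      have "dist ((f ^^ n) r) (c n) < \<sigma> / 2" using c(2)[OF elim(2)] by (simp add: \<epsilon>_def)
      then have "c' = c n" using c' c(1)[OF elim(2)] \<sigma>(2) dist_triangle_half_r[of "(f ^^ n) r" c' \<sigma> "c n"] by simp
      moreover have "(f ^^ n) p = c n" using orb[of "n - N"] elim(2) by simp
      ultimately show ?case using c'(2) by simp
    qed
  qed
  then show ?thesis using p(1) \<Omega>C unfolding W_stable_def by blast
qed

section \<open>Quasi-expanding maps\<close>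

text \<open>A polynomial diffeomorphism of dynamical degree greater than one with a normal normalized
  invariant family. The range of \<open>\<psi> x\<close> is called the leaf of \<open>x\<close>; the leaves need not be embedded.\<close>

locale quasi_expanding_map =
  fixes f :: "complex^2 \<Rightarrow> complex^2" and S :: "(complex^2) set" and \<psi> :: "complex^2 \<Rightarrow> complex \<Rightarrow> complex^2"
  assumes diffeo: "poly_diffeo f" and dyn: "dyn_degree f > 1" and qe: "quasi_expanding f S \<psi>"
begin

lemma family:
  shows SJ: "S \<subseteq> J_star f" and JS: "J_star f \<subseteq> closure S" and fS: "f ` S = S"
    and imm: "x \<in> S \<Longrightarrow> inj_hol_immersion (\<psi> x)"
    and inv_leaf: "x \<in> S \<Longrightarrow> f ` range (\<psi> x) = range (\<psi> (f x))"
    and leaves: "x1 \<in> S \<Longrightarrow> x2 \<in> S \<Longrightarrow> range (\<psi> x1) \<inter> range (\<psi> x2) = {} \<or> range (\<psi> x1) = range (\<psi> x2)"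
    and at0: "x \<in> S \<Longrightarrow> \<psi> x 0 = x"
    and G_eq: "x \<in> S \<Longrightarrow> \<exists>\<zeta>\<in>cball 0 1. G_plus f (\<psi> x \<zeta>) = 1"
    and G_le: "x \<in> S \<Longrightarrow> \<zeta> \<in> cball 0 1 \<Longrightarrow> G_plus f (\<psi> x \<zeta>) \<le> 1"
proof -
  note q = qe[unfolded quasi_expanding_def normalized_invariant_family_def]
  show "S \<subseteq> J_star f" using q by (elim conjE)
  show "J_star f \<subseteq> closure S" using q by (elim conjE)
  show "f ` S = S" using q by (elim conjE)
  have 1: "\<forall>x\<in>S. inj_hol_immersion (\<psi> x)" using q by (elim conjE)
  have 2: "\<forall>x\<in>S. f ` range (\<psi> x) = range (\<psi> (f x))" using q by (elim conjE)
  have 3: "\<forall>x1\<in>S. \<forall>x2\<in>S. range (\<psi> x1) \<inter> range (\<psi> x2) = {} \<or> range (\<psi> x1) = range (\<psi> x2)"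
 using q by (elim conjE)
  have 4: "\<forall>x\<in>S. \<psi> x 0 = x \<and> (\<exists>\<zeta>\<in>cball 0 1. G_plus f (\<psi> x \<zeta>) = 1) \<and>
      (\<forall>\<zeta>\<in>cball 0 1. G_plus f (\<psi> x \<zeta>) \<le> 1)"
    using q by (elim conjE)
  show "x \<in> S \<Longrightarrow> inj_hol_immersion (\<psi> x)" by (rule bspec[OF 1])
  show "x \<in> S \<Longrightarrow> f ` range (\<psi> x) = range (\<psi> (f x))" by (rule bspec[OF 2])
  show "x1 \<in> S \<Longrightarrow> x2 \<in> S \<Longrightarrow> range (\<psi> x1) \<inter> range (\<psi> x2) = {} \<or> range (\<psi> x1) = range (\<psi> x2)"
    by (rule bspec[OF bspec[OF 3]])
  show "x \<in> S \<Longrightarrow> \<psi> x 0 = x" "x \<in> S \<Longrightarrow> \<exists>\<zeta>\<in>cball 0 1. G_plus f (\<psi> x \<zeta>) = 1"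
    "x \<in> S \<Longrightarrow> \<zeta> \<in> cball 0 1 \<Longrightarrow> G_plus f (\<psi> x \<zeta>) \<le> 1"
    using bspec[OF 4, of x] by simp_all
qed

lemma ent: "x \<in> S \<Longrightarrow> entire_map (\<psi> x)"
  using imm inj_hol_immersionD(1) by blast

lemma normal:
  assumes "\<And>n. x n \<in> S"
  obtains r g where "strict_mono (r :: nat \<Rightarrow> nat)" "loc_unif_limit (\<lambda>j. \<psi> (x (r j))) g"
proof -
  have nf: "normal_family (\<psi> ` S)" using qe by (simp add: quasi_expanding_def)
  have "\<forall>n. (\<lambda>n. \<psi> (x n)) n \<in> \<psi> ` S" using assms by blast
  then obtain r g where "strict_mono (r :: nat \<Rightarrow> nat)" "loc_unif_limit ((\<lambda>n. \<psi> (x n)) \<circ> r) g"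
    using spec[OF nf[unfolded normal_family_def], of "\<lambda>n. \<psi> (x n)"] by blast
  then show ?thesis using that by (simp add: o_def)
qed

lemma cont: "continuous_on A f"
  using map_le_continuous poly_diffeo_map_le(1)[OF diffeo] .

lemma isCont_iterate: "isCont (f ^^ n) x"
  using map_le_funpow_continuous[OF poly_diffeo_map_le(1)[OF diffeo], of n]
  by (simp add: continuous_on_eq_continuous_at)

lemma S_iterate: "x \<in> S \<Longrightarrow> (f ^^ n) x \<in> S"
  using fS by (induction n) auto

lemma closure_S: "closure S = J_star f"
  using SJ JS closure_minimal[of S "J_star f"] by (auto simp: J_star_def)

lemma J_iterate: "x \<in> J_star f \<Longrightarrow> (f ^^ n) x \<in> J_star f"
proof (induction n)
  case (Suc n)
  have "f ` closure S \<subseteq> closure (f ` S)" by (rule image_closure_subset) (auto intro: cont closure_subset[THEN subsetD])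
  then show ?case using Suc closure_S fS by auto
qed simp

text \<open>Normality bounds the parametrizations uniformly on every disk.\<close>

lemma uniform_bound: "\<exists>B. \<forall>x\<in>S. \<forall>\<zeta>. norm \<zeta> \<le> R \<longrightarrow> norm (\<psi> x \<zeta>) \<le> B"
proof (rule ccontr)
  assume neg: "\<not> ?thesis"
  have "\<forall>n. \<exists>x \<zeta>. x \<in> S \<and> norm \<zeta> \<le> R \<and> norm (\<psi> x \<zeta>) > real n" using neg by (meson not_le)
  from choice[OF this] obtain x where "\<forall>n. \<exists>\<zeta>. x n \<in> S \<and> norm \<zeta> \<le> R \<and> norm (\<psi> (x n) \<zeta>) > real n" by blast
  from choice[OF this] obtain \<zeta> where x: "\<And>n. x n \<in> S" "\<And>n. norm (\<zeta> n) \<le> R" "\<And>n. norm (\<psi> (x n) (\<zeta> n)) > real n" by blast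
  obtain r g where r: "strict_mono (r :: nat \<Rightarrow> nat)" "loc_unif_limit (\<lambda>j. \<psi> (x (r j))) g"
    by (rule normal[OF x(1)]) (rule that)
  have "entire_map g" by (rule entire_map_limit[OF r(2) ent[OF x(1)]])
  then have "compact (g ` cball 0 R)" by (intro compact_continuous_image entire_map_continuous) auto
  then have "bounded (g ` cball 0 R)" by (rule compact_imp_bounded)
  then obtain M where M: "\<And>z. norm z \<le> R \<Longrightarrow> norm (g z) \<le> M"
    unfolding bounded_iff by (metis imageI mem_cball_0)
  have "uniform_limit (cball 0 R) (\<lambda>j. \<psi> (x (r j))) g sequentially" using r(2) by (simp add: loc_unif_limit_def)
  then have "\<forall>\<^sub>F j in sequentially. \<forall>z\<in>cball 0 R. dist (\<psi> (x (r j)) z) (g z) < 1" by (rule uniform_limitD) simp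
  moreover have "\<forall>\<^sub>F j in sequentially. M + 1 < real j" using filterlim_real_sequentially by (simp add: filterlim_at_top_dense)
  ultimately have "\<forall>\<^sub>F j in sequentially. False"
  proof eventually_elim
    case (elim j)
    have "norm (\<psi> (x (r j)) (\<zeta> (r j))) \<le> M + 1"
    proof -
      have "dist (\<psi> (x (r j)) (\<zeta> (r j))) (g (\<zeta> (r j))) < 1" using elim(1) x(2)[of "r j"] by simp
      moreover have "norm (\<psi> (x (r j)) (\<zeta> (r j))) \<le> norm (g (\<zeta> (r j))) + dist (\<psi> (x (r j)) (\<zeta> (r j))) (g (\<zeta> (r j)))"
        by norm
      ultimately show ?thesis using M[OF x(2)[of "r j"]] by linarith
    qed
    moreover have "real j \<le> real (r j)" using strict_mono_imp_increasing[OF r(1)] by simp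
    ultimately show ?case using x(3)[of "r j"] elim(2) by linarith
  qed
  then show False by simp
qed

lemma J_bounded: "bounded (J_star f)"
proof -
  obtain B where "\<forall>x\<in>S. \<forall>\<zeta>. norm \<zeta> \<le> 0 \<longrightarrow> norm (\<psi> x \<zeta>) \<le> B" using uniform_bound by blast
  then have "\<forall>x\<in>S. norm x \<le> B" using at0 by force
  then have "bounded S" unfolding bounded_iff by blast
  then show ?thesis using bounded_closure closure_S by metis
qed

lemma orbit_bounded: "x \<in> J_star f \<Longrightarrow> bounded (range (\<lambda>n. (f ^^ n) x))"
  by (rule bounded_subset[OF J_bounded]) (use J_iterate in blast)

text \<open>The normalization survives in the limit: otherwise the escape rate would tend to zero on the
  unit disks.\<close>

lemma limit_not_in_K_plus:
  assumes x: "\<And>n. x n \<in> S" and g: "loc_unif_limit (\<lambda>n. \<psi> (x n)) g"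
  obtains \<zeta> where "g \<zeta> \<notin> K_plus f"
proof -
  have "\<forall>n. \<exists>\<zeta>. \<zeta> \<in> cball 0 1 \<and> G_plus f (\<psi> (x n) \<zeta>) = 1" using G_eq[OF x] by blast
  from choice[OF this] obtain \<zeta> where \<zeta>: "\<And>n. \<zeta> n \<in> cball 0 1" "\<And>n. G_plus f (\<psi> (x n) (\<zeta> n)) = 1" by blast
  have "compact (cball (0::complex) 1)" by simp
  then obtain l s where s: "strict_mono (s :: nat \<Rightarrow> nat)" "(\<zeta> \<circ> s) \<longlonglongrightarrow> l"
    using \<zeta>(1) unfolding compact_def by blast
  have "(\<lambda>k. \<psi> (x (s k)) ((\<zeta> \<circ> s) k)) \<longlonglongrightarrow> g l"
    by (rule loc_unif_limit_pointwise[OF loc_unif_limit_subseq[OF g filterlim_subseq[OF s(1)]] ent[OF x] s(2)])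
  then have "g l \<in> K_plus f \<Longrightarrow> (\<lambda>k. G_plus f (\<psi> (x (s k)) ((\<zeta> \<circ> s) k))) \<longlonglongrightarrow> 0"
    by (rule green_function(2)[OF diffeo dyn])
  then have "g l \<notin> K_plus f" by (auto simp: \<zeta>(2) LIMSEQ_const_iff)
  then show ?thesis by (rule that)
qed

lemma limit_at_0:
  assumes x: "\<And>n. x n \<in> S" and g: "loc_unif_limit (\<lambda>n. \<psi> (x n)) g"
  shows "x \<longlonglongrightarrow> g 0" "g 0 \<in> J_star f"
proof -
  have "(\<lambda>n. \<psi> (x n) 0) \<longlonglongrightarrow> g 0"
    by (rule loc_unif_limit_pointwise[OF g ent[OF x] tendsto_const])
  then show "x \<longlonglongrightarrow> g 0" using at0[OF x] by simp
  then show "g 0 \<in> J_star f" unfolding closure_S[symmetric] using x closure_sequential by blast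
qed

lemma limit_nonconstant:
  assumes x: "\<And>n. x n \<in> S" and g: "loc_unif_limit (\<lambda>n. \<psi> (x n)) g"
  shows "\<exists>\<zeta>. g \<zeta> \<noteq> g 0"
proof (rule ccontr)
  assume "\<not> ?thesis"
  moreover have "g 0 \<in> K_plus f" using orbit_bounded limit_at_0(2)[OF x g] by (simp add: K_plus_def)
  ultimately show False using limit_not_in_K_plus[OF x g] by metis
qed

text \<open>\<open>f ^^ n\<close> maps the leaf of \<open>x\<close> onto that of its image, so it is affine in the parameters; it is
  linear since it fixes the parameter \<open>0\<close>.\<close>

lemma ex_multiplier:
  assumes x: "x \<in> S"
  shows "\<exists>l. \<forall>\<zeta>. (f ^^ n) (\<psi> x \<zeta>) = \<psi> ((f ^^ n) x) (l * \<zeta>)"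
proof -
  have ran: "(f ^^ n) ` range (\<psi> x) = range (\<psi> ((f ^^ n) x))"
  proof (induction n)
    case (Suc n)
    have "(f ^^ Suc n) ` A = f ` (f ^^ n) ` A" for A by (simp add: image_image)
    then have "(f ^^ Suc n) ` range (\<psi> x) = f ` (f ^^ n) ` range (\<psi> x)" .
    also have "\<dots> = range (\<psi> (f ((f ^^ n) x)))" unfolding Suc by (rule inv_leaf[OF S_iterate[OF x]])
    finally show ?case by simp
  qed simp
  have h2: "inj_hol_immersion ((f ^^ n) \<circ> \<psi> x)"
    by (rule poly_diffeo_compose_immersion[OF poly_diffeo_funpow[OF diffeo] imm[OF x]])
  have h1: "inj_hol_immersion (\<psi> ((f ^^ n) x))" by (rule imm[OF S_iterate[OF x]])
  have "range (\<psi> ((f ^^ n) x)) = range ((f ^^ n) \<circ> \<psi> x)" using ran by (simp only: image_comp)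
  then obtain a b where ab: "\<And>w. ((f ^^ n) \<circ> \<psi> x) w = \<psi> ((f ^^ n) x) (a + b * w)"
    using reparametrization_affine[OF h1 h2] by metis
  have "\<psi> ((f ^^ n) x) a = \<psi> ((f ^^ n) x) 0"
    using ab[of 0] at0[OF x] at0[OF S_iterate[OF x, of n]] by simp
  then have "a = 0" using inj_hol_immersionD(2)[OF h1] by (auto dest: injD)
  then show ?thesis using ab by (intro exI[of _ b]) simp
qed

text \<open>The multiplier of \<open>f ^^ n\<close> along the leaf of \<open>x\<close>. It is meaningful for \<open>x \<in> S\<close> only, and is
  unique there because \<open>\<psi>\<close> is injective on parameters.\<close>

definition mult :: "nat \<Rightarrow> complex^2 \<Rightarrow> complex" where
  "mult n x = (SOME l. \<forall>\<zeta>. (f ^^ n) (\<psi> x \<zeta>) = \<psi> ((f ^^ n) x) (l * \<zeta>))"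

lemma mult: "x \<in> S \<Longrightarrow> (f ^^ n) (\<psi> x \<zeta>) = \<psi> ((f ^^ n) x) (mult n x * \<zeta>)"
  unfolding mult_def using someI_ex[OF ex_multiplier] by blast

lemma mult_add:
  assumes x: "x \<in> S"
  shows "mult (m + n) x = mult m ((f ^^ n) x) * mult n x"
proof -
  have "\<psi> ((f ^^ (m + n)) x) (mult (m + n) x * 1) = (f ^^ (m + n)) (\<psi> x 1)" using mult[OF x] by simp
  also have "\<dots> = (f ^^ m) ((f ^^ n) (\<psi> x 1))" by (simp add: funpow_add)
  also have "\<dots> = \<psi> ((f ^^ m) ((f ^^ n) x)) (mult m ((f ^^ n) x) * (mult n x * 1))"
    by (simp only: mult[OF x] mult[OF S_iterate[OF x]])
  also have "\<dots> = \<psi> ((f ^^ (m + n)) x) (mult m ((f ^^ n) x) * mult n x)" by (simp add: funpow_add)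
  finally show ?thesis
    using inj_hol_immersionD(2)[OF imm[OF S_iterate[OF x, of "m + n"]]] by (auto dest: injD)
qed

text \<open>The escape rate attains the value one on the closed unit disk of the leaf of \<open>x\<close>, where \<open>f ^^ n\<close>
  multiplies it by a factor greater than one when \<open>n > 0\<close>; so the image of this disk is not contained
  in the unit disk.\<close>

lemma mult_ge_1:
  assumes x: "x \<in> S"
  shows "1 \<le> norm (mult n x)"
proof (rule ccontr)
  assume "\<not> ?thesis"
  then have lt: "norm (mult n x) < 1" by simp
  then have n: "n > 0"
  proof (cases n)
    case 0
    have "\<psi> x (mult 0 x * 1) = \<psi> x 1" using mult[OF x, of 0 1] by simp
    then have "mult 0 x = 1" using inj_hol_immersionD(2)[OF imm[OF x]] by (auto dest: injD)
    then show ?thesis using lt 0 by simp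
  qed simp
  obtain \<zeta> where \<zeta>: "\<zeta> \<in> cball 0 1" "G_plus f (\<psi> x \<zeta>) = 1" using G_eq[OF x] by blast
  have "norm (mult n x * \<zeta>) \<le> 1 * 1" unfolding norm_mult using lt \<zeta>(1) by (intro mult_mono) auto
  then have "G_plus f (\<psi> ((f ^^ n) x) (mult n x * \<zeta>)) \<le> 1" by (intro G_le S_iterate x) simp
  then have "dyn_degree f ^ n \<le> 1"
    using G_plus_scaling[OF diffeo dyn, of n "\<psi> x \<zeta>"] \<zeta>(2) mult[OF x, of n \<zeta>] by simp
  moreover have "dyn_degree f ^ n > 1" using dyn n by simp
  ultimately show False by simp
qed

lemma mult_mono:
  assumes x: "x \<in> S" and "k \<le> n"
  shows "norm (mult k x) \<le> norm (mult n x)"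
proof -
  have "mult n x = mult (n - k) ((f ^^ k) x) * mult k x" using mult_add[OF x, of "n - k" k] assms(2) by simp
  then show ?thesis using mult_ge_1[OF S_iterate[OF x], of "n - k" k]
    by (simp add: norm_mult mult_le_cancel_right1)
qed

text \<open>Uniform expansion: if the multipliers of arbitrarily long orbit segments stayed bounded,
  a limit of the corresponding leaves would have bounded forward orbits.\<close>

lemma mult_unbounded: "\<exists>N. \<forall>n\<ge>N. \<forall>x\<in>S. M < norm (mult n x)"
proof (rule ccontr)
  assume neg: "\<not> ?thesis"
  have "\<forall>n. \<exists>x. x \<in> S \<and> norm (mult n x) \<le> M"
  proof
    fix n
    obtain m x where "m \<ge> n" "x \<in> S" "norm (mult m x) \<le> M" using neg by (meson not_le)
    then show "\<exists>x. x \<in> S \<and> norm (mult n x) \<le> M" using mult_mono order_trans by blast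
  qed
  from choice[OF this] obtain x where x: "\<And>n. x n \<in> S" "\<And>n. norm (mult n (x n)) \<le> M" by blast
  obtain r g where r: "strict_mono (r :: nat \<Rightarrow> nat)" "loc_unif_limit (\<lambda>j. \<psi> (x (r j))) g"
    by (rule normal[OF x(1)]) (rule that)
  obtain \<zeta> where \<zeta>: "g \<zeta> \<notin> K_plus f" by (rule limit_not_in_K_plus[OF x(1) r(2)])
  obtain B where B: "\<forall>y\<in>S. \<forall>z. norm z \<le> M * norm \<zeta> \<longrightarrow> norm (\<psi> y z) \<le> B" using uniform_bound by blast
  have "norm ((f ^^ k) (g \<zeta>)) \<le> B" for k
  proof -
    have "(\<lambda>j. \<psi> (x (r j)) \<zeta>) \<longlonglongrightarrow> g \<zeta>"
      by (rule loc_unif_limit_pointwise[OF r(2) ent[OF x(1)] tendsto_const])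
    then have "(\<lambda>j. (f ^^ k) (\<psi> (x (r j)) \<zeta>)) \<longlonglongrightarrow> (f ^^ k) (g \<zeta>)"
      by (rule isCont_tendsto_compose[OF isCont_iterate])
    then have "(\<lambda>j. norm ((f ^^ k) (\<psi> (x (r j)) \<zeta>))) \<longlonglongrightarrow> norm ((f ^^ k) (g \<zeta>))" by (rule tendsto_norm)
    moreover have "norm ((f ^^ k) (\<psi> (x (r j)) \<zeta>)) \<le> B" if "j \<ge> k" for j
    proof -
      have "k \<le> r j" using strict_mono_imp_increasing[OF r(1), of j] that by simp
      then have "norm (mult k (x (r j))) \<le> M" using mult_mono[OF x(1)] x(2) order_trans by blast
      then have "norm (mult k (x (r j)) * \<zeta>) \<le> M * norm \<zeta>" unfolding norm_mult by (intro mult_right_mono) auto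
      then show ?thesis unfolding mult[OF x(1)] using B S_iterate[OF x(1)] by blast
    qed
    ultimately show ?thesis by (intro LIMSEQ_le_const2[of _ _ B]) auto
  qed
  then have "g \<zeta> \<in> K_plus f" unfolding K_plus_def bounded_iff by blast
  then show False using \<zeta> by blast
qed

lemma limit_mapsE:
  assumes "g \<in> limit_maps S \<psi> x"
  obtains y where "\<And>j. y j \<in> S" "y \<longlonglongrightarrow> x" "loc_unif_limit (\<lambda>j. \<psi> (y j)) g" "entire_map g" "g 0 = x"
proof -
  obtain y where y: "\<And>j. y j \<in> S" "y \<longlonglongrightarrow> x" "loc_unif_limit (\<lambda>j. \<psi> (y j)) g" "entire_map g"
    using assms unfolding limit_maps_def by blast
  have "g 0 = x" using LIMSEQ_unique[OF limit_at_0(1)[OF y(1,3)] y(2)] .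
  then show ?thesis using that y by blast
qed

lemma limit_maps_nonempty:
  assumes "x \<in> J_star f"
  shows "\<exists>g. g \<in> limit_maps S \<psi> x"
proof -
  obtain y where y: "\<And>j. y j \<in> S" "y \<longlonglongrightarrow> x" using assms closure_S closure_sequential by metis
  obtain r g where r: "strict_mono (r :: nat \<Rightarrow> nat)" "loc_unif_limit (\<lambda>j. \<psi> (y (r j))) g"
    by (rule normal[OF y(1)]) (rule that)
  have "(\<lambda>j. y (r j)) \<longlonglongrightarrow> x" using LIMSEQ_subseq_LIMSEQ[OF y(2) r(1)] by (simp add: o_def)
  moreover have "entire_map g" by (rule entire_map_limit[OF r(2) ent[OF y(1)]])
  ultimately show ?thesis unfolding limit_maps_def using y(1) r(2)
    by (intro exI[of _ g] CollectI conjI exI[of _ "\<lambda>j. y (r j)"]) auto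
qed

text \<open>The order is well defined because limit maps are not constant.\<close>

lemma Ord_eq_1_iff:
  assumes g: "g \<in> limit_maps S \<psi> x"
  shows "Ord g \<ge> 1" "Ord g = 1 \<longleftrightarrow> nth_deriv 1 g 0 \<noteq> 0"
proof -
  obtain y where y: "\<And>j. y j \<in> S" "loc_unif_limit (\<lambda>j. \<psi> (y j)) g" "entire_map g"
    using limit_mapsE[OF g] by metis
  have "\<exists>n. n \<ge> 1 \<and> nth_deriv n g 0 \<noteq> 0"
  proof (rule ccontr)
    assume neg: "\<not> ?thesis"
    have "g \<zeta> $ i = g 0 $ i" for \<zeta> i
    proof (rule holomorphic_fun_eq_const_on_connected[of "\<lambda>z. g z $ i" UNIV 0 \<zeta>])
      show "(\<lambda>z. g z $ i) holomorphic_on UNIV" using y(3) by (simp add: entire_map_def)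
      show "(deriv ^^ n) (\<lambda>z. g z $ i) 0 = 0" if "0 < n" for n
      proof -
        have "nth_deriv n g 0 = 0" using neg that by auto
        then have "nth_deriv n g 0 $ i = 0" by simp
        then show ?thesis by (simp add: nth_deriv_def)
      qed
    qed auto
    then show False using limit_nonconstant[OF y(1,2)] by (metis vec_eq_iff)
  qed
  then have ord: "Ord g \<ge> 1 \<and> nth_deriv (Ord g) g 0 \<noteq> 0" unfolding Ord_def by (rule LeastI_ex)
  then show "Ord g \<ge> 1" by blast
  show "Ord g = 1 \<longleftrightarrow> nth_deriv 1 g 0 \<noteq> 0"
  proof
    assume "nth_deriv 1 g 0 \<noteq> 0"
    then have "Ord g \<le> 1" unfolding Ord_def by (intro Least_le) simp
    then show "Ord g = 1" using ord by simp
  qed (use ord in metis)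
qed

lemma tau_eq_1D:
  assumes "tau S \<psi> x = 1" "g \<in> limit_maps S \<psi> x"
  shows "nth_deriv 1 g 0 \<noteq> 0"
proof -
  have "enat (Ord g) \<le> 1" using assms unfolding tau_def by (metis SUP_upper)
  then have "Ord g \<le> 1" by (metis enat_ord_simps(1) one_enat_def)
  then show ?thesis using Ord_eq_1_iff[OF assms(2)] by simp
qed

text \<open>At a point with \<open>\<tau> = 1\<close> the line \<open>E\<close> is well defined and spanned by the derivative of any
  limit map, since the derivatives of two limit maps are parallel by \<open>limits_tangent\<close>.\<close>

lemma E_line_eq:
  assumes tau: "tau S \<psi> x = 1" and g: "g \<in> limit_maps S \<psi> x"
  shows "E_line S \<psi> x = vec.span {nth_deriv 1 g 0}"
proof -
  have *: "vec.span {nth_deriv (Ord h) h 0} = vec.span {nth_deriv 1 g 0}" if h: "h \<in> limit_maps S \<psi> x" for h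
  proof -
    have nz: "nth_deriv 1 h 0 \<noteq> 0" "nth_deriv 1 g 0 \<noteq> 0" using tau_eq_1D[OF tau] g h by auto
    then have o: "Ord h = 1" using Ord_eq_1_iff[OF h] by simp
    obtain y where y: "\<And>j. y j \<in> S" "loc_unif_limit (\<lambda>j. \<psi> (y j)) g" "g 0 = x" using limit_mapsE[OF g] by metis
    obtain z where z: "\<And>j. z j \<in> S" "loc_unif_limit (\<lambda>j. \<psi> (z j)) h" "h 0 = x" using limit_mapsE[OF h] by metis
    have "om (nth_deriv 1 g 0) (nth_deriv 1 h 0) = 0"
      by (rule limits_tangent[OF y(2) z(2) imm[OF y(1)] imm[OF z(1)]]) (use y(3) z(3) leaves[OF y(1) z(1)] in auto)
    then obtain c where c: "nth_deriv 1 h 0 = c *s nth_deriv 1 g 0" using om_zero_parallel nz(2) by blast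
    then have c0: "c \<noteq> 0" using nz(1) by auto
    have "vec.span {c *s nth_deriv 1 g 0} = vec.span {nth_deriv 1 g 0}"
      unfolding vec.span_singleton
    proof (intro set_eqI iffI)
      fix u assume "u \<in> range (\<lambda>k. k *s nth_deriv 1 g 0)"
      then obtain k where "u = k *s nth_deriv 1 g 0" by blast
      then have "u = (k / c) *s (c *s nth_deriv 1 g 0)" using c0 by (simp add: vector_smult_assoc)
      then show "u \<in> range (\<lambda>k. k *s (c *s nth_deriv 1 g 0))" by blast
    qed (auto simp: vector_smult_assoc)
    then show ?thesis unfolding o c .
  qed
  show ?thesis unfolding E_line_def
  proof (rule the_equality)
    show "\<forall>h\<in>limit_maps S \<psi> x. vec.span {nth_deriv 1 g 0} = vec.span {nth_deriv (Ord h) h 0}" using * by simp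
    fix L assume "\<forall>h\<in>limit_maps S \<psi> x. L = vec.span {nth_deriv (Ord h) h 0}"
    then show "L = vec.span {nth_deriv 1 g 0}" using * g by metis
  qed
qed

text \<open>Normality again: a sequence of derivatives tending to infinity has no convergent subsequence.\<close>

lemma derivative_bound: "\<exists>B>0. \<forall>x\<in>S. norm (nth_deriv 1 (\<psi> x) 0) \<le> B"
proof (rule ccontr)
  assume neg: "\<not> ?thesis"
  have "\<forall>n. \<exists>x. x \<in> S \<and> norm (nth_deriv 1 (\<psi> x) 0) > real (Suc n)"
    using neg by (metis of_nat_0_less_iff not_le zero_less_Suc)
  from choice[OF this] obtain x where x: "\<And>n. x n \<in> S" "\<And>n. norm (nth_deriv 1 (\<psi> (x n)) 0) > real (Suc n)" by blast
  obtain r g where r: "strict_mono (r :: nat \<Rightarrow> nat)" "loc_unif_limit (\<lambda>j. \<psi> (x (r j))) g"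
    by (rule normal[OF x(1)]) (rule that)
  have "(\<lambda>j. nth_deriv 1 (\<psi> (x (r j))) 0) \<longlonglongrightarrow> nth_deriv 1 g 0"
    by (rule nth_deriv_limit[OF r(2) ent[OF x(1)] tendsto_const])
  then obtain B where B: "\<And>j. norm (nth_deriv 1 (\<psi> (x (r j))) 0) \<le> B"
    using convergent_imp_bounded[of "\<lambda>j. nth_deriv 1 (\<psi> (x (r j))) 0"] unfolding bounded_iff by blast
  obtain n :: nat where "B < real n" using reals_Archimedean2 by blast
  moreover have "real n \<le> real (r n)" using strict_mono_imp_increasing[OF r(1), of n] by simp
  ultimately show False using B[of n] x(2)[of "r n"] by simp
qed

end

section \<open>Tangencies\<close>

text \<open>Let \<open>g\<close> and \<open>h\<close> be an unstable and a stable limit map at \<open>r\<close> with parallel derivatives at \<open>0\<close>.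
  Stable multipliers have modulus at least one, so the derivative of \<open>f ^^ n\<close> at \<open>r\<close> applied to the
  common direction is bounded independently of \<open>n\<close>. If \<open>f ^^ n\<close> expands the unstable leaves by more
  than \<open>\<Lambda>\<close>, then some unstable parametrizations close to \<open>(f ^^ n) r\<close> have derivatives of size at most
  \<open>M / \<Lambda>\<close>.\<close>

lemma small_derivative_near_orbit:
  assumes u: "quasi_expanding_map f Su \<psi>u" and s: "quasi_expanding_map (inv f) Ss \<psi>s"
    and g: "g \<in> limit_maps Su \<psi>u r" and h: "h \<in> limit_maps Ss \<psi>s r"
    and c: "c \<noteq> 0" "nth_deriv 1 h 0 = c *s nth_deriv 1 g 0"
  obtains M where "M > 0"
    "\<And>n \<Lambda> \<epsilon>. \<Lambda> > 0 \<Longrightarrow> \<forall>x\<in>Su. \<Lambda> < norm (quasi_expanding_map.mult f \<psi>u n x) \<Longrightarrow> \<epsilon> > 0 \<Longrightarrow>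
       \<exists>w\<in>Su. dist w ((f ^^ n) r) < \<epsilon> \<and> norm (nth_deriv 1 (\<psi>u w) 0) \<le> M / \<Lambda>"
proof -
  interpret U: quasi_expanding_map f Su \<psi>u by fact
  interpret V: quasi_expanding_map "inv f" Ss \<psi>s by fact
  note inv = poly_diffeo_inverse[OF U.diffeo]
  obtain B where B: "B > 0" "\<forall>x\<in>Ss. norm (nth_deriv 1 (\<psi>s x) 0) \<le> B" using V.derivative_bound by blast
  define M where "M = B / norm c + 1"
  have Mpos: "M > 0" using B(1) by (simp add: M_def add_nonneg_pos)
  obtain y where y: "\<And>j. y j \<in> Su" "y \<longlonglongrightarrow> r" "loc_unif_limit (\<lambda>j. \<psi>u (y j)) g"
    using U.limit_mapsE[OF g] by metis
  obtain z where z: "\<And>j. z j \<in> Ss" "z \<longlonglongrightarrow> r" "loc_unif_limit (\<lambda>j. \<psi>s (z j)) h"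
    using V.limit_mapsE[OF h] by metis
  have fSs: "f x \<in> Ss" if "x \<in> Ss" for x
  proof -
    have "x \<in> inv f ` Ss" using V.fS that by simp
    then show ?thesis using inv(2) by auto
  qed
  have fnSs: "(f ^^ n) x \<in> Ss" if "x \<in> Ss" for x n using that fSs by (induction n) auto
  have a: "(\<lambda>j. nth_deriv 1 (\<psi>u (y j)) 0) \<longlonglongrightarrow> nth_deriv 1 g 0"
    by (rule nth_deriv_limit[OF y(3) U.ent[OF y(1)] tendsto_const])
  have b: "(\<lambda>j. nth_deriv 1 (\<psi>s (z j)) 0) \<longlonglongrightarrow> nth_deriv 1 h 0"
    by (rule nth_deriv_limit[OF z(3) V.ent[OF z(1)] tendsto_const])
  have "\<exists>w\<in>Su. dist w ((f ^^ n) r) < \<epsilon> \<and> norm (nth_deriv 1 (\<psi>u w) 0) \<le> M / \<Lambda>"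
    if \<Lambda>: "\<Lambda> > 0" "\<forall>x\<in>Su. \<Lambda> < norm (U.mult n x)" and \<epsilon>: "\<epsilon> > 0" for n \<Lambda> \<epsilon>
  proof -
    have fn: "poly_diffeo (f ^^ n)" by (rule poly_diffeo_funpow[OF U.diffeo])
    have invn: "(inv f ^^ n) ((f ^^ n) x) = x" "(f ^^ n) ((inv f ^^ n) x) = x" for x
      using poly_diffeo_inverse[OF fn] inv_fn[of f n] U.diffeo by (auto simp: poly_diffeo_def)
    obtain f' where f': "\<And>z. (f ^^ n has_derivative f' z) (at z)" "\<And>z c v. f' z (c *s v) = c *s f' z v"
      "\<And>z v z0 v0. z \<longlonglongrightarrow> z0 \<Longrightarrow> v \<longlonglongrightarrow> v0 \<Longrightarrow> (\<lambda>n. f' (z n) (v n)) \<longlonglongrightarrow> f' z0 v0"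
      by (rule map_le_derivative[OF poly_diffeo_map_le(1)[OF fn]]) (rule that)
    \<comment> \<open>along unstable leaves the derivative is multiplied by the expansion factor\<close>
    have E1: "f' x (nth_deriv 1 (\<psi>u x) 0) = U.mult n x *s nth_deriv 1 (\<psi>u ((f ^^ n) x)) 0" if x: "x \<in> Su" for x
    proof -
      have "((\<lambda>\<zeta>. (f ^^ n) (\<psi>u x \<zeta>)) has_derivative (\<lambda>h. h *s f' (\<psi>u x 0) (nth_deriv 1 (\<psi>u x) 0))) (at 0)"
        by (rule compose_curve_derivative[OF f'(1,2) U.ent[OF x]])
      then have "nth_deriv 1 (\<lambda>\<zeta>. (f ^^ n) (\<psi>u x \<zeta>)) 0 = f' x (nth_deriv 1 (\<psi>u x) 0)"
        unfolding U.at0[OF x] by (rule nth_deriv_1_eqI)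
      moreover have "nth_deriv 1 (\<lambda>\<zeta>. \<psi>u ((f ^^ n) x) (U.mult n x * \<zeta>)) 0 = U.mult n x *s nth_deriv 1 (\<psi>u ((f ^^ n) x)) (U.mult n x * 0)"
        by (rule nth_deriv_1_eqI[OF rescale_curve_derivative[OF U.ent[OF U.S_iterate[OF x]]]])
      ultimately show ?thesis unfolding U.mult[OF x] by simp
    qed
    \<comment> \<open>along stable leaves it stays bounded\<close>
    have E2: "norm (f' x (nth_deriv 1 (\<psi>s x) 0)) \<le> B" if x: "x \<in> Ss" for x
    proof -
      let ?t = "(f ^^ n) x" let ?\<mu> = "V.mult n ?t"
      have t: "?t \<in> Ss" by (rule fnSs[OF x])
      have eq: "\<psi>s ?t \<zeta> = (f ^^ n) (\<psi>s x (?\<mu> * \<zeta>))" for \<zeta>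
        using V.mult[OF t, of n \<zeta>] invn by metis
      have d: "((\<lambda>\<zeta>. \<psi>s x (?\<mu> * \<zeta>)) has_derivative (\<lambda>h. h *s (?\<mu> *s nth_deriv 1 (\<psi>s x) (?\<mu> * w)))) (at w)" for w
        by (rule rescale_curve_derivative[OF V.ent[OF x]])
      have e: "entire_map (\<lambda>\<zeta>. \<psi>s x (?\<mu> * \<zeta>))" by (rule entire_mapI) (use d in blast)
      have "((\<lambda>\<zeta>. (f ^^ n) (\<psi>s x (?\<mu> * \<zeta>))) has_derivative (\<lambda>h. h *s f' (\<psi>s x (?\<mu> * 0)) (nth_deriv 1 (\<lambda>\<zeta>. \<psi>s x (?\<mu> * \<zeta>)) 0))) (at 0)"
        by (rule compose_curve_derivative[OF f'(1,2) e])
      then have "nth_deriv 1 (\<psi>s ?t) 0 = f' (\<psi>s x (?\<mu> * 0)) (nth_deriv 1 (\<lambda>\<zeta>. \<psi>s x (?\<mu> * \<zeta>)) 0)"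
        unfolding eq[symmetric] by (rule nth_deriv_1_eqI)
      also have "nth_deriv 1 (\<lambda>\<zeta>. \<psi>s x (?\<mu> * \<zeta>)) 0 = ?\<mu> *s nth_deriv 1 (\<psi>s x) (?\<mu> * 0)"
        by (rule nth_deriv_1_eqI[OF d])
      finally have "nth_deriv 1 (\<psi>s ?t) 0 = ?\<mu> *s f' x (nth_deriv 1 (\<psi>s x) 0)"
        using V.at0[OF x] f'(2) by simp
      then have "norm (nth_deriv 1 (\<psi>s ?t) 0) = norm ?\<mu> * norm (f' x (nth_deriv 1 (\<psi>s x) 0))"
        by (simp only: norm_smult)
      moreover have "1 * norm (f' x (nth_deriv 1 (\<psi>s x) 0)) \<le> norm ?\<mu> * norm (f' x (nth_deriv 1 (\<psi>s x) 0))"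
        by (intro mult_right_mono V.mult_ge_1 t) simp
      moreover have "norm (nth_deriv 1 (\<psi>s ?t) 0) \<le> B" using B(2) t by blast
      ultimately show ?thesis by linarith
    qed
    have "(\<lambda>j. norm (f' (z j) (nth_deriv 1 (\<psi>s (z j)) 0))) \<longlonglongrightarrow> norm (f' r (nth_deriv 1 h 0))"
      by (intro tendsto_norm f'(3) z(2) b)
    then have "norm (f' r (nth_deriv 1 h 0)) \<le> B"
      by (rule LIMSEQ_le_const2) (use E2 z(1) in blast)
    then have "norm c * norm (f' r (nth_deriv 1 g 0)) \<le> B" unfolding c(2) f'(2) norm_smult .
    then have "norm (f' r (nth_deriv 1 g 0)) \<le> B / norm c" using c(1) by (simp add: field_simps)
    then have "norm (f' r (nth_deriv 1 g 0)) < M" by (simp add: M_def)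
    moreover have "(\<lambda>j. norm (f' (y j) (nth_deriv 1 (\<psi>u (y j)) 0))) \<longlonglongrightarrow> norm (f' r (nth_deriv 1 g 0))"
      by (intro tendsto_norm f'(3) y(2) a)
    ultimately have "\<forall>\<^sub>F j in sequentially. norm (f' (y j) (nth_deriv 1 (\<psi>u (y j)) 0)) < M"
      using order_tendstoD(2) by blast
    moreover have "\<forall>\<^sub>F j in sequentially. dist ((f ^^ n) (y j)) ((f ^^ n) r) < \<epsilon>"
      by (rule tendstoD[OF isCont_tendsto_compose[OF U.isCont_iterate y(2)] \<epsilon>])
    ultimately have "\<forall>\<^sub>F j in sequentially. norm (f' (y j) (nth_deriv 1 (\<psi>u (y j)) 0)) < M \<and> dist ((f ^^ n) (y j)) ((f ^^ n) r) < \<epsilon>"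
      by (rule eventually_conj)
    then obtain j where j: "norm (f' (y j) (nth_deriv 1 (\<psi>u (y j)) 0)) < M" "dist ((f ^^ n) (y j)) ((f ^^ n) r) < \<epsilon>"
      unfolding eventually_sequentially by auto
    let ?w = "(f ^^ n) (y j)"
    have "\<Lambda> * norm (nth_deriv 1 (\<psi>u ?w) 0) \<le> norm (U.mult n (y j)) * norm (nth_deriv 1 (\<psi>u ?w) 0)"
      using bspec[OF \<Lambda>(2) y(1)[of j]] by (intro mult_right_mono) auto
    also have "\<dots> < M" using j(1) unfolding E1[OF y(1)] norm_smult .
    finally have "norm (nth_deriv 1 (\<psi>u ?w) 0) \<le> M / \<Lambda>" using \<Lambda>(1) by (simp add: field_simps)
    then show ?thesis using j(2) U.S_iterate[OF y(1)] by blast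
  qed
  then show ?thesis using that[OF Mpos] by blast
qed

text \<open>As the multipliers tend to infinity uniformly, the unstable parametrizations degenerate along
  the forward orbit, and some limit map at each limit point of the orbit has vanishing derivative.\<close>

lemma limit_points_singular:
  assumes u: "quasi_expanding_map f Su \<psi>u" and s: "quasi_expanding_map (inv f) Ss \<psi>s"
    and g: "g \<in> limit_maps Su \<psi>u r" and h: "h \<in> limit_maps Ss \<psi>s r"
    and c: "c \<noteq> 0" "nth_deriv 1 h 0 = c *s nth_deriv 1 g 0"
    and m: "strict_mono (m :: nat \<Rightarrow> nat)" and x: "(\<lambda>k. (f ^^ m k) r) \<longlonglongrightarrow> x"
  shows "x \<in> J_star f" "tau Su \<psi>u x \<noteq> 1"
proof -
  interpret U: quasi_expanding_map f Su \<psi>u by fact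
  obtain M where M: "M > 0"
    "\<And>n \<Lambda> \<epsilon>. \<Lambda> > 0 \<Longrightarrow> \<forall>x\<in>Su. \<Lambda> < norm (U.mult n x) \<Longrightarrow> \<epsilon> > 0 \<Longrightarrow>
       \<exists>w\<in>Su. dist w ((f ^^ n) r) < \<epsilon> \<and> norm (nth_deriv 1 (\<psi>u w) 0) \<le> M / \<Lambda>"
    by (rule small_derivative_near_orbit[OF u s g h c]) (rule that)
  have "\<forall>k. \<exists>w. w \<in> Su \<and> dist w x \<le> 2 * inverse (real (Suc k)) \<and> norm (nth_deriv 1 (\<psi>u w) 0) \<le> inverse (real (Suc k))"
  proof
    fix k
    let ?e = "inverse (real (Suc k))"
    have e: "?e > 0" by simp
    obtain N where N: "\<forall>n\<ge>N. \<forall>x\<in>Su. M * real (Suc k) < norm (U.mult n x)" using U.mult_unbounded by blast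
    obtain K where K: "\<And>i. i \<ge> K \<Longrightarrow> dist ((f ^^ m i) r) x < ?e"
      using tendstoD[OF x e] unfolding eventually_sequentially by blast
    let ?i = "max K N"
    have "m ?i \<ge> N" using strict_mono_imp_increasing[OF m, of ?i] by simp
    then obtain w where w: "w \<in> Su" "dist w ((f ^^ m ?i) r) < ?e" "norm (nth_deriv 1 (\<psi>u w) 0) \<le> M / (M * real (Suc k))"
      using M(2)[of "M * real (Suc k)" "m ?i" ?e] N M(1) e by auto
    have Me: "M / (M * real (Suc k)) = ?e" using M(1) by (simp only: divide_inverse inverse_mult_distrib) simp
    have "dist w x \<le> 2 * ?e"
      using w(2) K[of ?i] dist_triangle[of w x "(f ^^ m ?i) r"] by simp
    then show "\<exists>w. w \<in> Su \<and> dist w x \<le> 2 * ?e \<and> norm (nth_deriv 1 (\<psi>u w) 0) \<le> ?e"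
      using w(1) w(3)[unfolded Me] by (intro exI[of _ w] conjI)
  qed
  from choice[OF this] obtain w where w: "\<And>k. w k \<in> Su" "\<And>k. dist (w k) x \<le> 2 * inverse (real (Suc k))"
    "\<And>k. norm (nth_deriv 1 (\<psi>u (w k)) 0) \<le> inverse (real (Suc k))" by blast
  have "(\<lambda>k. 2 * inverse (real (Suc k))) \<longlonglongrightarrow> 0"
    using tendsto_mult_left[OF LIMSEQ_inverse_real_of_nat, of 2] by simp
  then have "(\<lambda>k. dist (w k) x) \<longlonglongrightarrow> 0" by (rule Lim_null_comparison[rotated]) (use w(2) in auto)
  then have wx: "w \<longlonglongrightarrow> x" by (rule tendsto_dist_iff[THEN iffD2])
  then show "x \<in> J_star f" unfolding U.closure_S[symmetric] using w(1) closure_sequential by blast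
  have d0: "(\<lambda>k. nth_deriv 1 (\<psi>u (w k)) 0) \<longlonglongrightarrow> 0"
    by (rule Lim_null_comparison[OF _ LIMSEQ_inverse_real_of_nat]) (use w(3) in auto)
  obtain q G where q: "strict_mono (q :: nat \<Rightarrow> nat)" "loc_unif_limit (\<lambda>j. \<psi>u (w (q j))) G"
    by (rule U.normal[OF w(1)]) (rule that)
  have "(\<lambda>j. w (q j)) \<longlonglongrightarrow> x" using LIMSEQ_subseq_LIMSEQ[OF wx q(1)] by (simp add: o_def)
  moreover have "entire_map G" by (rule entire_map_limit[OF q(2) U.ent[OF w(1)]])
  ultimately have G: "G \<in> limit_maps Su \<psi>u x" unfolding limit_maps_def using w(1) q(2)
    by (intro CollectI conjI exI[of _ "\<lambda>j. w (q j)"]) auto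
  have "(\<lambda>j. nth_deriv 1 (\<psi>u (w (q j))) 0) \<longlonglongrightarrow> nth_deriv 1 G 0"
    by (rule nth_deriv_limit[OF q(2) U.ent[OF w(1)] tendsto_const])
  moreover have "(\<lambda>j. nth_deriv 1 (\<psi>u (w (q j))) 0) \<longlonglongrightarrow> 0"
    using LIMSEQ_subseq_LIMSEQ[OF d0 q(1)] by (simp add: o_def)
  ultimately have "nth_deriv 1 G 0 = 0" using LIMSEQ_unique by blast
  then show "tau Su \<psi>u x \<noteq> 1" using U.tau_eq_1D[OF _ G] by blast
qed

lemma tangency_in_stable_set:
  assumes u: "quasi_expanding_map f Su \<psi>u" and s: "quasi_expanding_map (inv f) Ss \<psi>s"
    and r: "r \<in> J_star f" and tau: "tau Su \<psi>u r = 1" "tau Ss \<psi>s r = 1"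
    and E: "E_line Ss \<psi>s r = E_line Su \<psi>u r"
    and C: "finite C" "\<And>x. x \<in> J_star f \<Longrightarrow> tau Su \<psi>u x \<noteq> 1 \<Longrightarrow> x \<in> C"
  shows "\<exists>p\<in>C. r \<in> W_stable f p"
proof -
  interpret U: quasi_expanding_map f Su \<psi>u by fact
  interpret V: quasi_expanding_map "inv f" Ss \<psi>s by fact
  have rV: "r \<in> J_star (inv f)" using r J_star_inv[OF U.diffeo] by simp
  obtain g where g: "g \<in> limit_maps Su \<psi>u r" using U.limit_maps_nonempty[OF r] by blast
  obtain h where h: "h \<in> limit_maps Ss \<psi>s r" using V.limit_maps_nonempty[OF rV] by blast
  have "vec.span {nth_deriv 1 h 0} = vec.span {nth_deriv 1 g 0}"
    using E unfolding U.E_line_eq[OF tau(1) g] V.E_line_eq[OF tau(2) h] .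
  then have "nth_deriv 1 h 0 \<in> vec.span {nth_deriv 1 g 0}" using vec.span_base by blast
  then obtain c where c: "nth_deriv 1 h 0 = c *s nth_deriv 1 g 0" unfolding vec.span_singleton by blast
  have c0: "c \<noteq> 0" using V.tau_eq_1D[OF tau(2) h] c by auto
  show ?thesis
  proof (rule finite_limit_set_shadowing[OF U.cont _ U.orbit_bounded[OF r] C(1)])
    show "inj f" using U.diffeo by (simp add: poly_diffeo_def bij_is_inj)
    show "x \<in> C" if "strict_mono m" "(\<lambda>k. (f ^^ m k) r) \<longlonglongrightarrow> x" for m :: "nat \<Rightarrow> nat" and x
      using limit_points_singular[OF u s g h c0 c that] C(2) by blast
  qed
qed

theorem proposition8p9:
  fixes f :: "complex^2 \<Rightarrow> complex^2"
    and Su Ss :: "(complex^2) set"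
    and \<psi>u \<psi>s :: "complex^2 \<Rightarrow> complex \<Rightarrow> complex^2"
  assumes "poly_diffeo f"
    and "dyn_degree f > 1"
    and "quasi_expanding f Su \<psi>u"
    and "quasi_contracting f Ss \<psi>s"
    and "finite (singular_locus f Su \<psi>u Ss \<psi>s)"
  shows "\<forall>r\<in>tangencies f Su \<psi>u Ss \<psi>s.
           \<exists>p\<in>singular_locus f Su \<psi>u Ss \<psi>s. \<exists>q\<in>singular_locus f Su \<psi>u Ss \<psi>s.
             r \<in> W_stable f p \<inter> W_unstable f q"
proof
  fix r assume "r \<in> tangencies f Su \<psi>u Ss \<psi>s"
  then have r: "r \<in> J_star f" and E: "E_line Ss \<psi>s r = E_line Su \<psi>u r" by (auto simp: tangencies_def)
  let ?C = "singular_locus f Su \<psi>u Ss \<psi>s"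
  have u: "quasi_expanding_map f Su \<psi>u" using assms(1-3) by (rule quasi_expanding_map.intro)
  have s: "quasi_expanding_map (inv f) Ss \<psi>s"
    using poly_diffeo_inv[OF assms(1)] green_function(3)[OF assms(1,2)] assms(4) by (rule quasi_expanding_map.intro)
  have ii: "inv (inv f) = f" using assms(1) by (simp add: poly_diffeo_def inv_inv_eq)
  have J: "J_star (inv f) = J_star f" by (rule J_star_inv[OF assms(1)])
  show "\<exists>p\<in>?C. \<exists>q\<in>?C. r \<in> W_stable f p \<inter> W_unstable f q"
  proof (cases "r \<in> ?C")
    case True
    have "r \<in> W_stable f r \<inter> W_unstable f r" by (simp add: W_stable_def)
    then show ?thesis using True by blast
  next
    case False
    then have tau: "tau Su \<psi>u r = 1" "tau Ss \<psi>s r = 1" using r by (auto simp: singular_locus_def)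
    have "\<exists>p\<in>?C. r \<in> W_stable f p"
      by (rule tangency_in_stable_set[OF u s r tau E assms(5)]) (auto simp: singular_locus_def)
    moreover have "\<exists>q\<in>?C. r \<in> W_stable (inv f) q"
    proof (rule tangency_in_stable_set[OF s _ _ tau(2,1) E[symmetric] assms(5)])
      show "quasi_expanding_map (inv (inv f)) Su \<psi>u" using u ii by simp
      show "r \<in> J_star (inv f)" using r J by simp
      show "x \<in> ?C" if "x \<in> J_star (inv f)" "tau Ss \<psi>s x \<noteq> 1" for x
        using that J by (auto simp: singular_locus_def)
    qed
    ultimately show ?thesis by blast
  qed
qed

end
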